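(* Let $n\in(5/2,+\infty)$ and $u_0\in\mathscr{A}$. Let $u:(-\mathscr{T},T)\to\mathscr{A}$ be the maximal $\mathscr{A}$-solution of the Euler Cauchy problem with datum $u_0$, and let $(u_j)_{j\ge0}$ be given by $u_j=\frac1j\sum_{\ell=0}^{j-1}\mathscr{P}(u_\ell,u_{j-\ell-1})$ $(j\ge1)$. Let $\tau$ and $\tau_n$ be the convergence radii of $\sum_{j\ge0}u_jt^j$ in $\mathscr{A}$ and in $H^n$, respectively. Then $$\tau\le\tau_n\le\min(\mathscr{T},T)\qquad\text{and}\qquad u(t)=\sum_{j=0}^{\infty}u_jt^j\ \text{ in } H^n,\quad\text{for all } t\in(-\tau_n,\tau_n).$$
   Context: Torus: $\mathbb{T}^3:=(\mathbb{R}/2\pi\mathbb{Z})^3$. $D'$ is the space of $\mathbb{R}^3$-valued distributions on $\mathbb{T}^3$; $v\in D'$ has Fourier coefficients $v_k\in\mathbb{C}^3$ ($k\in\mathbb{Z}^3$), $v=\sum_k v_ke^{ik\cdot x}$, $v_{-k}=\overline{v_k}$. For $a,b\in\mathbb{C}^3$, $a\cdot b=\sum_s a_sb_s$. For real $n\ge0$, $H^n:=\{v\in D' : \sum_k|k|^{2n}|v_k|^2<\infty,\ v_0=0,\ k\cdot v_k=0\ \forall k\}$, a Hilbert space with $\langle v|w\rangle_n=\sum_k|k|^{2n}\overline{v_k}\cdot w_k$ and norm $\|v\|_n$. $\mathscr{A}$ is the space of real-analytic, zero mean, divergence free vector fields $\mathbb{T}^3\to\mathbb{R}^3$. It is the union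 over $\rho>1$ of $\mathscr{A}_\rho:=\{v\in D':\liminf_{k\to\infty}|v_k|^{-1/(|k_1|+|k_2|+|k_3|)}>\rho,\ v_0=0,\ k\cdot v_k=0\}$ (with $0^{-1/m}:=+\infty$), each normed by $\sup|\sum_kv_kz^k|$ over $z\in\mathbb{C}^3$ with $1/\rho\le|z_s|\le\rho$ for $s=1,2,3$; $\mathscr{A}$ carries the locally convex inductive limit topology of these spaces. $\mathscr{A}$ embeds continuously in every $H^n$. $\mathscr{P}(v,w):=-\mathfrak{L}(v\cdot\nabla w)$ with $\mathfrak{L}$ the Leray projection onto divergence free fields; in Fourier terms $\mathscr{P}(v,w)_k=-i\sum_{h}(v_h\cdot(k-h))\,\mathfrak{L}_kw_{k-h}$, where $\mathfrak{L}_kc=c-(k\cdot c)k/|k|^2$ for $k\ne0$, $\mathfrak{L}_0c=c$. $\mathscr{P}$ maps $\mathscr{A}\times\mathscr{A}$ continuously to $\mathscr{A}$, and $H^n\times H^{n+1}$ continuously to $H^n$ for $n>3/2$. The Euler Cauchy problem is $\partial u/\partial t=\mathscr{P}(u,u)$, $u(0)=u_0$. An $\mathscr{A}$-solution is a real-analytic map $u:(-\mathscr{T},T)\to\mathscr{A}$ ($\mathscr{T},T\in(0,+\infty]$) solving the problem; for $n>5/2$ an $H^n$-solution is a map in $C((-\mathscr{T},T),H^n)\cap C^1((-\mathscr{T},T),H^{n-1})$ solving it. It is known that for $u_0\in\mathscr{A}$ there is a unique maximal (non-extendable) $\mathscr{A}$-solution, and that for every $n>5/2$ it coincides (same domain)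 with the unique maximal $H^n$-solution with datum $u_0$. The convergence radius of $\sum_j u_jt^j$ in $\mathscr{A}$ is the supremum $\tau\in[0,+\infty]$ of the $r\ge0$ such that the series converges in $\mathscr{A}$ for all $|t|<r$; in $H^n$ it is $\tau_n=\liminf_{j\to+\infty}\|u_j\|_n^{-1/j}$, with $0^{-1/j}:=+\infty$. *)

theory Defs
  imports "HOL-Analysis.Analysis"
begin

text \<open>
  A distribution on the torus (R/2 pi Z)^3 is identified with the family of its Fourier
  coefficients, so that the space of R^3-valued distributions becomes the space of families
  with values in C^3 that grow at most polynomially and satisfy the reality condition.
\<close>

type_synonym freq = "int ^ 3"
type_synonym vfield = "freq \<Rightarrow> complex ^ 3"

definition freq_norm :: "freq \<Rightarrow> real" where
  "freq_norm k = sqrt (\<Sum>s\<in>UNIV. (real_of_int (k $ s))\<^sup>2)"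

definition freq_l1 :: "freq \<Rightarrow> real" where
  "freq_l1 k = (\<Sum>s\<in>UNIV. \<bar>real_of_int (k $ s)\<bar>)"

definition freq_vec :: "freq \<Rightarrow> complex ^ 3" where
  "freq_vec k = (\<chi> s. of_int (k $ s))"

text \<open>Bilinear, not sesquilinear.\<close>

definition cdot :: "complex ^ 3 \<Rightarrow> complex ^ 3 \<Rightarrow> complex" where
  "cdot a b = (\<Sum>s\<in>UNIV. a $ s * b $ s)"

definition distributions :: "vfield set" where
  "distributions = {v.
     (\<exists>C N. \<forall>k. norm (v k) \<le> C * (1 + freq_norm k) ^ N) \<and>
     (\<forall>k. v (- k) = (\<chi> s. cnj (v k $ s)))}"

definition mean_free_div_free :: "vfield \<Rightarrow> bool" where
  "mean_free_div_free v \<longleftrightarrow> v 0 = 0 \<and> (\<forall>k. cdot (freq_vec k) (v k) = 0)"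

definition lincomb :: "real \<Rightarrow> vfield \<Rightarrow> real \<Rightarrow> vfield \<Rightarrow> vfield" where
  "lincomb a v b w = (\<lambda>k. a *\<^sub>R v k + b *\<^sub>R w k)"

definition power_partial_sum :: "(nat \<Rightarrow> vfield) \<Rightarrow> real \<Rightarrow> nat \<Rightarrow> vfield" where
  "power_partial_sum a t N = (\<lambda>k. \<Sum>j<N. t ^ j *\<^sub>R a j k)"

text \<open>The extended real x^(-1/m), with the convention 0^(-1/m) = infinity.\<close>

definition inv_root :: "real \<Rightarrow> real \<Rightarrow> ereal" where
  "inv_root m x = (if x = 0 then \<infinity> else ereal (x powr (- 1 / m)))"


subsection \<open>Sobolev spaces\<close>

definition Hsp :: "real \<Rightarrow> vfield set" where
  "Hsp n = {v \<in> distributions.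
     (\<lambda>k. freq_norm k powr (2 * n) * (norm (v k))\<^sup>2) summable_on UNIV \<and>
     mean_free_div_free v}"

definition Hnorm :: "real \<Rightarrow> vfield \<Rightarrow> real" where
  "Hnorm n v = sqrt (\<Sum>\<^sub>\<infinity>k. freq_norm k powr (2 * n) * (norm (v k))\<^sup>2)"

definition H_tendsto :: "real \<Rightarrow> (nat \<Rightarrow> vfield) \<Rightarrow> vfield \<Rightarrow> bool" where
  "H_tendsto n f l \<longleftrightarrow>
     (\<forall>N. f N \<in> Hsp n) \<and> l \<in> Hsp n \<and>
     (\<lambda>N. Hnorm n (lincomb 1 (f N) (- 1) l)) \<longlonglongrightarrow> 0"


subsection \<open>Real-analytic fields with their inductive limit topology\<close>

definition Asp_rho :: "real \<Rightarrow> vfield set" where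
  "Asp_rho \<rho> = {v \<in> distributions.
     Liminf cofinite (\<lambda>k. inv_root (freq_l1 k) (norm (v k))) > ereal \<rho> \<and>
     mean_free_div_free v}"

definition polyannulus :: "real \<Rightarrow> (complex ^ 3) set" where
  "polyannulus \<rho> = {z. \<forall>s. 1 / \<rho> \<le> norm (z $ s) \<and> norm (z $ s) \<le> \<rho>}"

definition Anorm :: "real \<Rightarrow> vfield \<Rightarrow> real" where
  "Anorm \<rho> v =
     (SUP z\<in>polyannulus \<rho>. norm (\<Sum>\<^sub>\<infinity>k. (\<Prod>s\<in>UNIV. (z $ s) powi (k $ s)) *s v k))"

definition Asp :: "vfield set" where
  "Asp = (\<Union>\<rho>\<in>{1<..}. Asp_rho \<rho>)"

text \<open>
  The standard base of neighbourhoods of 0 for the finest locally convex topology that makes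
  all the inclusions of the normed spaces \<^term>\<open>Asp_rho \<rho>\<close> continuous: the absolutely convex
  sets whose trace on each of these spaces is a neighbourhood of 0.
\<close>

definition A_zero_nhd :: "vfield set \<Rightarrow> bool" where
  "A_zero_nhd W \<longleftrightarrow> W \<subseteq> Asp \<and>
     (\<forall>v\<in>W. \<forall>w\<in>W. \<forall>a b. \<bar>a\<bar> + \<bar>b\<bar> \<le> 1 \<longrightarrow> lincomb a v b w \<in> W) \<and>
     (\<forall>\<rho>>1. \<exists>e>0. {v \<in> Asp_rho \<rho>. Anorm \<rho> v < e} \<subseteq> W)"

definition A_open :: "vfield set \<Rightarrow> bool" where
  "A_open U \<longleftrightarrow> U \<subseteq> Asp \<and> (\<forall>v\<in>U. \<exists>W. A_zero_nhd W \<and> lincomb 1 v 1 ` W \<subseteq> U)"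

definition A_topology :: "vfield topology" where
  "A_topology = topology A_open"

lemma A_zero_nhd_Int:
  assumes "A_zero_nhd W" "A_zero_nhd W'"
  shows "A_zero_nhd (W \<inter> W')"
proof -
  have "\<exists>e>0. {v \<in> Asp_rho \<rho>. Anorm \<rho> v < e} \<subseteq> W \<inter> W'" if "\<rho> > 1" for \<rho>
  proof -
    obtain e where "e > 0" "{v \<in> Asp_rho \<rho>. Anorm \<rho> v < e} \<subseteq> W"
      using assms(1) \<open>\<rho> > 1\<close> unfolding A_zero_nhd_def by blast
    moreover obtain e' where "e' > 0" "{v \<in> Asp_rho \<rho>. Anorm \<rho> v < e'} \<subseteq> W'"
      using assms(2) \<open>\<rho> > 1\<close> unfolding A_zero_nhd_def by blast
    ultimately show ?thesis
      by (intro exI[of _ "min e e'"]) auto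
  qed
  then show ?thesis
    using assms unfolding A_zero_nhd_def by blast
qed

lemma istopology_A_open: "istopology A_open"
  unfolding istopology_def
proof (intro conjI allI impI)
  fix S T assume S: "A_open S" and T: "A_open T"
  show "A_open (S \<inter> T)"
    unfolding A_open_def
  proof (intro conjI ballI)
    show "S \<inter> T \<subseteq> Asp" using S unfolding A_open_def by blast
    fix v assume "v \<in> S \<inter> T"
    then obtain W W' where "A_zero_nhd W" "lincomb 1 v 1 ` W \<subseteq> S"
        "A_zero_nhd W'" "lincomb 1 v 1 ` W' \<subseteq> T"
      using S T unfolding A_open_def by (meson IntE)
    then show "\<exists>W. A_zero_nhd W \<and> lincomb 1 v 1 ` W \<subseteq> S \<inter> T"
      by (intro exI[of _ "W \<inter> W'"]) (auto intro: A_zero_nhd_Int)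
  qed
next
  fix K :: "vfield set set" assume K: "\<forall>S\<in>K. A_open S"
  show "A_open (\<Union>K)"
    unfolding A_open_def
  proof (intro conjI ballI)
    show "\<Union>K \<subseteq> Asp" using K unfolding A_open_def by blast
    fix v assume "v \<in> \<Union>K"
    then obtain S where "S \<in> K" "v \<in> S" by blast
    then obtain W where "A_zero_nhd W" "lincomb 1 v 1 ` W \<subseteq> S"
      using K unfolding A_open_def by meson
    then show "\<exists>W. A_zero_nhd W \<and> lincomb 1 v 1 ` W \<subseteq> \<Union>K"
      using \<open>S \<in> K\<close> by blast
  qed
qed

lemma openin_A_topology: "openin A_topology = A_open"
  unfolding A_topology_def using istopology_A_open by (rule topology_inverse')


subsection \<open>The Euler Cauchy problem\<close>

definition leray :: "freq \<Rightarrow> complex ^ 3 \<Rightarrow> complex ^ 3" where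
  "leray k c =
     (if k = 0 then c
      else c - (cdot (freq_vec k) c / of_real ((freq_norm k)\<^sup>2)) *s freq_vec k)"

definition euler_P :: "vfield \<Rightarrow> vfield \<Rightarrow> vfield" where
  "euler_P v w =
     (\<lambda>k. (- \<i>) *s (\<Sum>\<^sub>\<infinity>h. cdot (v h) (freq_vec (k - h)) *s leray k (w (k - h))))"

definition time_dom :: "ereal \<Rightarrow> ereal \<Rightarrow> real set" where
  "time_dom Tm Tp = {t. - Tm < ereal t \<and> ereal t < Tp}"

definition A_real_analytic_on :: "real set \<Rightarrow> (real \<Rightarrow> vfield) \<Rightarrow> bool" where
  "A_real_analytic_on I u \<longleftrightarrow>
     (\<forall>t\<^sub>0\<in>I. \<exists>e>0. \<exists>a. (\<forall>j. a j \<in> Asp) \<and>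
        (\<forall>t\<in>I. \<bar>t - t\<^sub>0\<bar> < e \<longrightarrow>
           limitin A_topology (power_partial_sum a (t - t\<^sub>0)) (u t) sequentially))"

definition A_has_derivative :: "(real \<Rightarrow> vfield) \<Rightarrow> vfield \<Rightarrow> real \<Rightarrow> bool" where
  "A_has_derivative u w t \<longleftrightarrow>
     limitin A_topology (\<lambda>h. lincomb (1 / h) (u (t + h)) (- 1 / h) (u t)) w (at 0)"

definition A_solution :: "vfield \<Rightarrow> ereal \<Rightarrow> ereal \<Rightarrow> (real \<Rightarrow> vfield) \<Rightarrow> bool" where
  "A_solution u\<^sub>0 Tm Tp u \<longleftrightarrow>
     0 < Tm \<and> 0 < Tp \<and>
     (\<forall>t\<in>time_dom Tm Tp. u t \<in> Asp) \<and>
     A_real_analytic_on (time_dom Tm Tp) u \<and>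
     (\<forall>t\<in>time_dom Tm Tp. A_has_derivative u (euler_P (u t) (u t)) t) \<and>
     u 0 = u\<^sub>0"

definition maximal_A_solution :: "vfield \<Rightarrow> ereal \<Rightarrow> ereal \<Rightarrow> (real \<Rightarrow> vfield) \<Rightarrow> bool" where
  "maximal_A_solution u\<^sub>0 Tm Tp u \<longleftrightarrow>
     A_solution u\<^sub>0 Tm Tp u \<and>
     (\<forall>Tm' Tp' u'. A_solution u\<^sub>0 Tm' Tp' u' \<and> Tm \<le> Tm' \<and> Tp \<le> Tp' \<and>
        (\<forall>t\<in>time_dom Tm Tp. u' t = u t) \<longrightarrow> Tm' = Tm \<and> Tp' = Tp)"


subsection \<open>Convergence radii\<close>

definition A_conv_radius :: "(nat \<Rightarrow> vfield) \<Rightarrow> ereal" where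
  "A_conv_radius a =
     Sup {ereal r |r. r \<ge> 0 \<and>
       (\<forall>t. \<bar>t\<bar> < r \<longrightarrow> (\<exists>s. limitin A_topology (power_partial_sum a t) s sequentially))}"

definition H_conv_radius :: "real \<Rightarrow> (nat \<Rightarrow> vfield) \<Rightarrow> ereal" where
  "H_conv_radius n a = liminf (\<lambda>j. inv_root (real j) (Hnorm n (a j)))"

end

theory Submission
  imports Defs "HOL-Complex_Analysis.Conformal_Mappings"
begin

text \<open>
  Convergent sequences in the inductive limit topology are bounded in one of its steps, so an
  analytic solution is, locally in time, a power series whose coefficients satisfy
  \<open>|c\<^sub>i(k)| \<le> K r\<^bsup>-i\<^esup> e\<^bsup>-\<sigma>|k|\<^esup>\<close>, and the equation forces the recursion for the \<open>c\<^sub>i\<close>. This gives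
  \<open>\<tau> \<le> \<tau>\<^sub>n\<close> and, by the identity theorem applied to each Fourier coefficient, \<open>u(t) = \<Sum> u\<^sub>j t\<^sup>j\<close> where
  both sides exist.

  If \<open>\<tau>\<^sub>n\<close> exceeded \<open>T\<close>, the \<open>H\<^sup>n\<close> norm of \<open>u\<close> would be bounded on \<open>[0,T)\<close>. An energy estimate with the
  weights \<open>|k|\<^sup>n exp(\<sigma>(t) min(|k|, N))\<close>, \<open>\<sigma>(t) = \<sigma>\<^sub>0 e\<^bsup>-\<mu>t\<^esup>\<close>, in the manner of Foias--Temam and
  Levermore--Oliver then bounds the radius of spatial analyticity from below on \<open>[0,T)\<close>; the
  truncation at \<open>N\<close> makes all the sums finite a priori. By Cauchy--Kovalevskaya majorants
  the Taylor series of \<open>u\<close> at times near \<open>T\<close> then converge on intervals of a fixed length, so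
  \<open>u\<close> extends beyond \<open>T\<close>, against maximality. The other end point follows by time reversal.
\<close>

text \<open>An H^n bound gives only power decay of the coefficients, while restarting the
  Cauchy-Kovalevskaya series near the end point needs exponential decay with a rate bounded away
  from 0. The obstacle is the derivative lost in the energy of the exponential weight.
  Incompressibility symmetrizes the energy identity and leaves the difference of two weights times
  the smaller frequency; the exponential part of this difference costs half a derivative on each of
  two factors. A decreasing \<open>\<sigma>\<close> yields a damping term with the same two half
  derivatives, and \<open>\<mu>\<close> is chosen so that it wins as long as the energy stays below
  a bound B. What remains is linear in the energy, with the H^n norm as coefficient, so Gronwall's
  inequality keeps the energy below B on all of [0,T).

  The analysis is done on Fourier coefficients with constants common to all frequencies: power
  series in time for the single coefficients, without such uniformity, could not be inserted into
  the convolution. The topology of \<open>Asp\<close> enters only where uniform bounds are extracted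
  from convergence in it, or convergence is deduced from them.\<close>

no_notation fps_nth (infixl "$" 75)

section \<open>Lattice sums\<close>

lemma freq_norm_eq_norm: "freq_norm k = norm (\<chi> s. real_of_int (k $ s))"
  by (simp add: freq_norm_def norm_vec_def L2_set_def)

lemma freq_norm_nonneg [simp]: "0 \<le> freq_norm k"
  by (simp add: freq_norm_eq_norm)

lemma freq_norm_0 [simp]: "freq_norm 0 = 0"
  by (simp add: freq_norm_def)

lemma freq_norm_minus [simp]: "freq_norm (- k) = freq_norm k"
  by (simp add: freq_norm_def)

lemma freq_norm_triangle: "freq_norm (k + l) \<le> freq_norm k + freq_norm l"
proof -
  have "(\<chi> s. real_of_int ((k + l) $ s)) = (\<chi> s. real_of_int (k $ s)) + (\<chi> s. real_of_int (l $ s))"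
    by (simp add: vec_eq_iff)
  then show ?thesis by (metis freq_norm_eq_norm norm_triangle_ineq)
qed

lemma freq_norm_component: "\<bar>real_of_int (k $ s)\<bar> \<le> freq_norm k"
  using component_le_norm_cart[of "\<chi> s. real_of_int (k $ s)" s] by (simp add: freq_norm_eq_norm)

lemma freq_norm_ge_1: "k \<noteq> 0 \<Longrightarrow> 1 \<le> freq_norm k"
proof -
  assume "k \<noteq> 0"
  then obtain s where "k $ s \<noteq> 0" by (auto simp: vec_eq_iff)
  then have "1 \<le> \<bar>real_of_int (k $ s)\<bar>" by linarith
  then show ?thesis using freq_norm_component order_trans by blast
qed

lemma freq_l1_nonneg [simp]: "0 \<le> freq_l1 k"
  by (simp add: freq_l1_def sum_nonneg)

lemma freq_l1_0 [simp]: "freq_l1 0 = 0"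
  by (simp add: freq_l1_def)

lemma freq_l1_triangle: "freq_l1 (k + l) \<le> freq_l1 k + freq_l1 l"
  unfolding freq_l1_def sum.distrib[symmetric]
  by (rule sum_mono) (simp add: abs_triangle_ineq)

lemma freq_l1_le_add_diff: "freq_l1 k \<le> freq_l1 h + freq_l1 (k - h)"
  using freq_l1_triangle[of h "k - h"] by simp

lemma freq_norm_le_l1: "freq_norm k \<le> freq_l1 k"
  using norm_le_l1_cart[of "\<chi> s. real_of_int (k $ s)"]
  by (simp add: freq_norm_eq_norm freq_l1_def)

lemma freq_l1_le_norm: "freq_l1 k \<le> 3 * freq_norm k"
proof -
  have "freq_l1 k \<le> (\<Sum>s\<in>(UNIV::3 set). freq_norm k)"
    unfolding freq_l1_def by (rule sum_mono) (simp add: freq_norm_component)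
  then show ?thesis by simp
qed

text \<open>A finite set of frequencies lies in a cube, over which the sum of products factors into
  three one-dimensional sums. This reduces summability over the lattice to dimension one.\<close>

lemma summable_on_freq_prod:
  fixes f :: "int \<Rightarrow> real"
  assumes "f summable_on UNIV" and nn: "\<And>i. 0 \<le> f i"
  shows "(\<lambda>k::freq. \<Prod>s\<in>UNIV. f (k $ s)) summable_on UNIV"
proof (rule nonneg_bdd_above_summable_on)
  show "bdd_above (sum (\<lambda>k::freq. \<Prod>s\<in>UNIV. f (k $ s)) ` {F. F \<subseteq> UNIV \<and> finite F})"
  proof (rule bdd_aboveI2)
    fix F :: "freq set" assume "F \<in> {F. F \<subseteq> UNIV \<and> finite F}"
    then have F: "finite F" by simp
    define G where "G = (\<Union>s. (\<lambda>k. k $ s) ` F)"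
    have G: "finite G" using F by (auto simp: G_def)
    have inj: "inj_on vec_nth F" by (auto simp: inj_on_def vec_nth_inject)
    have "(\<Sum>k\<in>F. \<Prod>s\<in>UNIV. f (k $ s)) = (\<Sum>g\<in>vec_nth ` F. \<Prod>s\<in>UNIV. f (g s))"
      by (simp add: sum.reindex[OF inj])
    also have "\<dots> \<le> (\<Sum>g\<in>PiE (UNIV :: 3 set) (\<lambda>_. G). \<Prod>s\<in>UNIV. f (g s))"
    proof (rule sum_mono2)
      show "finite (PiE (UNIV :: 3 set) (\<lambda>_. G))" using G by (simp add: finite_PiE)
      show "vec_nth ` F \<subseteq> PiE UNIV (\<lambda>_. G)" by (auto simp: G_def)
    qed (simp add: nn prod_nonneg)
    also have "\<dots> = (\<Prod>s\<in>(UNIV::3 set). \<Sum>i\<in>G. f i)"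
      by (rule prod_sum_PiE[symmetric]) (use G in auto)
    also have "\<dots> \<le> (\<Prod>s\<in>(UNIV::3 set). infsum f UNIV)"
      by (rule prod_mono) (use assms G in \<open>auto intro!: finite_sum_le_infsum sum_nonneg\<close>)
    finally show "(\<Sum>k\<in>F. \<Prod>s\<in>UNIV. f (k $ s)) \<le> (\<Prod>s\<in>(UNIV::3 set). infsum f UNIV)" .
  qed
qed (simp add: nn prod_nonneg)

lemma summable_on_int_abs:
  fixes g :: "nat \<Rightarrow> real"
  assumes "summable g" "\<And>n. 0 \<le> g n"
  shows "(\<lambda>i::int. g (nat \<bar>i\<bar>)) summable_on UNIV"
proof -
  have g: "g summable_on UNIV" using assms summable_nonneg_imp_summable_on by blast
  have "(\<lambda>i::int. g (nat \<bar>i\<bar>)) summable_on (range int)"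
    by (subst summable_on_reindex) (use g in \<open>auto simp: o_def\<close>)
  moreover have "(\<lambda>i::int. g (nat \<bar>i\<bar>)) summable_on (range (\<lambda>n. - int n))"
    by (subst summable_on_reindex) (use g in \<open>auto simp: o_def inj_on_def\<close>)
  moreover have "range int \<union> range (\<lambda>n. - int n) = UNIV"
    by (auto intro: int_cases2)
  ultimately show ?thesis by (metis summable_on_union)
qed

lemma summable_on_exp_freq:
  assumes "\<sigma> > 0"
  shows "(\<lambda>k::freq. exp (- \<sigma> * freq_l1 k)) summable_on UNIV"
proof -
  have "summable (\<lambda>n. exp (- \<sigma>) ^ n)"
    using assms by (intro summable_geometric) simp
  then have "(\<lambda>i::int. exp (- \<sigma>) ^ nat \<bar>i\<bar>) summable_on UNIV"
    by (rule summable_on_int_abs) simp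
  then have "(\<lambda>i::int. exp (- \<sigma> * \<bar>real_of_int i\<bar>)) summable_on UNIV"
    by (simp add: exp_of_nat_mult[symmetric] mult.commute)
  then have "(\<lambda>k::freq. \<Prod>s\<in>UNIV. exp (- \<sigma> * \<bar>real_of_int (k $ s)\<bar>)) summable_on UNIV"
    by (rule summable_on_freq_prod) simp
  then show ?thesis
    by (simp add: exp_sum[symmetric] freq_l1_def sum_distrib_left sum_negf)
qed

text \<open>The condition s > 3 becomes s/3 > 1 for three one-dimensional series: (1 + |k|)^(-s) is
  the cube of (1 + |k|)^(-s/3), and |k| dominates each component. The factor \<open>2 powr s\<close>
  compares |k| with 1 + |k| for nonzero k; at k = 0 the left side is 0 by the convention for
  \<open>powr\<close>.\<close>

lemma summable_on_freq_norm_powr: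
  assumes "s > 3"
  shows "(\<lambda>k. freq_norm k powr (- s)) summable_on UNIV"
proof -
  have "summable (\<lambda>n. real n powr (- (s / 3)))"
    using assms by (subst summable_real_powr_iff) simp
  then have "summable (\<lambda>n. real (Suc n) powr (- (s / 3)))"
    by (subst summable_Suc_iff)
  then have "(\<lambda>i::int. real (Suc (nat \<bar>i\<bar>)) powr (- (s / 3))) summable_on UNIV"
    by (rule summable_on_int_abs) simp
  then have "(\<lambda>k::freq. \<Prod>j\<in>UNIV. real (Suc (nat \<bar>k $ j\<bar>)) powr (- (s / 3))) summable_on UNIV"
    by (rule summable_on_freq_prod) simp
  then have "(\<lambda>k::freq. 2 powr s * (\<Prod>j\<in>UNIV. real (Suc (nat \<bar>k $ j\<bar>)) powr (- (s / 3)))) summable_on UNIV"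
    by (rule summable_on_cmult_right)
  then show ?thesis
  proof (rule summable_on_comparison_test)
    fix k :: freq
    show "freq_norm k powr - s \<le> 2 powr s * (\<Prod>j\<in>UNIV. real (Suc (nat \<bar>k $ j\<bar>)) powr - (s / 3))"
    proof (cases "k = 0")
      case False
      note k1 = freq_norm_ge_1[OF False]
      have "(1 + freq_norm k) powr - s = ((1 + freq_norm k) powr - (s / 3)) ^ 3"
        using k1 by (simp add: powr_realpow[symmetric] powr_powr)
      also have "\<dots> = (\<Prod>j\<in>(UNIV::3 set). (1 + freq_norm k) powr - (s / 3))" by simp
      also have "\<dots> \<le> (\<Prod>j\<in>UNIV. real (Suc (nat \<bar>k $ j\<bar>)) powr - (s / 3))"
      proof (intro prod_mono conjI powr_mono2')
        fix j show "real (Suc (nat \<bar>k $ j\<bar>)) \<le> 1 + freq_norm k"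
          using freq_norm_component[of k j] by simp
      qed (use assms in auto)
      finally have le: "(1 + freq_norm k) powr - s \<le> (\<Prod>j\<in>UNIV. real (Suc (nat \<bar>k $ j\<bar>)) powr - (s / 3))" .
      have "(2 * freq_norm k) powr - s \<le> (1 + freq_norm k) powr - s"
        using k1 assms by (intro powr_mono2') auto
      then have "freq_norm k powr - s \<le> 2 powr s * (1 + freq_norm k) powr - s"
        using k1 by (simp add: powr_mult powr_minus field_simps)
      also have "\<dots> \<le> 2 powr s * (\<Prod>j\<in>UNIV. real (Suc (nat \<bar>k $ j\<bar>)) powr - (s / 3))"
        using le by simp
      finally show ?thesis .
    qed (simp add: prod_nonneg)
  qed simp
qed

text \<open>The price of one derivative: a factor |k| is bought with an arbitrarily small part
  \<open>\<epsilon>\<close> of the exponential rate, at the cost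
  1/\<open>\<epsilon>\<close>.\<close>

lemma le_exp_mult:
  fixes x \<epsilon> :: real
  assumes "\<epsilon> > 0"
  shows "x \<le> exp (\<epsilon> * x) / \<epsilon>"
proof -
  have "\<epsilon> * x \<le> exp (\<epsilon> * x)" using exp_ge_add_one_self[of "\<epsilon> * x"] by linarith
  then show ?thesis using assms by (simp add: field_simps)
qed

lemma powr_le_exp:
  fixes p \<epsilon> :: real
  assumes "\<epsilon> > 0" "p > 0"
  obtains C where "C > 0" "\<And>x. x \<ge> 0 \<Longrightarrow> x powr p \<le> C * exp (\<epsilon> * x)"
proof (rule that)
  fix x :: real assume "x \<ge> 0"
  define \<delta> where "\<delta> = \<epsilon> / p"
  have d: "\<delta> > 0" using assms by (simp add: \<delta>_def)
  have "x powr p \<le> (exp (\<delta> * x) / \<delta>) powr p"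
    using \<open>x \<ge> 0\<close> assms le_exp_mult[OF d] by (intro powr_mono2) auto
  also have "\<dots> = (1 / \<delta>) powr p * exp (\<epsilon> * x)"
    using d assms by (simp add: powr_divide powr_mult exp_powr_real \<delta>_def)
  finally show "x powr p \<le> (1 / (\<epsilon> / p)) powr p * exp (\<epsilon> * x)" by (simp add: \<delta>_def)
qed (use assms in auto)

lemma summable_on_freq_shift:
  fixes f :: "freq \<Rightarrow> 'a::banach"
  shows "(\<lambda>h. f (k - h)) summable_on UNIV \<longleftrightarrow> f summable_on UNIV"
    and "(\<Sum>\<^sub>\<infinity>h. f (k - h)) = (\<Sum>\<^sub>\<infinity>h. f h)"
proof -
  have b: "bij_betw (\<lambda>h. k - h) UNIV (UNIV :: freq set)"
    by (rule bij_betwI[where g = "\<lambda>h. k - h"]) auto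
  show "(\<lambda>h. f (k - h)) summable_on UNIV \<longleftrightarrow> f summable_on UNIV"
    by (rule summable_on_reindex_bij_betw[OF b])
  show "(\<Sum>\<^sub>\<infinity>h. f (k - h)) = (\<Sum>\<^sub>\<infinity>h. f h)"
    by (rule infsum_reindex_bij_betw[OF b])
qed

lemma summable_on_freq_translate:
  fixes f :: "freq \<Rightarrow> 'a::banach"
  shows "(\<lambda>k. f (k - h)) summable_on UNIV \<longleftrightarrow> f summable_on UNIV"
    and "(\<Sum>\<^sub>\<infinity>k. f (k - h)) = (\<Sum>\<^sub>\<infinity>k. f k)"
proof -
  have b: "bij_betw (\<lambda>k. k - h) UNIV (UNIV :: freq set)"
    by (rule bij_betwI[where g = "\<lambda>k. k + h"]) auto
  show "(\<lambda>k. f (k - h)) summable_on UNIV \<longleftrightarrow> f summable_on UNIV"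
    by (rule summable_on_reindex_bij_betw[OF b])
  show "(\<Sum>\<^sub>\<infinity>k. f (k - h)) = (\<Sum>\<^sub>\<infinity>k. f k)"
    by (rule infsum_reindex_bij_betw[OF b])
qed

section \<open>The space of analytic fields and its topology\<close>

text \<open>Takes the place of the sup norms: up to an arbitrarily small loss in the rate, a bound
  with rate \<open>ln \<rho>\<close> amounts to a bound on \<open>Anorm \<rho>\<close>, by
  \<open>Anorm_le\<close> and \<open>coeff_le_Anorm\<close>. Constant and rate are explicit so that
  uniformity over a family of fields can be expressed.\<close>

definition exp_decay :: "real \<Rightarrow> real \<Rightarrow> vfield \<Rightarrow> bool" where
  "exp_decay K \<sigma> v \<longleftrightarrow> (\<forall>k. norm (v k) \<le> K * exp (- \<sigma> * freq_l1 k))"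

definition real_field :: "vfield \<Rightarrow> bool" where
  "real_field v \<longleftrightarrow> (\<forall>k. v (- k) = (\<chi> s. cnj (v k $ s)))"

lemma exp_decay_nonneg: "exp_decay K \<sigma> v \<Longrightarrow> 0 \<le> K"
  unfolding exp_decay_def by (drule spec[of _ 0]) (simp add: order_trans[OF norm_ge_zero])

lemma exp_decay_mono:
  assumes "exp_decay K \<sigma> v" "K \<le> K'" "\<sigma>' \<le> \<sigma>"
  shows "exp_decay K' \<sigma>' v"
  unfolding exp_decay_def
proof
  fix k
  have "norm (v k) \<le> K * exp (- \<sigma> * freq_l1 k)" using assms by (simp add: exp_decay_def)
  also have "\<dots> \<le> K' * exp (- \<sigma>' * freq_l1 k)"
    using assms exp_decay_nonneg[OF assms(1)] by (intro mult_mono) (auto simp: mult_right_mono)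
  finally show "norm (v k) \<le> K' * exp (- \<sigma>' * freq_l1 k)" .
qed

lemma finite_freq_ball: "finite {k. freq_l1 k \<le> R}"
proof -
  let ?G = "{- \<lceil>R\<rceil>..\<lceil>R\<rceil>}"
  have "vec_nth ` {k. freq_l1 k \<le> R} \<subseteq> PiE UNIV (\<lambda>_. ?G)"
  proof (intro image_subsetI PiE_I)
    fix k :: freq and s assume "k \<in> {k. freq_l1 k \<le> R}"
    then have R: "freq_l1 k \<le> R" by simp
    have "\<bar>real_of_int (k $ s)\<bar> \<le> freq_l1 k"
      using freq_norm_component freq_norm_le_l1 order_trans by blast
    then have "\<bar>real_of_int (k $ s)\<bar> \<le> of_int \<lceil>R\<rceil>" using R by linarith
    then show "k $ s \<in> ?G" by simp linarith
  qed auto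
  then have "finite (vec_nth ` {k. freq_l1 k \<le> R})"
    by (rule finite_subset) (simp add: finite_PiE)
  then show ?thesis by (rule finite_imageD) (auto simp: inj_on_def vec_nth_inject)
qed

lemma eventually_freq_l1_gt: "eventually (\<lambda>k. freq_l1 k > R) cofinite"
  unfolding eventually_cofinite using finite_freq_ball[of R] by (simp add: not_less)

lemma exp_decay_distributions:
  assumes "exp_decay K \<sigma> v" "\<sigma> > 0" "real_field v"
  shows "v \<in> distributions"
proof -
  have "norm (v k) \<le> K * (1 + freq_norm k) ^ 0" for k
  proof -
    have "norm (v k) \<le> K * exp (- \<sigma> * freq_l1 k)" using assms by (simp add: exp_decay_def)
    also have "\<dots> \<le> K * 1" using exp_decay_nonneg[OF assms(1)] assms(2)
      by (intro mult_left_mono) auto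
    finally show ?thesis by simp
  qed
  then show ?thesis using assms(3) unfolding distributions_def real_field_def by blast
qed

text \<open>The strict inequality in \<open>Asp_rho\<close> forces a loss in the rate. At large
  frequencies a quarter of the rate absorbs the prefactor, so the liminf is at least
  exp(3\<open>\<sigma>\<close>/4), which exceeds exp(\<open>\<sigma>\<close>/2). Enlarging
  \<open>K\<close> to \<open>K + 1\<close> keeps the logarithm of the prefactor meaningful when K =
  0.\<close>

lemma exp_decay_Asp_rho:
  assumes d: "exp_decay K \<sigma> v" and s: "\<sigma> > 0" and r: "real_field v" and m: "mean_free_div_free v"
  shows "v \<in> Asp_rho (exp (\<sigma> / 2))"
proof -
  have K: "exp_decay (K + 1) \<sigma> v" using exp_decay_mono[OF d] by simp
  have K1: "K + 1 > 0" using exp_decay_nonneg[OF d] by simp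
  have "eventually (\<lambda>k. freq_l1 k > max 1 (4 * ln (K + 1) / \<sigma>)) cofinite"
    by (rule eventually_freq_l1_gt)
  then have "eventually (\<lambda>k. ereal (exp (3 * \<sigma> / 4)) \<le> inv_root (freq_l1 k) (norm (v k))) cofinite"
  proof (rule eventually_mono)
    fix k assume "freq_l1 k > max 1 (4 * ln (K + 1) / \<sigma>)"
    then have l: "freq_l1 k > 0" "ln (K + 1) \<le> freq_l1 k * \<sigma> / 4"
      using s by (auto simp: field_simps)
    show "ereal (exp (3 * \<sigma> / 4)) \<le> inv_root (freq_l1 k) (norm (v k))"
    proof (cases "v k = 0")
      case False
      have "norm (v k) \<le> (K + 1) * exp (- \<sigma> * freq_l1 k)" using K by (simp add: exp_decay_def)
      also have "\<dots> = exp (ln (K + 1) - \<sigma> * freq_l1 k)" using K1 by (simp add: exp_diff exp_minus field_simps)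
      also have "\<dots> \<le> exp (- (3 * \<sigma> / 4) * freq_l1 k)" using l by (simp add: field_simps)
      finally have "norm (v k) \<le> exp (- (3 * \<sigma> / 4) * freq_l1 k)" .
      then have "exp (- (3 * \<sigma> / 4) * freq_l1 k) powr (- 1 / freq_l1 k) \<le> norm (v k) powr (- 1 / freq_l1 k)"
        using False l by (intro powr_mono2') auto
      then show ?thesis using False l by (simp add: inv_root_def exp_powr_real)
    qed (simp add: inv_root_def)
  qed
  then have "ereal (exp (3 * \<sigma> / 4)) \<le> Liminf cofinite (\<lambda>k. inv_root (freq_l1 k) (norm (v k)))"
    by (rule Liminf_bounded)
  moreover have "ereal (exp (\<sigma> / 2)) < ereal (exp (3 * \<sigma> / 4))" using s by simp
  ultimately have "ereal (exp (\<sigma> / 2)) < Liminf cofinite (\<lambda>k. inv_root (freq_l1 k) (norm (v k)))"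
    by (rule less_le_trans[rotated])
  then show ?thesis
    using exp_decay_distributions[OF d s r] m unfolding Asp_rho_def by simp
qed

text \<open>The liminf exceeds \<open>\<rho>\<close> strictly, so some \<open>\<rho>'\<close> fits
  in between. The gain from \<open>\<rho>\<close> to \<open>\<rho>'\<close> is what makes the
  Laurent series converge absolutely on the closed polyannulus of
  \<open>Anorm \<rho>\<close>.\<close>

lemma Asp_rho_decay:
  assumes v: "v \<in> Asp_rho \<rho>" and r: "\<rho> > 1"
  obtains \<rho>' K where "\<rho>' > \<rho>" "exp_decay K (ln \<rho>') v"
proof -
  have "ereal \<rho> < Liminf cofinite (\<lambda>k. inv_root (freq_l1 k) (norm (v k)))"
    using v by (simp add: Asp_rho_def)
  then obtain \<rho>' where r': "ereal \<rho> < ereal \<rho>'" "ereal \<rho>' < Liminf cofinite (\<lambda>k. inv_root (freq_l1 k) (norm (v k)))"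
    using ereal_dense2 by blast
  have r1: "\<rho>' > \<rho>" "\<rho>' > 1" using r' r by auto
  have "eventually (\<lambda>k. ereal \<rho>' < inv_root (freq_l1 k) (norm (v k)) \<and> freq_l1 k > 0) cofinite"
    using less_LiminfD[OF r'(2)] eventually_freq_l1_gt[of 0] by eventually_elim auto
  then have ev: "eventually (\<lambda>k. norm (v k) \<le> exp (- ln \<rho>' * freq_l1 k)) cofinite"
  proof (rule eventually_mono)
    fix k assume k: "ereal \<rho>' < inv_root (freq_l1 k) (norm (v k)) \<and> freq_l1 k > 0"
    show "norm (v k) \<le> exp (- ln \<rho>' * freq_l1 k)"
    proof (cases "v k = 0")
      case False
      then have "\<rho>' < norm (v k) powr (- 1 / freq_l1 k)" using k by (simp add: inv_root_def)
      then have "(norm (v k) powr (- 1 / freq_l1 k)) powr (- freq_l1 k) \<le> \<rho>' powr (- freq_l1 k)"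
        using r1 by (intro powr_mono2') auto
      then show ?thesis using False k r1 by (simp add: powr_powr powr_def mult.commute)
    qed simp
  qed
  define S where "S = {k. \<not> norm (v k) \<le> exp (- ln \<rho>' * freq_l1 k)}"
  have S: "finite S" using ev by (simp add: S_def eventually_cofinite)
  \<comment> \<open>The finitely many exceptional frequencies are absorbed in the constant; the
    summand 1 serves all the others.\<close>
  define K where "K = 1 + (\<Sum>k\<in>S. norm (v k) * exp (ln \<rho>' * freq_l1 k))"
  have "norm (v k) \<le> K * exp (- ln \<rho>' * freq_l1 k)" for k
  proof (cases "k \<in> S")
    case True
    then have "norm (v k) * exp (ln \<rho>' * freq_l1 k) \<le> K"
      unfolding K_def using member_le_sum[OF True, of "\<lambda>k. norm (v k) * exp (ln \<rho>' * freq_l1 k)"] S by force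
    then have "norm (v k) * exp (ln \<rho>' * freq_l1 k) * exp (- ln \<rho>' * freq_l1 k) \<le> K * exp (- ln \<rho>' * freq_l1 k)"
      by (intro mult_right_mono) auto
    then show ?thesis by (simp add: mult.assoc exp_add[symmetric])
  next
    case False
    then have "norm (v k) \<le> 1 * exp (- ln \<rho>' * freq_l1 k)" by (simp add: S_def)
    also have "\<dots> \<le> K * exp (- ln \<rho>' * freq_l1 k)"
      by (intro mult_right_mono) (auto simp: K_def sum_nonneg)
    finally show ?thesis .
  qed
  then show ?thesis using that r1 by (auto simp: exp_decay_def)
qed

lemma Asp_iff:
  "v \<in> Asp \<longleftrightarrow> real_field v \<and> mean_free_div_free v \<and> (\<exists>K \<sigma>. \<sigma> > 0 \<and> exp_decay K \<sigma> v)" (is "?l = ?r")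
proof
  assume ?l
  then obtain \<rho> where r: "\<rho> > 1" "v \<in> Asp_rho \<rho>" by (auto simp: Asp_def)
  then obtain \<rho>' K where "\<rho>' > \<rho>" "exp_decay K (ln \<rho>') v" using Asp_rho_decay by blast
  moreover have "ln \<rho>' > 0" using calculation r by simp
  ultimately show ?r using r(2) by (auto simp: Asp_rho_def distributions_def real_field_def)
next
  assume ?r
  then show ?l using exp_decay_Asp_rho unfolding Asp_def
    by (metis UN_I greaterThan_iff half_gt_zero one_less_exp_iff)
qed

lemma Asp_rho_subset: "\<rho> > 1 \<Longrightarrow> Asp_rho \<rho> \<subseteq> Asp"
  by (auto simp: Asp_def)

lemma Asp_exp_decay: "v \<in> Asp \<Longrightarrow> \<exists>K \<sigma>. \<sigma> > 0 \<and> exp_decay K \<sigma> v"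
  by (simp add: Asp_iff)

lemma real_field_lincomb: "real_field v \<Longrightarrow> real_field w \<Longrightarrow> real_field (lincomb a v b w)"
  by (simp add: real_field_def lincomb_def vec_eq_iff)

lemma cdot_add_right: "cdot a (b + c) = cdot a b + cdot a c"
  by (simp add: cdot_def sum.distrib algebra_simps)

lemma cdot_scaleR_right: "cdot a (r *\<^sub>R b) = r *\<^sub>R cdot a b"
  by (simp add: cdot_def scaleR_sum_right)

lemma mdf_lincomb: "mean_free_div_free v \<Longrightarrow> mean_free_div_free w \<Longrightarrow> mean_free_div_free (lincomb a v b w)"
  by (simp add: mean_free_div_free_def lincomb_def cdot_add_right cdot_scaleR_right)

lemma exp_decay_lincomb:
  assumes "exp_decay K \<sigma> v" "exp_decay L \<sigma> w"
  shows "exp_decay (\<bar>a\<bar> * K + \<bar>b\<bar> * L) \<sigma> (lincomb a v b w)"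
  unfolding exp_decay_def
proof
  fix k
  have "norm (lincomb a v b w k) \<le> \<bar>a\<bar> * norm (v k) + \<bar>b\<bar> * norm (w k)"
    unfolding lincomb_def using norm_triangle_ineq[of "a *\<^sub>R v k" "b *\<^sub>R w k"] by simp
  also have "\<dots> \<le> \<bar>a\<bar> * (K * exp (- \<sigma> * freq_l1 k)) + \<bar>b\<bar> * (L * exp (- \<sigma> * freq_l1 k))"
    using assms by (intro add_mono mult_left_mono) (auto simp: exp_decay_def)
  finally show "norm (lincomb a v b w k) \<le> (\<bar>a\<bar> * K + \<bar>b\<bar> * L) * exp (- \<sigma> * freq_l1 k)"
    by (simp add: algebra_simps)
qed

lemma Asp_lincomb:
  assumes "v \<in> Asp" "w \<in> Asp"
  shows "lincomb a v b w \<in> Asp"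
proof -
  obtain K \<sigma> where 1: "\<sigma> > 0" "exp_decay K \<sigma> v" using assms(1) by (auto simp: Asp_iff)
  obtain L \<tau> where 2: "\<tau> > 0" "exp_decay L \<tau> w" using assms(2) by (auto simp: Asp_iff)
  have "exp_decay K (min \<sigma> \<tau>) v" "exp_decay L (min \<sigma> \<tau>) w"
    using 1 2 by (auto intro: exp_decay_mono)
  from exp_decay_lincomb[OF this, of a b] 1 2 assms show ?thesis
    unfolding Asp_iff by (metis min_less_iff_conj real_field_lincomb mdf_lincomb)
qed

subsection \<open>The norms on the steps of the inductive limit\<close>

lemma powi_eq_exp: "(x::real) > 0 \<Longrightarrow> x powi n = exp (real_of_int n * ln x)"
  by (simp add: powr_real_of_int'[symmetric] powr_def)

lemma norm_monomial_le:
  assumes "z \<in> polyannulus \<rho>" "\<rho> \<ge> 1"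
  shows "norm (\<Prod>s\<in>UNIV. (z $ s) powi (k $ s)) \<le> exp (ln \<rho> * freq_l1 k)"
proof -
  have "norm ((z $ s) powi (k $ s)) \<le> exp (ln \<rho> * \<bar>real_of_int (k $ s)\<bar>)" for s
  proof -
    have z: "1 / \<rho> \<le> norm (z $ s)" "norm (z $ s) \<le> \<rho>" using assms by (auto simp: polyannulus_def)
    then have z0: "0 < norm (z $ s)" using assms(2) by (smt (verit) divide_pos_pos)
    have "norm (z $ s) powi (k $ s) = exp (ln (norm (z $ s)) * real_of_int (k $ s))"
      using powi_eq_exp[OF z0] by (simp add: mult.commute)
    also have "\<dots> \<le> exp (ln \<rho> * \<bar>real_of_int (k $ s)\<bar>)"
    proof -
      have "ln (norm (z $ s)) \<le> ln \<rho>" by (subst ln_le_cancel_iff) (use z z0 assms(2) in auto)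
      moreover have "- ln \<rho> \<le> ln (norm (z $ s))"
      proof -
        have "ln (1 / \<rho>) \<le> ln (norm (z $ s))" by (subst ln_le_cancel_iff) (use z z0 assms(2) in auto)
        then show ?thesis using assms(2) by (simp add: ln_div)
      qed
      ultimately have "\<bar>ln (norm (z $ s))\<bar> \<le> ln \<rho>" by linarith
      then have "\<bar>ln (norm (z $ s))\<bar> * \<bar>real_of_int (k $ s)\<bar> \<le> ln \<rho> * \<bar>real_of_int (k $ s)\<bar>"
        by (intro mult_right_mono) auto
      moreover have "ln (norm (z $ s)) * real_of_int (k $ s) \<le> \<bar>ln (norm (z $ s))\<bar> * \<bar>real_of_int (k $ s)\<bar>"
        by (metis abs_ge_self abs_mult)
      ultimately show ?thesis by simp
    qed
    finally show ?thesis by (simp add: norm_power_int)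
  qed
  then have "norm (\<Prod>s\<in>UNIV. (z $ s) powi (k $ s)) \<le> (\<Prod>s\<in>UNIV. exp (ln \<rho> * \<bar>real_of_int (k $ s)\<bar>))"
    unfolding prod_norm[symmetric] by (intro prod_mono) auto
  then show ?thesis by (simp add: exp_sum[symmetric] freq_l1_def sum_distrib_left)
qed

lemma norm_vector_smult: "norm (c *s (v :: complex ^ 'n)) = norm c * norm v"
  by (simp add: norm_vec_def L2_set_def norm_mult power_mult_distrib sum_distrib_left[symmetric] real_sqrt_mult)

lemma laurent_term_bound:
  assumes "z \<in> polyannulus \<rho>" "\<rho> \<ge> 1" "exp_decay K \<sigma> v"
  shows "norm ((\<Prod>s\<in>UNIV. (z $ s) powi (k $ s)) *s v k) \<le> K * exp (- (\<sigma> - ln \<rho>) * freq_l1 k)"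
proof -
  have "norm ((\<Prod>s\<in>UNIV. (z $ s) powi (k $ s)) *s v k) \<le> exp (ln \<rho> * freq_l1 k) * (K * exp (- \<sigma> * freq_l1 k))"
    unfolding norm_vector_smult
    by (intro mult_mono norm_monomial_le[OF assms(1,2)]) (use assms(3) in \<open>auto simp: exp_decay_def\<close>)
  also have "\<dots> = K * exp (- (\<sigma> - ln \<rho>) * freq_l1 k)" by (simp add: exp_add[symmetric] algebra_simps)
  finally show ?thesis .
qed

lemma laurent_summable:
  assumes "z \<in> polyannulus \<rho>" "\<rho> \<ge> 1" "exp_decay K \<sigma> v" "ln \<rho> < \<sigma>"
  shows "(\<lambda>k. norm ((\<Prod>s\<in>UNIV. (z $ s) powi (k $ s)) *s v k)) summable_on UNIV"
proof -
  have "(\<lambda>k. K * exp (- (\<sigma> - ln \<rho>) * freq_l1 k)) summable_on UNIV"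
    by (rule summable_on_cmult_right[OF summable_on_exp_freq]) (use assms in simp)
  then show ?thesis
    by (rule summable_on_comparison_test) (use laurent_term_bound[OF assms(1-3)] in auto)
qed

lemma laurent_bound:
  assumes "z \<in> polyannulus \<rho>" "\<rho> \<ge> 1" "exp_decay K \<sigma> v" "ln \<rho> < \<sigma>"
  shows "norm (\<Sum>\<^sub>\<infinity>k. (\<Prod>s\<in>UNIV. (z $ s) powi (k $ s)) *s v k)
    \<le> K * (\<Sum>\<^sub>\<infinity>k::freq. exp (- (\<sigma> - ln \<rho>) * freq_l1 k))"
proof -
  have s: "(\<lambda>k::freq. K * exp (- (\<sigma> - ln \<rho>) * freq_l1 k)) summable_on UNIV"
    by (rule summable_on_cmult_right[OF summable_on_exp_freq]) (use assms in simp)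
  have "norm (\<Sum>\<^sub>\<infinity>k. (\<Prod>s\<in>UNIV. (z $ s) powi (k $ s)) *s v k)
      \<le> (\<Sum>\<^sub>\<infinity>k::freq. K * exp (- (\<sigma> - ln \<rho>) * freq_l1 k))"
    by (rule norm_infsum_le[OF has_sum_infsum[OF abs_summable_summable[OF laurent_summable[OF assms]]]
          has_sum_infsum[OF s]]) (rule laurent_term_bound[OF assms(1-3)])
  then show ?thesis by (simp add: infsum_cmult_right')
qed

lemma one_polyannulus: "\<rho> \<ge> 1 \<Longrightarrow> (\<chi> s. 1) \<in> polyannulus \<rho>"
  by (simp add: polyannulus_def field_simps)

lemma Anorm_le:
  assumes "\<rho> \<ge> 1" "exp_decay K \<sigma> v" "ln \<rho> < \<sigma>"
  shows "Anorm \<rho> v \<le> K * (\<Sum>\<^sub>\<infinity>k::freq. exp (- (\<sigma> - ln \<rho>) * freq_l1 k))"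
  unfolding Anorm_def
  by (rule cSUP_least) (use one_polyannulus[OF assms(1)] laurent_bound[OF _ assms] in auto)

lemma norm_laurent_le_Anorm:
  assumes "z \<in> polyannulus \<rho>" "\<rho> \<ge> 1" "exp_decay K \<sigma> v" "ln \<rho> < \<sigma>"
  shows "norm (\<Sum>\<^sub>\<infinity>k. (\<Prod>s\<in>UNIV. (z $ s) powi (k $ s)) *s v k) \<le> Anorm \<rho> v"
  unfolding Anorm_def
proof (rule cSUP_upper[OF assms(1)])
  show "bdd_above ((\<lambda>z. norm (\<Sum>\<^sub>\<infinity>k. (\<Prod>s\<in>UNIV. (z $ s) powi (k $ s)) *s v k)) ` polyannulus \<rho>)"
    by (rule bdd_aboveI2) (rule laurent_bound[OF _ assms(2-4)])
qed

text \<open>Orthogonality of the characters of Z/N, as a geometric sum of an N-th root of unity. The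
  bound on \<open>a\<close> excludes the nonzero multiples of N, which would be indistinguishable
  from 0.\<close>

lemma sum_cis_eq_0:
  fixes a :: int and N :: nat
  assumes "a \<noteq> 0" "\<bar>a\<bar> < int N"
  shows "(\<Sum>m<N. cis (2 * pi * real m * real_of_int a / real N)) = 0"
proof -
  define x where "x = cis (2 * pi * real_of_int a / real N)"
  have N: "N > 0" using assms by linarith
  have "x \<noteq> 1"
  proof
    assume "x = 1"
    then have "cos (2 * pi * real_of_int a / real N) = 1" by (metis x_def cis.sel(1) one_complex.sel(1))
    then obtain n :: int where "2 * pi * real_of_int a / real N = real_of_int n * 2 * pi"
      using cos_one_2pi_int by blast
    then have "real_of_int a = real_of_int n * real N" using N by (simp add: field_simps)
    then have e: "a = n * int N" by (metis of_int_eq_iff of_int_mult of_int_of_nat_eq)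
    then have "n \<noteq> 0" using assms by auto
    then have "1 * int N \<le> \<bar>n\<bar> * int N" by (intro mult_right_mono) auto
    then show False using e assms(2) by (simp add: abs_mult)
  qed
  moreover have "x ^ N = 1"
  proof -
    have "x ^ N = cis (2 * pi * real_of_int a)" unfolding x_def Complex.DeMoivre using N by simp
    then show ?thesis by (simp add: cis_multiple_2pi)
  qed
  ultimately have "(\<Sum>m<N. x ^ m) = 0" by (simp add: geometric_sum)
  moreover have "x ^ m = cis (2 * pi * real m * real_of_int a / real N)" for m
    unfolding x_def Complex.DeMoivre by (simp add: mult_ac)
  ultimately show ?thesis by simp
qed

text \<open>
  In Cauchy's estimate below, the average over the torus is replaced by the finite average over
  \<open>z s = \<rho>\<^bsup>\<plusminus>1\<^esup> \<omega>\<^bsup>m w s\<^esup>\<close>, \<open>m < N\<close>, with \<open>\<omega>\<close> an \<open>N\<close>-th root of unity; Kronecker's choice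
  \<open>w = (1, B, B\<^sup>2)\<close> separates the finitely many frequencies that matter.
\<close>

lemma kronecker_separation:
  fixes F :: "freq set"
  assumes "finite F"
  obtains w :: "3 \<Rightarrow> int" and N :: nat where "N > 0"
    "\<forall>d\<in>F. d \<noteq> 0 \<longrightarrow> (\<Sum>s\<in>UNIV. w s * d $ s) \<noteq> 0 \<and> \<bar>\<Sum>s\<in>UNIV. w s * d $ s\<bar> < int N"
proof -
  define b where "b = (\<Sum>d\<in>F. \<Sum>s\<in>UNIV. \<bar>d $ s\<bar>)"
  have b0: "b \<ge> 0" by (simp add: b_def sum_nonneg)
  have b: "\<bar>d $ s\<bar> \<le> b" if "d \<in> F" for d s
  proof -
    have "\<bar>d $ s\<bar> \<le> (\<Sum>s\<in>UNIV. \<bar>d $ s\<bar>)" by (rule member_le_sum) auto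
    also have "\<dots> \<le> b" unfolding b_def
      by (rule member_le_sum[OF that]) (auto simp: assms sum_nonneg)
    finally show ?thesis .
  qed
  define B where "B = 2 * b + 1"
  define w :: "3 \<Rightarrow> int" where "w = (\<lambda>s. if s = 1 then 1 else if s = 2 then B else B * B)"
  have w: "(\<Sum>s\<in>UNIV. w s * d $ s) = d $ 1 + B * d $ 2 + B * B * d $ 3" for d :: freq
    by (simp add: sum_3 w_def)
  define N where "N = nat (b + B * b + B * B * b + 1)"
  have N: "int N = b + B * b + B * B * b + 1" using b0 by (simp add: N_def B_def)
  \<comment> \<open>\<open>x\<close> is a multiple of the base \<open>B\<close> and smaller than it
    in modulus, hence 0. Applied to the first and then to the second digit.\<close>
  have small: "x = 0" if "\<bar>x\<bar> \<le> b" "x + B * y = 0" for x y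
  proof (rule ccontr)
    assume "x \<noteq> 0"
    then have "y \<noteq> 0" using that by auto
    then have "B \<le> B * \<bar>y\<bar>" using b0 mult_left_mono[of 1 "\<bar>y\<bar>" B] by (simp add: B_def)
    moreover have By: "B * \<bar>y\<bar> = \<bar>x\<bar>"
    proof -
      have "B * y = - x" "B \<ge> 0" using that(2) b0 by (auto simp: B_def)
      then show ?thesis by (metis abs_minus abs_mult abs_of_nonneg)
    qed
    ultimately show False using that(1) b0 unfolding By by (simp add: B_def)
  qed
  show ?thesis
  proof (rule that[of N w])
    show "N > 0" using N b0 by (smt (verit) B_def mult_nonneg_nonneg of_nat_0_less_iff)
    show "\<forall>d\<in>F. d \<noteq> 0 \<longrightarrow> (\<Sum>s\<in>UNIV. w s * d $ s) \<noteq> 0 \<and> \<bar>\<Sum>s\<in>UNIV. w s * d $ s\<bar> < int N"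
    proof (intro ballI impI)
      fix d assume d: "d \<in> F" "d \<noteq> 0"
      have "d = 0" if "d $ 1 + B * d $ 2 + B * B * d $ 3 = 0"
      proof -
        have 1: "d $ 1 = 0" by (rule small[of _ "d $ 2 + B * d $ 3"]) (use that b[OF d(1)] in \<open>auto simp: algebra_simps\<close>)
        have B: "B \<noteq> 0" using b0 B_def by auto
        have "B * (d $ 2 + B * d $ 3) = 0" using that 1 by (simp add: algebra_simps)
        then have e: "d $ 2 + B * d $ 3 = 0" using B by simp
        then have 2: "d $ 2 = 0" by (rule small[rotated]) (use b[OF d(1)] in auto)
        then have "d $ 3 = 0" using e B by simp
        then show ?thesis using 1 2 by (simp add: vec_eq_iff forall_3)
      qed
      moreover have "\<bar>d $ 1 + B * d $ 2 + B * B * d $ 3\<bar> < int N"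
      proof -
        have "\<bar>B * d $ 2\<bar> \<le> B * b" "\<bar>B * B * d $ 3\<bar> \<le> B * B * b"
          using b[OF d(1)] b0 B_def by (auto simp: abs_mult intro!: mult_left_mono)
        then show ?thesis using N b[OF d(1), of 1] by linarith
      qed
      ultimately show "(\<Sum>s\<in>UNIV. w s * d $ s) \<noteq> 0 \<and> \<bar>\<Sum>s\<in>UNIV. w s * d $ s\<bar> < int N"
        using d by (auto simp: w)
    qed
  qed
qed

lemma cis_sum: "finite A \<Longrightarrow> cis (\<Sum>s\<in>A. f s) = (\<Prod>s\<in>A. cis (f s))"
  by (induction A rule: finite_induct) (simp_all add: cis_mult[symmetric])

lemma coeff_le_Anorm:
  assumes r: "\<rho> > 1" and v: "v \<in> Asp_rho \<rho>"
  shows "norm (v k) \<le> Anorm \<rho> v * exp (- ln \<rho> * freq_l1 k)"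
proof -
  obtain \<rho>' K where rK: "\<rho>' > \<rho>" "exp_decay K (ln \<rho>') v" using Asp_rho_decay[OF v r] by blast
  have ln: "ln \<rho> < ln \<rho>'" using rK r by simp
  have r1: "\<rho> \<ge> 1" using r by simp
  \<comment> \<open>Finite averaging separates only finitely many frequencies. The margin
    \<open>\<epsilon>\<close> is given away for the tail of the Laurent series, which is small
    uniformly over the polyannulus.\<close>
  have "norm (v k) * exp (ln \<rho> * freq_l1 k) \<le> Anorm \<rho> v + \<epsilon>" if e: "\<epsilon> > 0" for \<epsilon>
  proof -
    define g where "g = (\<lambda>q::freq. K * exp (- (ln \<rho>' - ln \<rho>) * freq_l1 q))"
    have g: "g summable_on UNIV" unfolding g_def
      by (rule summable_on_cmult_right[OF summable_on_exp_freq]) (use ln in simp)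
    obtain F where F: "finite F" "dist (sum g F) (infsum g UNIV) \<le> \<epsilon>"
      using infsum_finite_approximation[OF g e] by blast
    define G where "G = insert k F"
    have G: "finite G" "k \<in> G" using F by (auto simp: G_def)
    have gnn: "0 \<le> g q" for q using exp_decay_nonneg[OF rK(2)] by (simp add: g_def)
    have tail: "infsum g (- G) \<le> \<epsilon>"
    proof -
      have "infsum g UNIV = infsum g (G \<union> - G)" by (simp add: Un_commute)
      also have "\<dots> = sum g G + infsum g (- G)"
        using G by (subst infsum_Un_disjoint) (auto intro: summable_on_subset_banach[OF g])
      finally have "infsum g UNIV = sum g G + infsum g (- G)" .
      moreover have "sum g F \<le> sum g G" using F gnn by (intro sum_mono2) (auto simp: G_def)
      ultimately show ?thesis using F(2) by (simp add: dist_real_def)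
    qed
    obtain w :: "3 \<Rightarrow> int" and N :: nat where N: "N > 0" and
      w: "\<forall>d\<in>(\<lambda>q. q - k) ` G. d \<noteq> 0 \<longrightarrow> (\<Sum>s\<in>UNIV. w s * d $ s) \<noteq> 0 \<and> \<bar>\<Sum>s\<in>UNIV. w s * d $ s\<bar> < int N"
      by (rule kronecker_separation[OF finite_imageI[OF G(1), of "\<lambda>q. q - k"]])
    define \<phi> where "\<phi> = (\<lambda>d::freq. \<Sum>s\<in>UNIV. w s * d $ s)"
    have phi_diff: "\<phi> (q - k) = \<phi> q - \<phi> k" for q
      by (simp add: \<phi>_def sum_subtractf right_diff_distrib)
    \<comment> \<open>The radii in the polyannulus for which the monomial with exponent
      \<open>k\<close> has its largest modulus, computed in \<open>Rk\<close> below.\<close>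
    define \<rho>s where "\<rho>s = (\<lambda>s. if k $ s \<ge> 0 then \<rho> else 1 / \<rho>)"
    define z :: "nat \<Rightarrow> complex ^ 3" where
      "z = (\<lambda>m. \<chi> s. of_real (\<rho>s s) * cis (2 * pi * real m * real_of_int (w s) / real N))"
    define R where "R = (\<lambda>q::freq. \<Prod>s\<in>UNIV. \<rho>s s powi (q $ s))"
    have z: "z m \<in> polyannulus \<rho>" for m
      using r by (auto simp: polyannulus_def z_def \<rho>s_def norm_mult norm_divide field_simps)
        (smt (verit) mult_le_cancel_left1)+
    have mono: "(\<Prod>s\<in>UNIV. (z m $ s) powi (q $ s)) = of_real (R q) * cis (2 * pi * real m * real_of_int (\<phi> q) / real N)" for m q
    proof -
      have "(z m $ s) powi (q $ s) = of_real (\<rho>s s powi (q $ s)) * cis (2 * pi * real m / real N * (real_of_int (w s * q $ s)))" for s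
        by (simp add: z_def power_int_mult_distrib cis_power_int of_real_power_int mult_ac)
      then have "(\<Prod>s\<in>UNIV. (z m $ s) powi (q $ s)) = of_real (R q) * cis (\<Sum>s\<in>UNIV. 2 * pi * real m / real N * (real_of_int (w s * q $ s)))"
        by (simp add: prod.distrib R_def cis_sum)
      also have "(\<Sum>s\<in>UNIV. 2 * pi * real m / real N * (real_of_int (w s * q $ s))) = 2 * pi * real m * real_of_int (\<phi> q) / real N"
        by (simp add: sum_distrib_left sum_divide_distrib \<phi>_def mult_ac)
      finally show ?thesis .
    qed
    have Rk: "R k = exp (ln \<rho> * freq_l1 k)"
    proof -
      have "\<rho>s s powi (k $ s) = exp (ln \<rho> * \<bar>real_of_int (k $ s)\<bar>)" for s
      proof -
        have p: "\<rho>s s > 0" using r by (simp add: \<rho>s_def)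
        have "\<rho>s s powi (k $ s) = exp (real_of_int (k $ s) * ln (\<rho>s s))"
          by (rule powi_eq_exp[OF p])
        then show ?thesis using r by (auto simp: \<rho>s_def ln_div)
      qed
      then show ?thesis by (simp add: R_def exp_sum[symmetric] freq_l1_def sum_distrib_left)
    qed
    define T where "T = (\<lambda>m q. (\<Prod>s\<in>UNIV. (z m $ s) powi (q $ s)) *s v q)"
    \<comment> \<open>The conjugate phase of the monomial with exponent \<open>k\<close> at the m-th
      point: multiplying by it and summing over \<open>m\<close> isolates the coefficient at
      \<open>k\<close>.\<close>
    define c where "c = (\<lambda>m. cis (- (2 * pi * real m * real_of_int (\<phi> k) / real N)))"
    have Tsum: "(\<lambda>q. T m q) summable_on A" for m A
      unfolding T_def
      by (rule summable_on_subset_banach[OF abs_summable_summable[OF laurent_summable[OF z r1 rK(2) ln]]]) simp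
    have fin: "norm (\<Sum>q\<in>G. T m q) \<le> Anorm \<rho> v + \<epsilon>" for m
    proof -
      have "infsum (T m) UNIV = infsum (T m) (G \<union> - G)" by (simp add: Un_commute)
      also have "\<dots> = sum (T m) G + infsum (T m) (- G)"
        using G Tsum by (subst infsum_Un_disjoint) auto
      finally have "sum (T m) G = infsum (T m) UNIV - infsum (T m) (- G)" by simp
      moreover have "norm (infsum (T m) UNIV) \<le> Anorm \<rho> v"
        unfolding T_def by (rule norm_laurent_le_Anorm[OF z r1 rK(2) ln])
      moreover have "norm (infsum (T m) (- G)) \<le> infsum g (- G)"
      proof (rule norm_infsum_le[OF has_sum_infsum[OF Tsum] has_sum_infsum])
        show "g summable_on - G" by (rule summable_on_subset_banach[OF g]) simp
        show "norm (T m q) \<le> g q" for q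
          unfolding T_def g_def by (rule laurent_term_bound[OF z r1 rK(2)])
      qed
      ultimately show ?thesis using tail norm_triangle_ineq4[of "infsum (T m) UNIV" "infsum (T m) (- G)"] by simp
    qed
    have "(\<Sum>m<N. c m *s (\<Sum>q\<in>G. T m q)) = (\<Sum>q\<in>G. \<Sum>m<N. c m *s T m q)"
      by (subst sum.swap) (simp add: vec.scale_sum_right)
    also have "\<dots> = (\<Sum>q\<in>G. if q = k then of_real (real N * R k) *s v k else 0)"
    proof (rule sum.cong[OF refl])
      fix q assume q: "q \<in> G"
      have t: "c m *s T m q = (of_real (R q) * cis (2 * pi * real m * real_of_int (\<phi> (q - k)) / real N)) *s v q" for m
      proof -
        have "c m * cis (2 * pi * real m * real_of_int (\<phi> q) / real N) = cis (2 * pi * real m * real_of_int (\<phi> (q - k)) / real N)"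
          unfolding c_def cis_mult phi_diff by (rule arg_cong[of _ _ cis]) (simp add: diff_divide_distrib algebra_simps)
        then show ?thesis unfolding T_def mono vector_smult_assoc by (simp add: mult_ac)
      qed
      have "(\<Sum>m<N. c m *s T m q) = (of_real (R q) * (\<Sum>m<N. cis (2 * pi * real m * real_of_int (\<phi> (q - k)) / real N))) *s v q"
        unfolding t sum_distrib_left vec.scale_sum_left ..
      also have "\<dots> = (if q = k then of_real (real N * R k) *s v k else 0)"
      proof (cases "q = k")
        case True
        have "\<phi> 0 = 0" by (simp add: \<phi>_def)
        then show ?thesis using True by (simp add: mult.commute)
      next
        case False
        then have "\<phi> (q - k) \<noteq> 0 \<and> \<bar>\<phi> (q - k)\<bar> < int N"
          using w q unfolding \<phi>_def by fastforce
        then show ?thesis using False sum_cis_eq_0 by simp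
      qed
      finally show "(\<Sum>m<N. c m *s T m q) = (if q = k then of_real (real N * R k) *s v k else 0)" .
    qed
    also have "\<dots> = of_real (real N * R k) *s v k" using G by simp
    finally have eq: "(\<Sum>m<N. c m *s (\<Sum>q\<in>G. T m q)) = of_real (real N * R k) *s v k" .
    have "norm (of_real (real N * R k) *s v k) \<le> (\<Sum>m<N. norm (c m *s (\<Sum>q\<in>G. T m q)))"
      unfolding eq[symmetric] by (rule norm_sum)
    also have "\<dots> \<le> (\<Sum>m<N. Anorm \<rho> v + \<epsilon>)"
      by (rule sum_mono) (use fin in \<open>simp add: norm_vector_smult c_def\<close>)
    finally have "real N * (R k * norm (v k)) \<le> real N * (Anorm \<rho> v + \<epsilon>)"
      by (simp add: norm_vector_smult Rk norm_mult)
    then have "R k * norm (v k) \<le> Anorm \<rho> v + \<epsilon>" using N by simp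
    then show ?thesis by (simp add: Rk mult.commute)
  qed
  then have "norm (v k) * exp (ln \<rho> * freq_l1 k) \<le> Anorm \<rho> v"
    by (rule field_le_epsilon)
  then have "norm (v k) * exp (ln \<rho> * freq_l1 k) * exp (- ln \<rho> * freq_l1 k) \<le> Anorm \<rho> v * exp (- ln \<rho> * freq_l1 k)"
    by (intro mult_right_mono) auto
  then show ?thesis by (simp add: mult.assoc exp_add[symmetric])
qed

lemma Anorm_nonneg: "\<rho> > 1 \<Longrightarrow> v \<in> Asp_rho \<rho> \<Longrightarrow> 0 \<le> Anorm \<rho> v"
  using order_trans[OF norm_ge_zero coeff_le_Anorm[of \<rho> v 0]] by simp

subsection \<open>Convergence in the inductive limit topology\<close>

text \<open>The continuous seminorms of the inductive limit, since boundedness on each step is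
  enough; they turn convergence in \<open>A_topology\<close> into convergence of numbers.
  Homogeneity and subadditivity are packed into one inequality for \<open>lincomb\<close>.\<close>

definition A_seminorm :: "(vfield \<Rightarrow> real) \<Rightarrow> bool" where
  "A_seminorm p \<longleftrightarrow>
     (\<forall>v\<in>Asp. \<forall>w\<in>Asp. \<forall>a b. p (lincomb a v b w) \<le> \<bar>a\<bar> * p v + \<bar>b\<bar> * p w) \<and>
     (\<forall>\<rho>>1. \<exists>C. \<forall>v\<in>Asp_rho \<rho>. p v \<le> C * Anorm \<rho> v)"

lemma A_zero_nhd_Asp: "A_zero_nhd Asp"
  unfolding A_zero_nhd_def using Asp_lincomb
  by (auto intro!: exI[of _ "1::real"] dest: subsetD[OF Asp_rho_subset])

lemma A_open_Asp: "A_open Asp"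
  unfolding A_open_def using A_zero_nhd_Asp Asp_lincomb by blast

lemma topspace_A_topology: "topspace A_topology = Asp"
proof -
  have "openin A_topology Asp" by (simp add: openin_A_topology A_open_Asp)
  moreover have "\<And>U. openin A_topology U \<Longrightarrow> U \<subseteq> Asp" by (simp add: openin_A_topology A_open_def)
  ultimately show ?thesis unfolding topspace_def by blast
qed

lemma A_open_seminorm_ball:
  assumes p: "A_seminorm p" and l: "l \<in> Asp"
  shows "A_open {v \<in> Asp. p (lincomb 1 v (- 1) l) < \<epsilon>}"
  unfolding A_open_def
proof (intro conjI ballI)
  fix v assume "v \<in> {v \<in> Asp. p (lincomb 1 v (- 1) l) < \<epsilon>}"
  then have v: "v \<in> Asp" "p (lincomb 1 v (- 1) l) < \<epsilon>" by auto
  define \<delta> where "\<delta> = (\<epsilon> - p (lincomb 1 v (- 1) l)) / 2"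
  have d: "\<delta> > 0" using v by (simp add: \<delta>_def)
  define W where "W = {w \<in> Asp. p w \<le> \<delta>}"
  have "A_zero_nhd W"
    unfolding A_zero_nhd_def
  proof (intro conjI ballI allI impI)
    fix x y a b assume x: "x \<in> W" and y: "y \<in> W" and ab: "\<bar>a\<bar> + \<bar>b\<bar> \<le> (1::real)"
    have "p (lincomb a x b y) \<le> \<bar>a\<bar> * p x + \<bar>b\<bar> * p y"
      using p x y by (auto simp: A_seminorm_def W_def)
    also have "\<dots> \<le> \<bar>a\<bar> * \<delta> + \<bar>b\<bar> * \<delta>"
      using x y by (intro add_mono mult_left_mono) (auto simp: W_def)
    also have "\<dots> \<le> 1 * \<delta>"
      unfolding distrib_right[symmetric] using ab d by (intro mult_right_mono) auto
    finally show "lincomb a x b y \<in> W" using x y by (simp add: W_def Asp_lincomb)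
  next
    fix \<rho> :: real assume r: "\<rho> > 1"
    then obtain C where C: "\<forall>v\<in>Asp_rho \<rho>. p v \<le> C * Anorm \<rho> v" using p by (auto simp: A_seminorm_def)
    show "\<exists>e>0. {v \<in> Asp_rho \<rho>. Anorm \<rho> v < e} \<subseteq> W"
    proof (intro exI conjI subsetI)
      \<comment> \<open>The constant from \<open>A_seminorm\<close> may be 0 or negative, hence
        \<open>\<bar>C\<bar> + 1\<close>.\<close>
      show "\<delta> / (\<bar>C\<bar> + 1) > 0" using d by simp
      fix x assume "x \<in> {v \<in> Asp_rho \<rho>. Anorm \<rho> v < \<delta> / (\<bar>C\<bar> + 1)}"
      then have x: "x \<in> Asp_rho \<rho>" "Anorm \<rho> x < \<delta> / (\<bar>C\<bar> + 1)" by auto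
      have "p x \<le> C * Anorm \<rho> x" using C x by blast
      also have "\<dots> \<le> (\<bar>C\<bar> + 1) * Anorm \<rho> x"
        using Anorm_nonneg[OF r x(1)] by (intro mult_right_mono) auto
      also have "\<dots> \<le> \<delta>" using x(2) by (simp add: field_simps)
      finally show "x \<in> W" using x Asp_rho_subset[OF r] by (auto simp: W_def)
    qed
  qed (auto simp: W_def)
  moreover have "lincomb 1 v 1 ` W \<subseteq> {v \<in> Asp. p (lincomb 1 v (- 1) l) < \<epsilon>}"
  proof clarsimp
    fix w assume w: "w \<in> W"
    then have wA: "w \<in> Asp" "p w \<le> \<delta>" by (auto simp: W_def)
    have e: "lincomb 1 (lincomb 1 v 1 w) (- 1) l = lincomb 1 (lincomb 1 v (- 1) l) 1 w"
      by (rule ext) (simp add: lincomb_def)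
    have "p (lincomb 1 (lincomb 1 v (- 1) l) 1 w) \<le> \<bar>1\<bar> * p (lincomb 1 v (- 1) l) + \<bar>1\<bar> * p w"
      using p Asp_lincomb[OF v(1) l] wA(1) unfolding A_seminorm_def by blast
    then show "lincomb 1 v 1 w \<in> Asp \<and> p (lincomb 1 (lincomb 1 v 1 w) (- 1) l) < \<epsilon>"
      using wA v(1) d unfolding e by (simp add: Asp_lincomb \<delta>_def field_simps)
  qed
  ultimately show "\<exists>W. A_zero_nhd W \<and> lincomb 1 v 1 ` W \<subseteq> {v \<in> Asp. p (lincomb 1 v (- 1) l) < \<epsilon>}"
    by blast
qed auto

lemma limitin_A_seminorm:
  assumes lim: "limitin A_topology f l F" and p: "A_seminorm p" and e: "\<epsilon> > 0"
  shows "eventually (\<lambda>x. f x \<in> Asp \<and> p (lincomb 1 (f x) (- 1) l) < \<epsilon>) F"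
proof -
  have l: "l \<in> Asp" using lim by (simp add: limitin_def topspace_A_topology)
  \<comment> \<open>The zero field is a combination with both scalars 0, so the inequality in
    \<open>A_seminorm\<close> makes its value at most 0.\<close>
  have "lincomb 1 l (- 1) l = lincomb 0 l 0 l" by (simp add: lincomb_def)
  moreover have "p (lincomb 0 l 0 l) \<le> \<bar>0\<bar> * p l + \<bar>0\<bar> * p l"
    using p l unfolding A_seminorm_def by blast
  ultimately have "l \<in> {v \<in> Asp. p (lincomb 1 v (- 1) l) < \<epsilon>}" using l e by simp
  with lim A_open_seminorm_ball[OF p l, of \<epsilon>] show ?thesis
    unfolding limitin_def openin_A_topology by fastforce
qed

lemma A_seminorm_coeff: "A_seminorm (\<lambda>v. norm (v k))"
  unfolding A_seminorm_def
proof (intro conjI ballI allI impI)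
  fix v w :: vfield and a b :: real
  show "norm (lincomb a v b w k) \<le> \<bar>a\<bar> * norm (v k) + \<bar>b\<bar> * norm (w k)"
    unfolding lincomb_def using norm_triangle_ineq[of "a *\<^sub>R v k" "b *\<^sub>R w k"] by simp
next
  fix \<rho> :: real assume "\<rho> > 1"
  then show "\<exists>C. \<forall>v\<in>Asp_rho \<rho>. norm (v k) \<le> C * Anorm \<rho> v"
    using coeff_le_Anorm by (auto simp: mult.commute intro!: exI[of _ "exp (- ln \<rho> * freq_l1 k)"])
qed

lemma limitin_A_coeff:
  assumes "limitin A_topology f l F"
  shows "((\<lambda>x. f x k) \<longlongrightarrow> l k) F"
proof (rule tendstoI)
  fix \<epsilon> :: real assume "\<epsilon> > 0"
  from limitin_A_seminorm[OF assms A_seminorm_coeff[of k] this]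
  show "\<forall>\<^sub>F x in F. dist (f x k) (l k) < \<epsilon>"
    by (rule eventually_mono) (simp add: lincomb_def dist_norm)
qed

text \<open>Convergence in one step implies convergence in the limit topology: the differences lie
  in \<open>Asp_rho (exp (\<sigma> / 2))\<close> and tend to 0 in the norm of that step, and every
  neighbourhood of 0 contains a ball of it.\<close>

lemma limitin_A_I:
  assumes l: "l \<in> Asp" and s: "\<sigma> > 0"
    and f: "eventually (\<lambda>x. f x \<in> Asp) F"
    and b: "eventually (\<lambda>x. exp_decay (\<epsilon> x) \<sigma> (lincomb 1 (f x) (- 1) l)) F"
    and e: "(\<epsilon> \<longlongrightarrow> 0) F"
  shows "limitin A_topology f l F"
  unfolding limitin_def topspace_A_topology openin_A_topology
proof (intro conjI allI impI)
  fix U assume U: "A_open U \<and> l \<in> U"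
  then obtain W where W: "A_zero_nhd W" "lincomb 1 l 1 ` W \<subseteq> U" unfolding A_open_def by blast
  define \<rho> where "\<rho> = exp (\<sigma> / 2)"
  have r: "\<rho> > 1" using s by (simp add: \<rho>_def)
  obtain e0 where e0: "e0 > 0" "{v \<in> Asp_rho \<rho>. Anorm \<rho> v < e0} \<subseteq> W"
    using W r by (auto simp: A_zero_nhd_def)
  define C where "C = (\<Sum>\<^sub>\<infinity>k::freq. exp (- (\<sigma> - ln \<rho>) * freq_l1 k))"
  have "((\<lambda>x. \<epsilon> x * C) \<longlongrightarrow> 0) F" using tendsto_mult_left_zero[OF e] .
  then have "eventually (\<lambda>x. \<epsilon> x * C < e0) F" using e0(1) by (rule order_tendstoD)
  with f b show "eventually (\<lambda>x. f x \<in> U) F"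
  proof eventually_elim
    case (elim x)
    define d where "d = lincomb 1 (f x) (- 1) l"
    have dA: "d \<in> Asp" using elim l by (simp add: d_def Asp_lincomb)
    have dd: "exp_decay (\<epsilon> x) \<sigma> d" using elim by (simp add: d_def)
    have "d \<in> Asp_rho \<rho>" unfolding \<rho>_def
      by (rule exp_decay_Asp_rho[OF dd s]) (use dA in \<open>auto simp: Asp_iff\<close>)
    moreover have "Anorm \<rho> d \<le> \<epsilon> x * C" unfolding C_def
      by (rule Anorm_le[OF _ dd]) (use r s in \<open>auto simp: \<rho>_def\<close>)
    ultimately have "d \<in> W" using e0 elim by auto
    moreover have "lincomb 1 l 1 d = f x" by (simp add: d_def lincomb_def)
    ultimately show ?case using W(2) by (metis image_subset_iff)
  qed
qed (rule l)

text \<open>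
  Convergent sequences are bounded in one step of the inductive limit: otherwise the seminorm
  \<open>sup\<^sub>m |v(\<kappa> m)| e\<^bsup>|\<kappa> m|/m\<^esup> / m\<close> is continuous and detects frequencies \<open>\<kappa> m\<close> that violate every bound.
\<close>

lemma A_seminorm_sup:
  fixes \<kappa> :: "nat \<Rightarrow> freq"
  defines "\<gamma> \<equiv> \<lambda>m. exp (freq_l1 (\<kappa> m) / real (Suc m)) / real (Suc m)"
  shows "A_seminorm (\<lambda>v. SUP m. norm (v (\<kappa> m)) * \<gamma> m)"
    and "v \<in> Asp \<Longrightarrow> norm (v (\<kappa> m)) * \<gamma> m \<le> (SUP m. norm (v (\<kappa> m)) * \<gamma> m)"
proof -
  have g0: "\<gamma> m > 0" for m by (simp add: \<gamma>_def)
  have bd: "\<exists>C\<ge>0. \<forall>v A m. exp_decay A \<sigma> v \<longrightarrow> norm (v (\<kappa> m)) * \<gamma> m \<le> C * A" if s: "\<sigma> > 0" for \<sigma>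
  proof -
    \<comment> \<open>From \<open>M\<close> on, the growth rate 1/(m+1) of the weight is at most the
      decay rate \<open>\<sigma>\<close>; the finitely many earlier weights go into
      \<open>C\<close>.\<close>
    obtain M :: nat where M: "1 / \<sigma> < real M" using reals_Archimedean2 by blast
    define C where "C = 1 + (\<Sum>m<M. \<gamma> m)"
    have "norm (v (\<kappa> m)) * \<gamma> m \<le> C * A" if v: "exp_decay A \<sigma> v" for v A m
    proof -
      have A: "A \<ge> 0" using v exp_decay_nonneg by blast
      have le: "norm (v (\<kappa> m)) \<le> A * exp (- \<sigma> * freq_l1 (\<kappa> m))" using v by (simp add: exp_decay_def)
      show ?thesis
      proof (cases "m < M")
        case True
        have "norm (v (\<kappa> m)) \<le> A * 1"
          by (rule order_trans[OF le mult_left_mono]) (use A s in auto)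
        then have "norm (v (\<kappa> m)) * \<gamma> m \<le> A * \<gamma> m" using g0[of m] by simp
        moreover have "\<gamma> m \<le> C" unfolding C_def
          using member_le_sum[of m "{..<M}" \<gamma>] True g0 by (smt (verit) finite_lessThan lessThan_iff DiffD1)
        ultimately show ?thesis using A mult_left_mono[of "\<gamma> m" C A] by (simp add: mult.commute)
      next
        case False
        have "1 / \<sigma> \<le> real (Suc m)" using M False by linarith
        then have "1 / real (Suc m) \<le> \<sigma>" using s by (simp add: field_simps)
        then have sm: "freq_l1 (\<kappa> m) / real (Suc m) \<le> \<sigma> * freq_l1 (\<kappa> m)"
          using mult_right_mono[of "1 / real (Suc m)" \<sigma> "freq_l1 (\<kappa> m)"] by simp
        have "\<gamma> m \<le> exp (freq_l1 (\<kappa> m) / real (Suc m)) / 1" unfolding \<gamma>_def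
          by (rule divide_left_mono) auto
        also have "\<dots> \<le> exp (\<sigma> * freq_l1 (\<kappa> m))" using sm by simp
        finally have "norm (v (\<kappa> m)) * \<gamma> m \<le> A * exp (- \<sigma> * freq_l1 (\<kappa> m)) * exp (\<sigma> * freq_l1 (\<kappa> m))"
          using le A by (intro mult_mono) (auto simp: less_imp_le[OF g0])
        also have "\<dots> = 1 * A" by (simp add: mult.assoc exp_add[symmetric])
        also have "\<dots> \<le> C * A"
          using A g0 by (intro mult_right_mono) (auto simp: C_def sum_nonneg less_imp_le)
        finally show ?thesis .
      qed
    qed
    moreover have "C \<ge> 0" using g0 by (auto simp: C_def sum_nonneg less_imp_le intro!: add_nonneg_nonneg)
    ultimately show ?thesis by blast
  qed
  have bdd: "bdd_above (range (\<lambda>m. norm (v (\<kappa> m)) * \<gamma> m))" if "v \<in> Asp" for v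
  proof -
    obtain K \<sigma> where "\<sigma> > 0" "exp_decay K \<sigma> v" using \<open>v \<in> Asp\<close> by (auto simp: Asp_iff)
    with bd show ?thesis by (meson bdd_aboveI2)
  qed
  show up: "norm (v (\<kappa> m)) * \<gamma> m \<le> (SUP m. norm (v (\<kappa> m)) * \<gamma> m)" if "v \<in> Asp" for v m
    by (rule cSUP_upper[OF UNIV_I bdd[OF that]])
  show "A_seminorm (\<lambda>v. SUP m. norm (v (\<kappa> m)) * \<gamma> m)"
    unfolding A_seminorm_def
  proof (intro conjI ballI allI impI)
    fix v w a b assume vw: "v \<in> Asp" "w \<in> Asp"
    show "(SUP m. norm (lincomb a v b w (\<kappa> m)) * \<gamma> m)
        \<le> \<bar>a\<bar> * (SUP m. norm (v (\<kappa> m)) * \<gamma> m) + \<bar>b\<bar> * (SUP m. norm (w (\<kappa> m)) * \<gamma> m)"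
    proof (rule cSUP_least)
      fix m
      have "norm (lincomb a v b w (\<kappa> m)) * \<gamma> m \<le> (\<bar>a\<bar> * norm (v (\<kappa> m)) + \<bar>b\<bar> * norm (w (\<kappa> m))) * \<gamma> m"
        unfolding lincomb_def using norm_triangle_ineq[of "a *\<^sub>R v (\<kappa> m)" "b *\<^sub>R w (\<kappa> m)"] g0[of m]
        by (intro mult_right_mono) auto
      also have "\<dots> = \<bar>a\<bar> * (norm (v (\<kappa> m)) * \<gamma> m) + \<bar>b\<bar> * (norm (w (\<kappa> m)) * \<gamma> m)"
        by (simp add: algebra_simps)
      also have "\<dots> \<le> \<bar>a\<bar> * (SUP m. norm (v (\<kappa> m)) * \<gamma> m) + \<bar>b\<bar> * (SUP m. norm (w (\<kappa> m)) * \<gamma> m)"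
        by (intro add_mono mult_left_mono up vw) auto
      finally show "norm (lincomb a v b w (\<kappa> m)) * \<gamma> m
        \<le> \<bar>a\<bar> * (SUP m. norm (v (\<kappa> m)) * \<gamma> m) + \<bar>b\<bar> * (SUP m. norm (w (\<kappa> m)) * \<gamma> m)" .
    qed auto
  next
    fix \<rho> :: real assume r: "\<rho> > 1"
    then obtain C where C: "\<forall>v A m. exp_decay A (ln \<rho>) v \<longrightarrow> norm (v (\<kappa> m)) * \<gamma> m \<le> C * A"
      using bd[of "ln \<rho>"] by auto
    have "(SUP m. norm (v (\<kappa> m)) * \<gamma> m) \<le> C * Anorm \<rho> v" if "v \<in> Asp_rho \<rho>" for v
    proof (rule cSUP_least)
      have "exp_decay (Anorm \<rho> v) (ln \<rho>) v"
        using coeff_le_Anorm[OF r that] by (simp add: exp_decay_def)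
      then show "norm (v (\<kappa> m)) * \<gamma> m \<le> C * Anorm \<rho> v" for m using C by blast
    qed auto
    then show "\<exists>C. \<forall>v\<in>Asp_rho \<rho>. (SUP m. norm (v (\<kappa> m)) * \<gamma> m) \<le> C * Anorm \<rho> v" by blast
  qed
qed

lemma limitin_A_uniform_decay:
  assumes lim: "limitin A_topology f l sequentially" and f: "\<And>j. f j \<in> Asp"
  obtains K \<sigma> where "\<sigma> > 0" "\<And>j. exp_decay K \<sigma> (lincomb 1 (f j) (- 1) l)"
proof -
  define g where "g = (\<lambda>j. lincomb 1 (f j) (- 1) l)"
  have l: "l \<in> Asp" using lim by (simp add: limitin_def topspace_A_topology)
  have gA: "g j \<in> Asp" for j using f l by (simp add: g_def Asp_lincomb)
  have "\<exists>K \<sigma>. \<sigma> > 0 \<and> (\<forall>j. exp_decay K \<sigma> (g j))"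
  proof (rule ccontr)
    assume neg: "\<not> ?thesis"
    \<comment> \<open>The failure is tested with constant m+1 and rate 1/(m+1) at once, so that
      every fixed constant and rate are eventually beaten.\<close>
    have "\<exists>j k. norm (g j k) > real (Suc m) * exp (- (1 / real (Suc m)) * freq_l1 k)" for m
      using neg[unfolded exp_decay_def] by (metis not_less of_nat_0_less_iff zero_less_Suc zero_less_divide_1_iff)
    then obtain \<iota> \<kappa> where ik: "\<And>m. norm (g (\<iota> m) (\<kappa> m)) > real (Suc m) * exp (- (1 / real (Suc m)) * freq_l1 (\<kappa> m))"
      by metis
    define \<gamma> where "\<gamma> = (\<lambda>m. exp (freq_l1 (\<kappa> m) / real (Suc m)) / real (Suc m))"
    have big: "norm (g (\<iota> m) (\<kappa> m)) * \<gamma> m > 1" for m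
    proof -
      have "real (Suc m) * exp (- (1 / real (Suc m)) * freq_l1 (\<kappa> m)) * \<gamma> m = 1"
        unfolding \<gamma>_def by (simp add: exp_minus)
      moreover have "\<gamma> m > 0" by (simp add: \<gamma>_def)
      ultimately show ?thesis using ik[of m] by (metis mult_less_cancel_right_pos)
    qed
    have "eventually (\<lambda>j. (SUP m. norm (g j (\<kappa> m)) * \<gamma> m) < 1) sequentially"
      using limitin_A_seminorm[OF lim A_seminorm_sup(1)[of \<kappa>], of 1]
      unfolding g_def \<gamma>_def by (auto elim: eventually_mono)
    then obtain J where J: "\<And>j. j \<ge> J \<Longrightarrow> (SUP m. norm (g j (\<kappa> m)) * \<gamma> m) < 1"
      by (auto simp: eventually_sequentially)
    \<comment> \<open>The seminorm exceeds 1 at every offending index but is below 1 from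
      \<open>J\<close> on. Hence only finitely many fields offend, and finitely many fields share
      one constant and one rate.\<close>
    have iJ: "\<iota> m < J" for m
      using J[of "\<iota> m"] big[of m] A_seminorm_sup(2)[OF gA, of "\<iota> m" \<kappa> m] unfolding \<gamma>_def
      by (meson not_less less_trans not_less_iff_gr_or_eq order_le_less_trans)
    obtain KK \<sigma>\<sigma> where ks: "\<And>j. \<sigma>\<sigma> j > 0 \<and> exp_decay (KK j) (\<sigma>\<sigma> j) (g j)"
      using Asp_exp_decay[OF gA] by metis
    obtain m :: nat where m: "real m > (\<Sum>j<J. \<bar>KK j\<bar> + 1 / \<sigma>\<sigma> j)" using reals_Archimedean2 by blast
    let ?j = "\<iota> m"
    have pos: "1 / \<sigma>\<sigma> j > 0" for j using ks by simp
    have "\<bar>KK ?j\<bar> + 1 / \<sigma>\<sigma> ?j \<le> (\<Sum>j<J. \<bar>KK j\<bar> + 1 / \<sigma>\<sigma> j)"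
      by (rule member_le_sum) (use iJ pos in \<open>auto simp: less_imp_le\<close>)
    then have 1: "\<bar>KK ?j\<bar> + 1 / \<sigma>\<sigma> ?j < real (Suc m)" using m by simp
    have 2: "1 / real (Suc m) \<le> \<sigma>\<sigma> ?j"
      using 1 pos[of ?j] ks[of ?j] by (simp add: field_simps) (smt (verit) abs_ge_zero mult_nonneg_nonneg)
    have "exp_decay (real (Suc m)) (1 / real (Suc m)) (g ?j)"
    proof (rule exp_decay_mono)
      show "exp_decay (KK ?j) (\<sigma>\<sigma> ?j) (g ?j)" using ks by blast
      show "KK ?j \<le> real (Suc m)" using 1 pos[of ?j] by linarith
    qed (rule 2)
    then show False using ik[of m] unfolding exp_decay_def by (meson not_less)
  qed
  then show ?thesis using that by (auto simp: g_def)
qed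

section \<open>The Euler nonlinearity on analytic fields\<close>

lemma cdot_commute: "cdot a b = cdot b a"
  by (simp add: cdot_def mult.commute)

lemma cdot_diff_right: "cdot a (b - c) = cdot a b - cdot a c"
  by (simp add: cdot_def sum_subtractf right_diff_distrib)

lemma cdot_add_left: "cdot (a + b) c = cdot a c + cdot b c"
  by (simp add: cdot_def sum.distrib algebra_simps)

lemma cdot_smult_right: "cdot a (c *s b) = c * cdot a b"
  by (simp add: cdot_def sum_distrib_left mult_ac)

lemma cdot_smult_left: "cdot (c *s a) b = c * cdot a b"
  by (simp add: cdot_def sum_distrib_left mult_ac)

lemma cdot_scaleR_left: "cdot (r *\<^sub>R a) b = r *\<^sub>R cdot a b"
  by (simp add: cdot_def scaleR_sum_right)

lemma cdot_zero_right [simp]: "cdot a 0 = 0"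
  by (simp add: cdot_def)

lemma norm_cdot_le: "norm (cdot a b) \<le> norm a * norm b"
proof -
  have "norm (cdot a b) \<le> (\<Sum>s\<in>UNIV. \<bar>norm (a $ s)\<bar> * \<bar>norm (b $ s)\<bar>)"
    unfolding cdot_def by (rule sum_norm_le) (simp add: norm_mult)
  also have "\<dots> \<le> norm a * norm b"
    unfolding norm_vec_def by (rule L2_set_mult_ineq)
  finally show ?thesis .
qed

lemma bounded_linear_cdot_right: "bounded_linear (cdot a)"
  by (rule bounded_linear_intro[of _ "norm a"])
    (use norm_cdot_le[of a] in \<open>simp_all add: cdot_add_right cdot_scaleR_right mult.commute\<close>)

lemma norm_freq_vec: "norm (freq_vec k) = freq_norm k"
  by (simp add: norm_vec_def L2_set_def freq_vec_def freq_norm_def)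

lemma freq_vec_minus: "freq_vec (- k) = - freq_vec k"
  by (simp add: freq_vec_def vec_eq_iff)

lemma freq_vec_diff: "freq_vec (k - l) = freq_vec k - freq_vec l"
  by (simp add: freq_vec_def vec_eq_iff)

lemma cdot_freq_vec_self: "cdot (freq_vec k) (freq_vec k) = of_real ((freq_norm k)\<^sup>2)"
  by (simp add: cdot_def freq_vec_def freq_norm_def sum_nonneg power2_eq_square)

lemma leray_add: "leray k (b + c) = leray k b + leray k c"
  by (simp add: leray_def cdot_add_right add_divide_distrib vec_eq_iff algebra_simps)

lemma leray_smult: "leray k (c *s b) = c *s leray k b"
  by (simp add: leray_def cdot_smult_right vec_eq_iff algebra_simps)

lemma scaleR_eq_smult: "r *\<^sub>R (b :: complex ^ 'n) = of_real r *s b"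
  by (simp add: vec_eq_iff scaleR_conv_of_real[where 'a = complex])

lemma leray_scaleR: "leray k (r *\<^sub>R b) = r *\<^sub>R leray k b"
  by (simp add: scaleR_eq_smult leray_smult)

lemma norm_leray_le: "norm (leray k c) \<le> 2 * norm c"
proof (cases "k = 0")
  case False
  then have k: "freq_norm k > 0" using freq_norm_ge_1[OF False] by linarith
  have "norm (leray k c) \<le> norm c + norm ((cdot (freq_vec k) c / of_real ((freq_norm k)\<^sup>2)) *s freq_vec k)"
    using False by (simp add: leray_def norm_triangle_ineq4)
  also have "norm ((cdot (freq_vec k) c / of_real ((freq_norm k)\<^sup>2)) *s freq_vec k)
      = norm (cdot (freq_vec k) c) / freq_norm k"
    using k by (simp add: norm_vector_smult norm_divide norm_mult norm_freq_vec power2_eq_square)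
  also have "\<dots> \<le> (freq_norm k * norm c) / freq_norm k"
    using norm_cdot_le[of "freq_vec k" c] k by (intro divide_right_mono) (auto simp: norm_freq_vec)
  finally show ?thesis using k by simp
qed (simp add: leray_def)

lemma cdot_leray: "k \<noteq> 0 \<Longrightarrow> cdot (freq_vec k) (leray k c) = 0"
proof -
  assume k: "k \<noteq> 0"
  then have "freq_norm k \<noteq> 0" using freq_norm_ge_1[OF k] by auto
  then show ?thesis using k
    by (simp add: leray_def cdot_diff_right cdot_smult_right cdot_freq_vec_self)
qed

section \<open>Complex conjugation and the reality condition\<close>

definition cnj_vec :: "complex ^ 3 \<Rightarrow> complex ^ 3" where
  "cnj_vec x = (\<chi> s. cnj (x $ s))"

lemma bounded_linear_cnj_vec: "bounded_linear cnj_vec"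
  by (rule bounded_linear_intro[of _ 1])
    (simp_all add: cnj_vec_def vec_eq_iff norm_vec_def)

lemma cnj_vec_smult: "cnj_vec (c *s x) = cnj c *s cnj_vec x"
  by (simp add: cnj_vec_def vec_eq_iff)

lemma cnj_vec_minus: "cnj_vec (- x) = - cnj_vec x"
  by (simp add: cnj_vec_def vec_eq_iff)

lemma cnj_vec_cnj_vec [simp]: "cnj_vec (cnj_vec x) = x"
  by (simp add: cnj_vec_def vec_eq_iff)

lemma cnj_vec_freq_vec [simp]: "cnj_vec (freq_vec k) = freq_vec k"
  by (simp add: cnj_vec_def freq_vec_def vec_eq_iff)

lemma cdot_cnj_vec: "cdot (cnj_vec a) (cnj_vec b) = cnj (cdot a b)"
  by (simp add: cdot_def cnj_vec_def)

lemma leray_cnj_vec: "leray (- k) (cnj_vec c) = cnj_vec (leray k c)"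
proof -
  have "cdot (- freq_vec k) (cnj_vec c) = - cnj (cdot (freq_vec k) c)"
    using cdot_smult_left[of "-1" "freq_vec k" "cnj_vec c"] cdot_cnj_vec[of "freq_vec k" c] by simp
  then show ?thesis
    by (simp add: leray_def freq_vec_minus) (simp add: cnj_vec_def vec_eq_iff freq_vec_def)
qed

lemma real_field_iff: "real_field v \<longleftrightarrow> (\<forall>k. v (- k) = cnj_vec (v k))"
  by (simp add: real_field_def cnj_vec_def)

subsection \<open>Wiener norms\<close>

text \<open>Weighted l1 norms. For nonnegative rates the weight is submultiplicative, so a
  convolution is bounded in them without loss of rate, which pointwise bounds as in
  \<open>exp_decay\<close> do not provide. Finiteness is a separate predicate because
  \<open>infsum\<close> assigns 0 to a family that is not summable.\<close>

definition wiener_fin :: "real \<Rightarrow> vfield \<Rightarrow> bool" where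
  "wiener_fin \<sigma> v \<longleftrightarrow> (\<lambda>k. exp (\<sigma> * freq_l1 k) * norm (v k)) summable_on UNIV"

definition wiener :: "real \<Rightarrow> vfield \<Rightarrow> real" where
  "wiener \<sigma> v = (\<Sum>\<^sub>\<infinity>k. exp (\<sigma> * freq_l1 k) * norm (v k))"

lemma wiener_nonneg: "0 \<le> wiener \<sigma> v"
  unfolding wiener_def by (rule infsum_nonneg) simp

lemma exp_decay_wiener:
  assumes v: "exp_decay K \<sigma> v" and s: "\<sigma>' < \<sigma>"
  shows "wiener_fin \<sigma>' v" "wiener \<sigma>' v \<le> K * (\<Sum>\<^sub>\<infinity>k::freq. exp (- (\<sigma> - \<sigma>') * freq_l1 k))"
proof -
  have sm: "(\<lambda>k::freq. K * exp (- (\<sigma> - \<sigma>') * freq_l1 k)) summable_on UNIV"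
    by (rule summable_on_cmult_right[OF summable_on_exp_freq]) (use s in simp)
  have le: "exp (\<sigma>' * freq_l1 k) * norm (v k) \<le> K * exp (- (\<sigma> - \<sigma>') * freq_l1 k)" for k
  proof -
    have "exp (\<sigma>' * freq_l1 k) * norm (v k) \<le> exp (\<sigma>' * freq_l1 k) * (K * exp (- \<sigma> * freq_l1 k))"
      using v by (intro mult_left_mono) (auto simp: exp_decay_def)
    also have "\<dots> = K * exp (- (\<sigma> - \<sigma>') * freq_l1 k)"
      by (simp add: exp_add[symmetric] algebra_simps)
    finally show ?thesis .
  qed
  show 1: "wiener_fin \<sigma>' v" unfolding wiener_fin_def
    by (rule summable_on_comparison_test[OF sm le]) simp
  have "wiener \<sigma>' v \<le> (\<Sum>\<^sub>\<infinity>k::freq. K * exp (- (\<sigma> - \<sigma>') * freq_l1 k))"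
    unfolding wiener_def by (rule infsum_mono[OF 1[unfolded wiener_fin_def] sm le])
  then show "wiener \<sigma>' v \<le> K * (\<Sum>\<^sub>\<infinity>k::freq. exp (- (\<sigma> - \<sigma>') * freq_l1 k))"
    by (simp add: infsum_cmult_right')
qed

lemma wiener_exp_decay:
  assumes "wiener_fin \<sigma> v"
  shows "exp_decay (wiener \<sigma> v) \<sigma> v"
  unfolding exp_decay_def
proof
  fix k
  have "(\<Sum>k\<in>{k}. exp (\<sigma> * freq_l1 k) * norm (v k)) \<le> wiener \<sigma> v"
    unfolding wiener_def by (rule finite_sum_le_infsum[OF assms[unfolded wiener_fin_def]]) auto
  then show "norm (v k) \<le> wiener \<sigma> v * exp (- \<sigma> * freq_l1 k)"
    by (simp add: exp_minus field_simps)
qed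

lemma wiener_mono:
  assumes "wiener_fin \<sigma> v" "\<sigma>' \<le> \<sigma>"
  shows "wiener_fin \<sigma>' v" "wiener \<sigma>' v \<le> wiener \<sigma> v"
proof -
  have le: "exp (\<sigma>' * freq_l1 k) * norm (v k) \<le> exp (\<sigma> * freq_l1 k) * norm (v k)" for k
    using assms(2) by (intro mult_right_mono) (auto simp: mult_right_mono)
  show 1: "wiener_fin \<sigma>' v" unfolding wiener_fin_def
    by (rule summable_on_comparison_test[OF assms(1)[unfolded wiener_fin_def] le]) simp
  show "wiener \<sigma>' v \<le> wiener \<sigma> v" unfolding wiener_def
    by (rule infsum_mono[OF 1[unfolded wiener_fin_def] assms(1)[unfolded wiener_fin_def] le])
qed

lemma has_sum_sum:
  fixes f :: "'i \<Rightarrow> 'a \<Rightarrow> 'b::topological_comm_monoid_add"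
  assumes "finite A" "\<And>i. i \<in> A \<Longrightarrow> (f i has_sum S i) B"
  shows "((\<lambda>x. \<Sum>i\<in>A. f i x) has_sum (\<Sum>i\<in>A. S i)) B"
  using assms by (induction A rule: finite_induct) (auto intro!: has_sum_add)

lemma wiener_sum:
  assumes "finite A" "\<And>l. l \<in> A \<Longrightarrow> wiener_fin \<sigma> (f l)"
  shows "wiener_fin \<sigma> (\<lambda>k. r *\<^sub>R (\<Sum>l\<in>A. f l k))"
    and "wiener \<sigma> (\<lambda>k. r *\<^sub>R (\<Sum>l\<in>A. f l k)) \<le> \<bar>r\<bar> * (\<Sum>l\<in>A. wiener \<sigma> (f l))"
proof -
  have hs: "((\<lambda>k. \<bar>r\<bar> * (\<Sum>l\<in>A. exp (\<sigma> * freq_l1 k) * norm (f l k))) has_sum \<bar>r\<bar> * (\<Sum>l\<in>A. wiener \<sigma> (f l))) UNIV"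
    by (intro has_sum_cmult_right has_sum_sum)
      (use assms in \<open>auto simp: wiener_def wiener_fin_def\<close>)
  have le: "exp (\<sigma> * freq_l1 k) * norm (r *\<^sub>R (\<Sum>l\<in>A. f l k)) \<le> \<bar>r\<bar> * (\<Sum>l\<in>A. exp (\<sigma> * freq_l1 k) * norm (f l k))" for k
  proof -
    have "norm (r *\<^sub>R (\<Sum>l\<in>A. f l k)) \<le> \<bar>r\<bar> * (\<Sum>l\<in>A. norm (f l k))"
      by (simp add: mult_left_mono norm_sum)
    then have "exp (\<sigma> * freq_l1 k) * norm (r *\<^sub>R (\<Sum>l\<in>A. f l k)) \<le> exp (\<sigma> * freq_l1 k) * (\<bar>r\<bar> * (\<Sum>l\<in>A. norm (f l k)))"
      by (intro mult_left_mono) auto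
    then show ?thesis by (simp add: sum_distrib_left mult_ac)
  qed
  show 1: "wiener_fin \<sigma> (\<lambda>k. r *\<^sub>R (\<Sum>l\<in>A. f l k))" unfolding wiener_fin_def
    by (rule summable_on_comparison_test[OF has_sum_imp_summable[OF hs] le]) simp
  show "wiener \<sigma> (\<lambda>k. r *\<^sub>R (\<Sum>l\<in>A. f l k)) \<le> \<bar>r\<bar> * (\<Sum>l\<in>A. wiener \<sigma> (f l))"
    unfolding wiener_def[of \<sigma> "\<lambda>k. r *\<^sub>R (\<Sum>l\<in>A. f l k)"]
    by (rule has_sum_mono[OF has_sum_infsum[OF 1[unfolded wiener_fin_def]] hs le])
qed

lemma convolution_summable:
  fixes V W :: "freq \<Rightarrow> real"
  assumes V: "V summable_on UNIV" "\<And>k. 0 \<le> V k" and W: "W summable_on UNIV" "\<And>k. 0 \<le> W k"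
  shows "(\<lambda>(k, h). V h * W (k - h)) summable_on UNIV"
    and "(\<lambda>h. V h * W (k - h)) summable_on UNIV"
    and "(\<lambda>k. \<Sum>\<^sub>\<infinity>h. V h * W (k - h)) summable_on UNIV"
    and "(\<Sum>\<^sub>\<infinity>k. \<Sum>\<^sub>\<infinity>h. V h * W (k - h)) = infsum V UNIV * infsum W UNIV"
proof -
  have hs: "((\<lambda>k. V h * W (k - h)) has_sum V h * infsum W UNIV) UNIV" for h
    by (rule has_sum_cmult_right) (metis W(1) has_sum_infsum summable_on_freq_translate)
  have "(\<lambda>(h, k). V h * W (k - h)) summable_on UNIV \<times> UNIV"
    by (rule summable_on_SigmaI[where g = "\<lambda>h. V h * infsum W UNIV"])
      (use hs V W in \<open>auto intro: summable_on_cmult_left\<close>)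
  then have s2: "(\<lambda>(k, h). V h * W (k - h)) summable_on UNIV \<times> UNIV"
    by (subst summable_on_reindex_bij_witness[where i = prod.swap and j = prod.swap
          and T = "UNIV \<times> UNIV" and h = "\<lambda>(h, k). V h * W (k - h)"]) auto
  then show s: "(\<lambda>(k, h). V h * W (k - h)) summable_on UNIV" by simp
  have "V h * W (k - h) \<le> infsum W UNIV * V h" for h
  proof -
    have "sum W {k - h} \<le> infsum W UNIV"
      by (rule finite_sum_le_infsum) (use W in auto)
    then show ?thesis using V(2)[of h] by (simp add: mult.commute mult_left_mono)
  qed
  then show "(\<lambda>h. V h * W (k - h)) summable_on UNIV"
    by (intro summable_on_comparison_test[OF summable_on_cmult_right[OF V(1), of "infsum W UNIV"]])
      (use V W in auto)
  show "(\<lambda>k. \<Sum>\<^sub>\<infinity>h. V h * W (k - h)) summable_on UNIV"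
    by (rule summable_on_Sigma_banach[OF s2])
  have "(\<Sum>\<^sub>\<infinity>k. \<Sum>\<^sub>\<infinity>h. V h * W (k - h)) = (\<Sum>\<^sub>\<infinity>h. \<Sum>\<^sub>\<infinity>k. V h * W (k - h))"
    by (rule infsum_swap_banach[OF s2])
  also have "\<dots> = (\<Sum>\<^sub>\<infinity>h. V h * infsum W UNIV)"
    by (rule infsum_cong) (rule infsumI[OF hs])
  finally show "(\<Sum>\<^sub>\<infinity>k. \<Sum>\<^sub>\<infinity>h. V h * W (k - h)) = infsum V UNIV * infsum W UNIV"
    by (simp add: infsum_cmult_left')
qed

lemma norm_euler_term:
  "norm (cdot a (freq_vec l) *s leray k b) \<le> 2 * (norm a * (freq_norm l * norm b))"
proof -
  have "norm (cdot a (freq_vec l) *s leray k b) \<le> (norm a * freq_norm l) * (2 * norm b)"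
    unfolding norm_vector_smult
    by (intro mult_mono norm_leray_le) (use norm_cdot_le[of a "freq_vec l"] in \<open>auto simp: norm_freq_vec\<close>)
  then show ?thesis by simp
qed

text \<open>Only \<open>w\<close> is differentiated, so only \<open>w\<close> has to be measured at
  the larger rate: \<open>le_exp_mult\<close> trades |k| for
  exp(\<open>\<epsilon>\<close>|k|)/\<open>\<epsilon>\<close>. The 2 bounds the Leray projection.
  This asymmetry is what the recursion estimate exploits.\<close>

lemma wiener_euler:
  assumes v: "wiener_fin \<sigma> v" and w: "wiener_fin (\<sigma> + \<epsilon>) w" and e: "\<epsilon> > 0" and s: "\<sigma> \<ge> 0"
  shows "(\<lambda>h. norm (cdot (v h) (freq_vec (k - h)) *s leray k (w (k - h)))) summable_on UNIV"
    and "wiener_fin \<sigma> (euler_P v w)"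
    and "wiener \<sigma> (euler_P v w) \<le> 2 / \<epsilon> * wiener \<sigma> v * wiener (\<sigma> + \<epsilon>) w"
proof -
  define V where "V = (\<lambda>k. exp (\<sigma> * freq_l1 k) * norm (v k))"
  define W where "W = (\<lambda>k. exp (\<sigma> * freq_l1 k) * (freq_norm k * norm (w k)))"
  have V: "V summable_on UNIV" "\<And>k. 0 \<le> V k" using v by (auto simp: V_def wiener_fin_def)
  have Wle: "W k \<le> 1 / \<epsilon> * (exp ((\<sigma> + \<epsilon>) * freq_l1 k) * norm (w k))" for k
  proof -
    have "freq_norm k \<le> exp (\<epsilon> * freq_l1 k) / \<epsilon>"
      using freq_norm_le_l1[of k] le_exp_mult[OF e, of "freq_l1 k"] by linarith
    then have "W k \<le> exp (\<sigma> * freq_l1 k) * (exp (\<epsilon> * freq_l1 k) / \<epsilon> * norm (w k))"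
      unfolding W_def by (intro mult_left_mono mult_right_mono) auto
    then show ?thesis by (simp add: distrib_right exp_add)
  qed
  have W0: "0 \<le> W k" for k by (simp add: W_def)
  have Ws: "(\<lambda>k. 1 / \<epsilon> * (exp ((\<sigma> + \<epsilon>) * freq_l1 k) * norm (w k))) summable_on UNIV"
    using w unfolding wiener_fin_def by (rule summable_on_cmult_right)
  have W: "W summable_on UNIV" by (rule summable_on_comparison_test[OF Ws Wle W0])
  have Winf: "infsum W UNIV \<le> 1 / \<epsilon> * wiener (\<sigma> + \<epsilon>) w"
  proof -
    have "infsum W UNIV \<le> (\<Sum>\<^sub>\<infinity>k. 1 / \<epsilon> * (exp ((\<sigma> + \<epsilon>) * freq_l1 k) * norm (w k)))"
      by (rule infsum_mono[OF W Ws Wle])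
    then show ?thesis by (simp only: infsum_cmult_right' wiener_def)
  qed
  note conv = convolution_summable[OF V W W0]
  let ?t = "\<lambda>k h. cdot (v h) (freq_vec (k - h)) *s leray k (w (k - h))"
  have t: "exp (\<sigma> * freq_l1 k) * norm (?t k h) \<le> 2 * (V h * W (k - h))" for k h
  proof -
    have "\<sigma> * freq_l1 k \<le> \<sigma> * freq_l1 h + \<sigma> * freq_l1 (k - h)"
      using freq_l1_le_add_diff[of k h] s by (metis distrib_left mult_left_mono)
    then have "exp (\<sigma> * freq_l1 k) \<le> exp (\<sigma> * freq_l1 h) * exp (\<sigma> * freq_l1 (k - h))"
      by (simp add: exp_add[symmetric])
    then have "exp (\<sigma> * freq_l1 k) * norm (?t k h) \<le> (exp (\<sigma> * freq_l1 h) * exp (\<sigma> * freq_l1 (k - h)))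
        * (2 * (norm (v h) * (freq_norm (k - h) * norm (w (k - h)))))"
      by (intro mult_mono norm_euler_term) auto
    then show ?thesis by (simp add: V_def W_def mult_ac)
  qed
  have t1: "norm (?t k h) \<le> 2 * (V h * W (k - h))" for k h
  proof -
    have "1 * norm (?t k h) \<le> exp (\<sigma> * freq_l1 k) * norm (?t k h)"
      using s by (intro mult_right_mono) auto
    then show ?thesis using t[of k h] by simp
  qed
  show abs: "(\<lambda>h. norm (?t k h)) summable_on UNIV" for k
    by (rule summable_on_comparison_test[OF summable_on_cmult_right[OF conv(2)] t1]) simp
  have P: "exp (\<sigma> * freq_l1 k) * norm (euler_P v w k) \<le> 2 * (\<Sum>\<^sub>\<infinity>h. V h * W (k - h))" for k
  proof -
    have "norm (euler_P v w k) \<le> (\<Sum>\<^sub>\<infinity>h. norm (?t k h))"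
      unfolding euler_P_def norm_vector_smult[of "- \<i>"] using norm_infsum_bound[OF abs] by simp
    then have "exp (\<sigma> * freq_l1 k) * norm (euler_P v w k) \<le> exp (\<sigma> * freq_l1 k) * (\<Sum>\<^sub>\<infinity>h. norm (?t k h))"
      by simp
    also have "\<dots> = (\<Sum>\<^sub>\<infinity>h. exp (\<sigma> * freq_l1 k) * norm (?t k h))" by (rule infsum_cmult_right'[symmetric])
    also have "\<dots> \<le> (\<Sum>\<^sub>\<infinity>h. 2 * (V h * W (k - h)))"
      by (rule infsum_mono[OF summable_on_cmult_right[OF abs] summable_on_cmult_right[OF conv(2)] t])
    finally show ?thesis by (simp only: infsum_cmult_right')
  qed
  show Pf: "wiener_fin \<sigma> (euler_P v w)" unfolding wiener_fin_def
    by (rule summable_on_comparison_test[OF summable_on_cmult_right[OF conv(3)] P]) simp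
  have "wiener \<sigma> (euler_P v w) \<le> (\<Sum>\<^sub>\<infinity>k. 2 * (\<Sum>\<^sub>\<infinity>h. V h * W (k - h)))"
    unfolding wiener_def
    by (rule infsum_mono[OF Pf[unfolded wiener_fin_def] summable_on_cmult_right[OF conv(3)] P])
  also have "\<dots> = 2 * (wiener \<sigma> v * infsum W UNIV)"
    by (simp only: infsum_cmult_right' conv(4)) (simp add: V_def wiener_def)
  also have "\<dots> \<le> 2 * (wiener \<sigma> v * (1 / \<epsilon> * wiener (\<sigma> + \<epsilon>) w))"
    by (intro mult_left_mono Winf wiener_nonneg) auto
  finally show "wiener \<sigma> (euler_P v w) \<le> 2 / \<epsilon> * wiener \<sigma> v * wiener (\<sigma> + \<epsilon>) w" by simp
qed

text \<open>Pointwise bounds become summable by giving up part of the rate: \<open>v\<close>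
  descends to \<open>\<sigma> / 4\<close>, \<open>w\<close> to \<open>\<sigma> / 2\<close>, and the
  difference of the two pays for the derivative. The constant depends on \<open>\<sigma>\<close>
  alone, so the bound holds uniformly along a series in time.\<close>

lemma exp_decay_euler:
  assumes s: "\<sigma> > 0"
  shows "\<exists>C\<ge>0. \<forall>K L v w. exp_decay K \<sigma> v \<longrightarrow> exp_decay L \<sigma> w \<longrightarrow> exp_decay (C * K * L) (\<sigma> / 4) (euler_P v w)"
proof -
  define S where "S = (\<lambda>\<tau>. \<Sum>\<^sub>\<infinity>k::freq. exp (- \<tau> * freq_l1 k))"
  have S0: "S \<tau> \<ge> 0" for \<tau> unfolding S_def by (rule infsum_nonneg) simp
  let ?C = "8 / \<sigma> * S (\<sigma> - \<sigma> / 4) * S (\<sigma> - \<sigma> / 2)"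
  show ?thesis
  proof (intro exI[of _ ?C] conjI allI impI)
    show "?C \<ge> 0" using s S0 by simp
    fix K L v w assume v: "exp_decay K \<sigma> v" and w: "exp_decay L \<sigma> w"
    have 1: "wiener_fin (\<sigma> / 4) v" "wiener (\<sigma> / 4) v \<le> K * S (\<sigma> - \<sigma> / 4)"
      unfolding S_def by (rule exp_decay_wiener[OF v]; use s in simp)+
    have 2: "wiener_fin (\<sigma> / 2) w" "wiener (\<sigma> / 2) w \<le> L * S (\<sigma> - \<sigma> / 2)"
      unfolding S_def by (rule exp_decay_wiener[OF w]; use s in simp)+
    have 3: "wiener_fin (\<sigma> / 4) (euler_P v w)"
      "wiener (\<sigma> / 4) (euler_P v w) \<le> 2 / (\<sigma> / 4) * wiener (\<sigma> / 4) v * wiener (\<sigma> / 2) w"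
      using wiener_euler(2,3)[of "\<sigma> / 4" v "\<sigma> / 4" w] 1 2 s by simp_all
    have "2 / (\<sigma> / 4) * wiener (\<sigma> / 4) v * wiener (\<sigma> / 2) w
        \<le> 2 / (\<sigma> / 4) * (K * S (\<sigma> - \<sigma> / 4)) * (L * S (\<sigma> - \<sigma> / 2))"
      using s S0 exp_decay_nonneg[OF v]
      by (intro mult_mono 1 2 order_refl) (auto intro!: mult_nonneg_nonneg simp: wiener_nonneg)
    with 3(2) have "wiener (\<sigma> / 4) (euler_P v w) \<le> ?C * K * L" by (simp add: mult_ac)
    then show "exp_decay (?C * K * L) (\<sigma> / 4) (euler_P v w)"
      using exp_decay_mono[OF wiener_exp_decay[OF 3(1)]] by blast
  qed
qed

lemma euler_term_summable:
  assumes "v \<in> Asp" "w \<in> Asp"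
  shows "(\<lambda>h. norm (cdot (v h) (freq_vec (k - h)) *s leray k (w (k - h)))) summable_on UNIV"
proof -
  obtain K \<sigma> where 1: "\<sigma> > 0" "exp_decay K \<sigma> v" using assms(1) by (auto simp: Asp_iff)
  obtain L \<tau> where 2: "\<tau> > 0" "exp_decay L \<tau> w" using assms(2) by (auto simp: Asp_iff)
  have "wiener_fin 0 v" "wiener_fin (0 + \<tau> / 2) w"
    using exp_decay_wiener(1)[OF 1(2), of 0] exp_decay_wiener(1)[OF 2(2), of "\<tau> / 2"] 1 2 by auto
  from wiener_euler(1)[OF this] 2 show ?thesis by simp
qed

lemma euler_P_Asp:
  assumes v: "v \<in> Asp" and w: "w \<in> Asp"
  shows "euler_P v w \<in> Asp"
proof -
  obtain K \<sigma> where 1: "\<sigma> > 0" "exp_decay K \<sigma> v" using v by (auto simp: Asp_iff)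
  obtain L \<tau> where 2: "\<tau> > 0" "exp_decay L \<tau> w" using w by (auto simp: Asp_iff)
  define m where "m = min \<sigma> \<tau>"
  have m: "m > 0" "exp_decay K m v" "exp_decay L m w"
    using 1 2 by (auto simp: m_def intro: exp_decay_mono)
  obtain C where dec: "exp_decay (C * K * L) (m / 4) (euler_P v w)"
    using exp_decay_euler[OF m(1)] m(2,3) by blast
  let ?t = "\<lambda>k h. cdot (v h) (freq_vec (k - h)) *s leray k (w (k - h))"
  have hs: "(?t k has_sum infsum (?t k) UNIV) UNIV" for k
    by (rule has_sum_infsum[OF abs_summable_summable[OF euler_term_summable[OF v w]]])
  have rv: "v (- k) = cnj_vec (v k)" "w (- k) = cnj_vec (w k)" for k
    using v w by (auto simp: Asp_iff real_field_iff)
  have dv: "cdot (freq_vec k) (v k) = 0" for k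
    using v by (auto simp: Asp_iff mean_free_div_free_def)
  have "euler_P v w (- k) = cnj_vec (euler_P v w k)" for k
  proof -
    \<comment> \<open>Conjugation symmetry of the convolution: the term at -k and -h is minus the
      conjugate of the term at k and h. The sign is undone by conjugating the prefactor -i.\<close>
    have tm: "?t (- k) (- h) = - cnj_vec (?t k h)" for h
    proof -
      have "- k - - h = - (k - h)" by simp
      then have "?t (- k) (- h) = cdot (cnj_vec (v h)) (- cnj_vec (freq_vec (k - h))) *s leray (- k) (cnj_vec (w (k - h)))"
        by (simp only: rv freq_vec_minus cnj_vec_freq_vec)
      also have "cdot (cnj_vec (v h)) (- cnj_vec (freq_vec (k - h))) = - cnj (cdot (v h) (freq_vec (k - h)))"
        using cdot_smult_right[of "cnj_vec (v h)" "-1" "cnj_vec (freq_vec (k - h))"] cdot_cnj_vec[of "v h" "freq_vec (k - h)"]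
          by simp
      finally show ?thesis by (simp add: leray_cnj_vec cnj_vec_smult)
    qed
    have "infsum (?t (- k)) UNIV = (\<Sum>\<^sub>\<infinity>h. ?t (- k) (- h))"
      by (rule infsum_reindex_bij_betw[symmetric]) (rule bij_betwI[where g = uminus]; simp)
    also have "\<dots> = (\<Sum>\<^sub>\<infinity>h. - cnj_vec (?t k h))" by (simp only: tm)
    also have "\<dots> = - cnj_vec (infsum (?t k) UNIV)"
      by (rule infsumI) (rule has_sum_bounded_linear[OF bounded_linear_minus[OF bounded_linear_cnj_vec] hs])
    finally show ?thesis by (simp add: euler_P_def cnj_vec_smult cnj_vec_minus)
  qed
  then have "real_field (euler_P v w)" by (simp add: real_field_iff)
  moreover have "mean_free_div_free (euler_P v w)"
    unfolding mean_free_div_free_def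
  proof (intro conjI allI)
    \<comment> \<open>At frequency 0 every single term vanishes by incompressibility of
      \<open>v\<close>, so the mean stays 0.\<close>
    have "?t 0 h = 0" for h
    proof -
      have "cdot (v h) (freq_vec (0 - h)) = - cdot (freq_vec h) (v h)"
        using cdot_smult_right[of "v h" "-1" "freq_vec h"] by (simp add: freq_vec_minus cdot_commute)
      then show ?thesis using dv[of h] by simp
    qed
    then have "infsum (?t 0) UNIV = 0" by (intro infsum_0)
    then show 0: "euler_P v w 0 = 0" by (simp only: euler_P_def vec.scale_zero_right)
    fix k show "cdot (freq_vec k) (euler_P v w k) = 0"
    proof (cases "k = 0")
      case False
      have "(\<lambda>h. cdot (freq_vec k) (?t k h)) = (\<lambda>h. 0)"
        by (simp add: cdot_smult_right cdot_leray[OF False])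
      moreover have "((\<lambda>h. cdot (freq_vec k) (?t k h)) has_sum cdot (freq_vec k) (infsum (?t k) UNIV)) UNIV"
        by (rule has_sum_bounded_linear[OF bounded_linear_cdot_right hs])
      ultimately have "((\<lambda>h::freq. 0) has_sum cdot (freq_vec k) (infsum (?t k) UNIV)) UNIV" by simp
      then have "cdot (freq_vec k) (infsum (?t k) UNIV) = 0"
        by (rule has_sum_unique[OF _ has_sum_0_simp])
      then show ?thesis by (simp only: euler_P_def cdot_smult_right mult_zero_right)
    qed (simp add: 0)
  qed
  ultimately show ?thesis unfolding Asp_iff using dec m(1)
    by (intro conjI exI[of _ "C * K * L"] exI[of _ "m / 4"]) simp_all
qed

lemma Asp_sum:
  assumes "finite A" "A \<noteq> {}" "\<And>l. l \<in> A \<Longrightarrow> f l \<in> Asp"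
  shows "(\<lambda>k. r *\<^sub>R (\<Sum>l\<in>A. f l k)) \<in> Asp"
proof -
  have "(\<lambda>k. \<Sum>l\<in>A. f l k) \<in> Asp" using assms
  proof (induction A rule: finite_ne_induct)
    case (insert x F)
    have "(\<lambda>k. \<Sum>l\<in>insert x F. f l k) = lincomb 1 (f x) 1 (\<lambda>k. \<Sum>l\<in>F. f l k)"
      using insert by (simp add: lincomb_def)
    then show ?case using insert by (simp add: Asp_lincomb)
  qed simp
  from Asp_lincomb[OF this this, of r 0] show ?thesis by (simp add: lincomb_def)
qed

section \<open>The power series recursion\<close>

definition euler_recursion :: "(nat \<Rightarrow> vfield) \<Rightarrow> bool" where
  "euler_recursion a \<longleftrightarrow>
     (\<forall>j. a (Suc j) = (\<lambda>k. (1 / real (Suc j)) *\<^sub>R (\<Sum>l\<le>j. euler_P (a l) (a (j - l)) k)))"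

lemma euler_recursion_Asp:
  assumes "euler_recursion a" "a 0 \<in> Asp"
  shows "a j \<in> Asp"
proof (induction j rule: less_induct)
  case (less j)
  show ?case
  proof (cases j)
    case (Suc i)
    have "(\<lambda>k. (1 / real (Suc i)) *\<^sub>R (\<Sum>l\<le>i. euler_P (a l) (a (i - l)) k)) \<in> Asp"
      by (rule Asp_sum) (use less Suc in \<open>auto intro!: euler_P_Asp\<close>)
    then show ?thesis using assms(1) Suc by (simp add: euler_recursion_def)
  qed (use assms in simp)
qed

lemma euler_recursion_unique:
  assumes "euler_recursion a" "euler_recursion b" "a 0 = b 0"
  shows "a = b"
proof -
  have "a j = b j" for j
  proof (induction j rule: less_induct)
    case (less j)
    show ?case
    proof (cases j)
      case (Suc i)
      have "(\<Sum>l\<le>i. euler_P (a l) (a (i - l)) k) = (\<Sum>l\<le>i. euler_P (b l) (b (i - l)) k)" for k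
        by (rule sum.cong) (use less Suc in auto)
      then show ?thesis using assms Suc by (simp add: euler_recursion_def)
    qed (use assms in simp)
  qed
  then show ?thesis by blast
qed

text \<open>
  The Cauchy--Kovalevskaya majorants: passing from \<open>\<sigma>\<^sub>0 - s\<close> to \<open>\<sigma>\<^sub>0 - s + s/j\<close> costs a factor
  \<open>j/s\<close>, which the factor \<open>1/j\<close> of the recursion absorbs, so the coefficients are
  dominated by Catalan-type numbers.
\<close>

fun catalan_majorant :: "real \<Rightarrow> real \<Rightarrow> nat \<Rightarrow> real" where
  "catalan_majorant \<kappa> A 0 = A"
| "catalan_majorant \<kappa> A (Suc j) = \<kappa> * (\<Sum>l\<le>j. catalan_majorant \<kappa> A l * catalan_majorant \<kappa> A (j - l))"

lemma catalan_majorant_nonneg: "A \<ge> 0 \<Longrightarrow> \<kappa> \<ge> 0 \<Longrightarrow> catalan_majorant \<kappa> A j \<ge> 0"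
proof (induction j rule: less_induct)
  case (less j)
  then show ?case by (cases j) (auto intro!: sum_nonneg mult_nonneg_nonneg)
qed

lemma sum_convolution_le_square:
  fixes f :: "nat \<Rightarrow> real"
  assumes "\<And>i. f i \<ge> 0"
  shows "(\<Sum>j\<le>n. \<Sum>l\<le>j. f l * f (j - l)) \<le> (\<Sum>l\<le>n. f l)\<^sup>2"
proof -
  have "(\<Sum>j\<le>n. \<Sum>l\<le>j. f l * f (j - l)) = (\<Sum>(i,j)\<in>{(i,j). i + j \<le> n}. f i * f j)"
    by (rule sum.triangle_reindex_eq[symmetric])
  also have "\<dots> \<le> (\<Sum>(i,j)\<in>{..n} \<times> {..n}. f i * f j)"
    by (rule sum_mono2) (auto simp: assms)
  also have "\<dots> = (\<Sum>l\<le>n. f l)\<^sup>2"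
    by (simp add: power2_eq_square sum_product sum.cartesian_product)
  finally show ?thesis .
qed

text \<open>The partial sums of the generating function at x = 1/(4\<open>\<kappa>\<close>A) satisfy
  S' \<le> A + \<open>\<kappa>\<close> x S^2, where S' has one term more than S. The value 2A is the
  fixed point of the right side, so all partial sums stay below it, and with them every single
  term.\<close>

lemma catalan_majorant_le:
  assumes A: "A > 0" and k: "\<kappa> > 0"
  shows "catalan_majorant \<kappa> A j \<le> 2 * A * (4 * \<kappa> * A) ^ j"
proof -
  define x where "x = 1 / (4 * \<kappa> * A)"
  have x: "x > 0" using A k by (simp add: x_def)
  define f where "f = (\<lambda>j. catalan_majorant \<kappa> A j * x ^ j)"
  have f0: "f j \<ge> 0" for j using A k x by (simp add: f_def catalan_majorant_nonneg)
  have S: "(\<Sum>j\<le>n. f j) \<le> 2 * A" for n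
  proof (induction n)
    case (Suc n)
    have fS: "f (Suc j) = \<kappa> * x * (\<Sum>l\<le>j. f l * f (j - l))" for j
    proof -
      have "x ^ Suc j * (\<Sum>l\<le>j. catalan_majorant \<kappa> A l * catalan_majorant \<kappa> A (j - l))
          = x * (\<Sum>l\<le>j. f l * f (j - l))"
      proof -
        have "x ^ j * (catalan_majorant \<kappa> A l * catalan_majorant \<kappa> A (j - l)) = f l * f (j - l)" if "l \<le> j" for l
        proof -
          have "x ^ j = x ^ l * x ^ (j - l)" using that by (simp add: power_add[symmetric])
          then show ?thesis by (simp add: f_def mult_ac)
        qed
        then have "x ^ j * (\<Sum>l\<le>j. catalan_majorant \<kappa> A l * catalan_majorant \<kappa> A (j - l)) = (\<Sum>l\<le>j. f l * f (j - l))"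
          unfolding sum_distrib_left by (intro sum.cong) auto
        then show ?thesis by (simp add: mult.assoc)
      qed
      then show ?thesis by (simp add: f_def mult_ac)
    qed
    have fz: "f 0 = A" by (simp add: f_def)
    have "(\<Sum>j\<le>Suc n. f j) = A + \<kappa> * x * (\<Sum>j\<le>n. \<Sum>l\<le>j. f l * f (j - l))"
      by (subst sum.atMost_Suc_shift) (simp add: fS fz sum_distrib_left)
    also have "\<dots> \<le> A + \<kappa> * x * (\<Sum>l\<le>n. f l)\<^sup>2"
      using k x f0 by (intro add_left_mono mult_left_mono sum_convolution_le_square) auto
    also have "\<dots> \<le> A + \<kappa> * x * (2 * A)\<^sup>2"
      using k x f0 Suc.IH by (intro add_left_mono mult_left_mono power_mono) (auto intro: sum_nonneg)
    also have "\<dots> = 2 * A" using A k by (simp add: x_def power2_eq_square field_simps)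
    finally show ?case .
  qed (use A in \<open>simp add: f_def\<close>)
  have "f j \<le> (\<Sum>j\<le>j. f j)" by (rule member_le_sum) (auto simp: f0)
  with S[of j] have "catalan_majorant \<kappa> A j * x ^ j \<le> 2 * A" by (simp add: f_def)
  then show ?thesis using A k by (simp add: x_def power_one_over field_simps)
qed

lemma euler_recursion_wiener:
  assumes rec: "euler_recursion a" and fin: "wiener_fin \<sigma> (a 0)" and A: "wiener \<sigma> (a 0) \<le> A"
  defines "\<kappa> \<equiv> 2 * exp 1"
  assumes "0 \<le> s" "s \<le> \<sigma>" "j > 0 \<Longrightarrow> s > 0"
  shows "wiener_fin (\<sigma> - s) (a j) \<and> wiener (\<sigma> - s) (a j) \<le> catalan_majorant \<kappa> A j / s ^ j"
  using assms(5-)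
proof (induction j arbitrary: s rule: less_induct)
  case (less j)
  have A0: "A \<ge> 0" using A wiener_nonneg order_trans by blast
  have c0: "catalan_majorant \<kappa> A i \<ge> 0" for i
    using catalan_majorant_nonneg[OF A0] by (simp add: \<kappa>_def)
  show ?case
  proof (cases j)
    case 0
    have "\<sigma> - s \<le> \<sigma>" using less by simp
    from wiener_mono[OF fin this] A 0 show ?thesis by simp
  next
    case (Suc i)
    then have s: "s > 0" using less by simp
    define \<epsilon> where "\<epsilon> = s / real (Suc i)"
    have e: "\<epsilon> > 0" using s by (simp add: \<epsilon>_def)
    have P: "wiener_fin (\<sigma> - s) (euler_P (a l) (a (i - l))) \<and>
       wiener (\<sigma> - s) (euler_P (a l) (a (i - l))) \<le>
         real (Suc i) * \<kappa> / s ^ Suc i * (catalan_majorant \<kappa> A l * catalan_majorant \<kappa> A (i - l))" if l: "l \<le> i" for l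
    proof -
      have 1: "wiener_fin (\<sigma> - s) (a l) \<and> wiener (\<sigma> - s) (a l) \<le> catalan_majorant \<kappa> A l / s ^ l"
        by (rule less.IH) (use l Suc s less.prems in auto)
      have se: "s - \<epsilon> = s * real i / real (Suc i)" by (simp add: \<epsilon>_def field_simps)
      have 2: "wiener_fin (\<sigma> - (s - \<epsilon>)) (a (i - l)) \<and>
          wiener (\<sigma> - (s - \<epsilon>)) (a (i - l)) \<le> catalan_majorant \<kappa> A (i - l) / (s - \<epsilon>) ^ (i - l)"
      proof (rule less.IH)
        show "0 \<le> s - \<epsilon>" unfolding se using s by simp
        show "s - \<epsilon> \<le> \<sigma>" using e less.prems by simp
        show "0 < s - \<epsilon>" if "0 < i - l" unfolding se using s that by simp
      qed (use Suc in simp)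
      \<comment> \<open>Origin of \<open>exp 1\<close> in \<open>\<kappa>\<close>: the
        differentiated factor is estimated with the smaller loss s - \<open>\<epsilon>\<close> = s
        i/(i+1), and passing to the loss s costs at most (1 + 1/i)^i \<le> e. The 2 in
        \<open>\<kappa>\<close> is that of \<open>wiener_euler\<close>.\<close>
      have pw: "1 / (s - \<epsilon>) ^ (i - l) \<le> exp 1 / s ^ (i - l)"
      proof (cases "i - l = 0")
        case False
        then have i: "i > 0" by simp
        have "s / (s - \<epsilon>) = 1 + 1 / real i" using i s unfolding se by (simp add: field_simps)
        then have "(s / (s - \<epsilon>)) ^ (i - l) = (1 + 1 / real i) ^ (i - l)" by simp
        also have "\<dots> \<le> exp (1 / real i) ^ (i - l)"
          by (intro power_mono) auto
        also have "\<dots> = exp (real (i - l) / real i)" by (simp add: exp_of_nat_mult[symmetric])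
        also have "\<dots> \<le> exp 1" using i by simp
        finally have "(s / (s - \<epsilon>)) ^ (i - l) \<le> exp 1" .
        then show ?thesis using s by (simp add: power_divide field_simps)
      qed simp
      have sig: "\<sigma> - s \<ge> 0" "\<sigma> - (s - \<epsilon>) = \<sigma> - s + \<epsilon>" using less.prems by auto
      from wiener_euler(2,3)[OF conjunct1[OF 1] conjunct1[OF 2, unfolded sig(2)] e sig(1)]
      have 3: "wiener_fin (\<sigma> - s) (euler_P (a l) (a (i - l)))"
        "wiener (\<sigma> - s) (euler_P (a l) (a (i - l))) \<le> 2 / \<epsilon> * wiener (\<sigma> - s) (a l) * wiener (\<sigma> - (s - \<epsilon>)) (a (i - l))"
        unfolding sig(2) by auto
      note 3(2)
      also have "2 / \<epsilon> * wiener (\<sigma> - s) (a l) * wiener (\<sigma> - (s - \<epsilon>)) (a (i - l))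
         \<le> 2 / \<epsilon> * (catalan_majorant \<kappa> A l / s ^ l) * (catalan_majorant \<kappa> A (i - l) * (exp 1 / s ^ (i - l)))"
      proof (intro mult_mono order_refl)
        have "wiener (\<sigma> - (s - \<epsilon>)) (a (i - l)) \<le> catalan_majorant \<kappa> A (i - l) * (1 / (s - \<epsilon>) ^ (i - l))"
          using 2 by simp
        also have "\<dots> \<le> catalan_majorant \<kappa> A (i - l) * (exp 1 / s ^ (i - l))"
          by (rule mult_left_mono[OF pw c0])
        finally show "wiener (\<sigma> - (s - \<epsilon>)) (a (i - l)) \<le> catalan_majorant \<kappa> A (i - l) * (exp 1 / s ^ (i - l))" .
      qed (use 1 e c0 s in \<open>auto intro!: mult_nonneg_nonneg divide_nonneg_nonneg simp: wiener_nonneg\<close>)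
      also have "\<dots> = real (Suc i) * \<kappa> / s ^ Suc i * (catalan_majorant \<kappa> A l * catalan_majorant \<kappa> A (i - l))"
      proof -
        have "s ^ i = s ^ l * s ^ (i - l)" using l by (simp add: power_add[symmetric])
        then show ?thesis using s by (simp add: \<epsilon>_def \<kappa>_def field_simps)
      qed
      finally show ?thesis using 3(1) by blast
    qed
    have aj: "a j = (\<lambda>k. (1 / real (Suc i)) *\<^sub>R (\<Sum>l\<in>{..i}. euler_P (a l) (a (i - l)) k))"
      using rec Suc by (simp add: euler_recursion_def)
    have f: "wiener_fin (\<sigma> - s) (a j)" unfolding aj by (rule wiener_sum) (use P in auto)
    have "wiener (\<sigma> - s) (a j) \<le> \<bar>1 / real (Suc i)\<bar> * (\<Sum>l\<in>{..i}. wiener (\<sigma> - s) (euler_P (a l) (a (i - l))))"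
      unfolding aj by (rule wiener_sum) (use P in auto)
    also have "\<dots> \<le> \<bar>1 / real (Suc i)\<bar> * (\<Sum>l\<in>{..i}. real (Suc i) * \<kappa> / s ^ Suc i * (catalan_majorant \<kappa> A l * catalan_majorant \<kappa> A (i - l)))"
      using P by (intro mult_left_mono sum_mono) auto
    also have "\<dots> = catalan_majorant \<kappa> A j / s ^ j"
      unfolding sum_distrib_left[symmetric] Suc by (simp add: field_simps del: of_nat_Suc)
    finally show ?thesis using f by blast
  qed
qed

text \<open>The time radius \<open>\<sigma> / (16 * exp 1 * A)\<close> depends on the initial value
  only through a spatial rate and a bound on its Wiener norm. Hence solutions restarted from fields
  with common bounds live for a common time. Half of the rate is spent, s =
  \<open>\<sigma> / 2\<close>, and 16 e A/\<open>\<sigma>\<close> is 4\<open>\<kappa>\<close>A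
  divided by s.\<close>

lemma euler_recursion_decay:
  assumes rec: "euler_recursion a" and fin: "wiener_fin \<sigma> (a 0)" and A: "wiener \<sigma> (a 0) \<le> A"
    and A0: "A > 0" and s: "\<sigma> > 0"
  shows "exp_decay (2 * A * (16 * exp 1 * A / \<sigma>) ^ j) (\<sigma> / 2) (a j)"
proof -
  let ?c = "catalan_majorant (2 * exp 1) A"
  have "wiener_fin (\<sigma> - \<sigma> / 2) (a j) \<and> wiener (\<sigma> - \<sigma> / 2) (a j) \<le> ?c j / (\<sigma> / 2) ^ j"
    by (rule euler_recursion_wiener[OF rec fin A]) (use s in auto)
  then have w: "wiener_fin (\<sigma> / 2) (a j)" "wiener (\<sigma> / 2) (a j) \<le> ?c j / (\<sigma> / 2) ^ j" by auto
  have "?c j / (\<sigma> / 2) ^ j \<le> 2 * A * (4 * (2 * exp 1) * A) ^ j / (\<sigma> / 2) ^ j"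
    using s A0 by (intro divide_right_mono catalan_majorant_le) auto
  also have "\<dots> = 2 * A * ((4 * (2 * exp 1) * A) / (\<sigma> / 2)) ^ j"
    by (simp only: power_divide times_divide_eq_right)
  also have "(4 * (2 * exp 1) * A) / (\<sigma> / 2) = 16 * exp 1 * A / \<sigma>" by simp
  finally show ?thesis using w exp_decay_mono[OF wiener_exp_decay[OF w(1)]] by fastforce
qed

section \<open>Local power series expansions in time\<close>

lemma geometric_tail:
  fixes x :: "nat \<Rightarrow> 'a::banach"
  assumes x: "\<And>i. norm (x i) \<le> M * y ^ i" and y: "0 \<le> y" "y < 1" and S: "x sums S"
  shows "norm (S - (\<Sum>i<N. x i)) \<le> M * y ^ N / (1 - y)"
proof -
  have g: "(\<lambda>i. M * y ^ N * y ^ i) sums (M * y ^ N * (1 / (1 - y)))"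
    by (intro sums_mult geometric_sums) (use y in simp)
  have le: "norm (x (i + N)) \<le> M * y ^ N * y ^ i" for i
    using x[of "i + N"] by (simp add: power_add mult_ac)
  have sn: "summable (\<lambda>i. norm (x (i + N)))"
    by (rule summable_comparison_test'[OF sums_summable[OF g]]) (use le in auto)
  have "(\<lambda>i. x (i + N)) sums (S - (\<Sum>i<N. x i))"
    using sums_split_initial_segment[OF S] .
  then have "norm (S - (\<Sum>i<N. x i)) \<le> (\<Sum>i. norm (x (i + N)))"
    using summable_norm[OF sn] by (simp add: sums_iff)
  also have "\<dots> \<le> M * y ^ N * (1 / (1 - y))"
    using suminf_le[OF le sn sums_summable[OF g]] g by (simp add: sums_iff)
  finally show ?thesis by simp
qed

lemma geometric_summable_norm:
  fixes x :: "nat \<Rightarrow> 'a::banach"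
  assumes x: "\<And>i. norm (x i) \<le> M * y ^ i" and y: "0 \<le> y" "y < 1"
  shows "summable (\<lambda>i. norm (x i))"
  by (rule summable_comparison_test'[of "\<lambda>i. M * y ^ i"])
    (use x y in \<open>auto intro!: summable_mult summable_geometric\<close>)

text \<open>Once the coefficients below n vanish, the geometric tail bound gives a norm of
  \<open>e n\<close> of order s as s tends to 0 from the right.\<close>

lemma power_series_zero_unique:
  fixes e :: "nat \<Rightarrow> 'a::banach"
  assumes r: "r > 0" and e: "\<And>i. norm (e i) \<le> M * (1 / r) ^ i"
    and z: "\<And>s::real. 0 < s \<Longrightarrow> s < r \<Longrightarrow> (\<lambda>i. s ^ i *\<^sub>R e i) sums 0"
  shows "e n = 0"
proof (induction n rule: less_induct)
  case (less n)
  have M: "M \<ge> 0" using order_trans[OF norm_ge_zero e[of 0]] by simp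
  have "norm (e n) \<le> 2 * M / r ^ Suc n * s" if s: "0 < s" "s < r / 2" for s
  proof -
    have "norm (0 - (\<Sum>i<Suc n. s ^ i *\<^sub>R e i)) \<le> M * (s / r) ^ Suc n / (1 - s / r)"
    proof (rule geometric_tail)
      fix i
      have "norm (s ^ i *\<^sub>R e i) \<le> s ^ i * (M * (1 / r) ^ i)"
        using s e[of i] by (simp add: mult_left_mono)
      then show "norm (s ^ i *\<^sub>R e i) \<le> M * (s / r) ^ i" by (simp add: power_divide field_simps)
    qed (use s r z in \<open>auto simp: field_simps\<close>)
    also have "(\<Sum>i<Suc n. s ^ i *\<^sub>R e i) = s ^ n *\<^sub>R e n" using less by simp
    finally have "s ^ n * norm (e n) \<le> M * (s / r) ^ Suc n / (1 - s / r)" using s by simp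
    also have "\<dots> \<le> M * (s / r) ^ Suc n / (1 / 2)"
      using M s r by (intro divide_left_mono) (auto simp: field_simps)
    also have "\<dots> = s ^ n * (2 * M / r ^ Suc n * s)" by (simp add: power_divide)
    finally show ?thesis using s by (simp only: mult_le_cancel_left_pos zero_less_power)
  qed
  then have ev: "eventually (\<lambda>s. norm (e n) \<le> 2 * M / r ^ Suc n * s) (at_right 0)"
    using r by (auto simp: eventually_at_right_field intro!: exI[of _ "r / 2"])
  have "((\<lambda>s. 2 * M / r ^ Suc n * s) \<longlongrightarrow> 2 * M / r ^ Suc n * 0) (at_right 0)"
    by (intro tendsto_intros)
  then have "norm (e n) \<le> 2 * M / r ^ Suc n * 0"
    by (rule tendsto_lowerbound[OF _ ev]) simp
  then show ?case by simp
qed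

text \<open>The double family is absolutely summable over all pairs (l, m) and may therefore be
  regrouped along l + m = i.\<close>

lemma bilinear_Cauchy_product_sums:
  fixes a :: "nat \<Rightarrow> 'a::banach" and b :: "nat \<Rightarrow> 'b::banach"
    and prod :: "'a \<Rightarrow> 'b \<Rightarrow> 'c::banach"
  assumes bl: "bounded_bilinear prod"
    and a: "summable (\<lambda>i. norm (a i))" and b: "summable (\<lambda>i. norm (b i))"
  shows "(\<lambda>i. \<Sum>l\<le>i. prod (a l) (b (i - l))) sums prod (suminf a) (suminf b)"
proof -
  interpret bounded_bilinear prod by (rule bl)
  obtain C where C: "\<And>x y. norm (prod x y) \<le> norm x * norm y * C" using bounded by blast
  let ?f = "\<lambda>(l, m). prod (a l) (b m)"
  have ha: "(a has_sum suminf a) UNIV" and hb: "(b has_sum suminf b) UNIV"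
    using a b by (auto intro!: norm_summable_imp_has_sum summable_sums summable_norm_cancel)
  have na: "((\<lambda>i. norm (a i)) has_sum (\<Sum>i. norm (a i))) UNIV"
    and nb: "((\<lambda>i. norm (b i)) has_sum (\<Sum>i. norm (b i))) UNIV"
    using a b by (auto intro!: norm_summable_imp_has_sum summable_sums)
  have g: "(\<lambda>(l, m). norm (a l) * norm (b m) * \<bar>C\<bar>) summable_on UNIV \<times> UNIV"
  proof (rule summable_on_SigmaI)
    show "((\<lambda>m. case (l, m) of (l, m) \<Rightarrow> norm (a l) * norm (b m) * \<bar>C\<bar>) has_sum norm (a l) * (\<Sum>i. norm (b i)) * \<bar>C\<bar>) UNIV" for l
      by (simp, intro has_sum_cmult_left has_sum_cmult_right nb)
    show "(\<lambda>l. norm (a l) * (\<Sum>i. norm (b i)) * \<bar>C\<bar>) summable_on UNIV"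
      by (intro summable_on_cmult_left has_sum_imp_summable[OF na])
  qed auto
  have "norm (?f x) \<le> (case x of (l, m) \<Rightarrow> norm (a l) * norm (b m) * \<bar>C\<bar>)" for x
  proof (cases x)
    case (Pair l m)
    have "norm (prod (a l) (b m)) \<le> norm (a l) * norm (b m) * C" by (rule C)
    also have "\<dots> \<le> norm (a l) * norm (b m) * \<bar>C\<bar>" by (intro mult_left_mono) auto
    finally show ?thesis by (simp add: Pair)
  qed
  then have f: "?f summable_on UNIV \<times> UNIV"
    by (intro abs_summable_summable[OF Infinite_Sum.abs_summable_on_comparison_test'[OF g]])
  have "infsum ?f (UNIV \<times> UNIV) = (\<Sum>\<^sub>\<infinity>l. \<Sum>\<^sub>\<infinity>m. prod (a l) (b m))"
    using infsum_Sigma_banach[OF f] by simp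
  also have "\<dots> = (\<Sum>\<^sub>\<infinity>l. prod (a l) (suminf b))"
    by (rule infsum_cong) (rule infsumI[OF has_sum_bounded_linear[OF bounded_linear_right hb]])
  also have "\<dots> = prod (suminf a) (suminf b)"
    by (rule infsumI[OF has_sum_bounded_linear[OF bounded_linear_left ha]])
  finally have hf: "(?f has_sum prod (suminf a) (suminf b)) (UNIV \<times> UNIV)"
    using f by (simp add: has_sum_iff)
  have "((\<lambda>(i, l). prod (a l) (b (i - l))) has_sum prod (suminf a) (suminf b)) (Sigma UNIV (\<lambda>i. {..i}))"
    by (subst has_sum_reindex_bij_witness[where T = "UNIV \<times> UNIV" and h = ?f
          and j = "\<lambda>(i, l). (l, i - l)" and i = "\<lambda>(l, m). (l + m, l)" and s' = "prod (suminf a) (suminf b)"])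
      (use hf in auto)
  then have "((\<lambda>i. \<Sum>l\<le>i. prod (a l) (b (i - l))) has_sum prod (suminf a) (suminf b)) UNIV"
    by (rule has_sum_SigmaD) auto
  then show ?thesis by (rule has_sum_imp_sums)
qed

text \<open>The quotient is written as in \<open>A_has_derivative\<close>, so that a limit taken
  coefficient by coefficient becomes a derivative by unfolding.\<close>

lemma has_vector_derivative_iff_quotient:
  fixes f :: "real \<Rightarrow> 'a::real_normed_vector"
  shows "(f has_vector_derivative D) (at t) \<longleftrightarrow>
    ((\<lambda>h. (1 / h) *\<^sub>R f (t + h) + (- 1 / h) *\<^sub>R f t) \<longlongrightarrow> D) (at 0)"
proof -
  have "eventually (\<lambda>h. norm (f (t + h) - f t - h *\<^sub>R D) / norm h
      = norm ((1 / h) *\<^sub>R f (t + h) + (- 1 / h) *\<^sub>R f t - D)) (at (0::real))"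
    unfolding eventually_at
  proof (intro exI[of _ 1] conjI ballI impI)
    fix h :: real assume "h \<noteq> 0 \<and> dist h 0 < 1"
    then have h: "h \<noteq> 0" by simp
    have "(1 / h) *\<^sub>R f (t + h) + (- 1 / h) *\<^sub>R f t - D = (1 / h) *\<^sub>R (f (t + h) - f t - h *\<^sub>R D)"
      using h by (simp add: scaleR_diff_right)
    then show "norm (f (t + h) - f t - h *\<^sub>R D) / norm h
      = norm ((1 / h) *\<^sub>R f (t + h) + (- 1 / h) *\<^sub>R f t - D)" by simp
  qed auto
  then have "((\<lambda>h. norm (f (t + h) - f t - h *\<^sub>R D) / norm h) \<longlongrightarrow> 0) (at 0)
     \<longleftrightarrow> ((\<lambda>h. norm ((1 / h) *\<^sub>R f (t + h) + (- 1 / h) *\<^sub>R f t - D)) \<longlongrightarrow> 0) (at 0)"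
    by (rule tendsto_cong)
  also have "\<dots> \<longleftrightarrow> ((\<lambda>h. (1 / h) *\<^sub>R f (t + h) + (- 1 / h) *\<^sub>R f t) \<longlongrightarrow> D) (at 0)"
    by (simp add: tendsto_norm_zero_iff LIM_zero_iff)
  finally show ?thesis
    by (simp add: has_vector_derivative_def has_derivative_at bounded_linear_scaleR_left)
qed

text \<open>A power series in time converging within a single step of the inductive limit, expressed
  on Fourier coefficients. Time radius, spatial rate and constant are common to all frequencies;
  this uniformity allows the infinite convolution sums to be expanded in powers of time.\<close>

definition expansion_at :: "real \<Rightarrow> real \<Rightarrow> real \<Rightarrow> (nat \<Rightarrow> vfield) \<Rightarrow> (real \<Rightarrow> vfield) \<Rightarrow> real \<Rightarrow> bool" where
  "expansion_at r \<sigma> K c u t\<^sub>0 \<longleftrightarrow> r > 0 \<and> \<sigma> > 0 \<and> (\<forall>i. exp_decay (K * (1 / r) ^ i) \<sigma> (c i)) \<and>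
     (\<forall>t k. \<bar>t - t\<^sub>0\<bar> < r \<longrightarrow> (\<lambda>i. (t - t\<^sub>0) ^ i *\<^sub>R c i k) sums u t k)"

definition locally_analytic :: "(real \<Rightarrow> vfield) \<Rightarrow> real \<Rightarrow> bool" where
  "locally_analytic u t\<^sub>0 \<longleftrightarrow> (\<exists>r \<sigma> K c. expansion_at r \<sigma> K c u t\<^sub>0)"

lemma expansion_term:
  assumes "expansion_at r \<sigma> K c u t\<^sub>0"
  shows "norm (s ^ i *\<^sub>R c i k) \<le> K * exp (- \<sigma> * freq_l1 k) * (\<bar>s\<bar> / r) ^ i"
proof -
  have "norm (s ^ i *\<^sub>R c i k) \<le> \<bar>s\<bar> ^ i * (K * (1 / r) ^ i * exp (- \<sigma> * freq_l1 k))"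
    using assms by (simp add: expansion_at_def exp_decay_def power_abs mult_left_mono)
  then show ?thesis by (simp add: power_divide field_simps)
qed

lemma expansion_K: "expansion_at r \<sigma> K c u t\<^sub>0 \<Longrightarrow> K \<ge> 0"
  unfolding expansion_at_def using exp_decay_nonneg[of "K * (1 / r) ^ 0" \<sigma> "c 0"]
  by (metis mult.right_neutral power_0)

lemma expansion_ratio:
  assumes "expansion_at r \<sigma> K c u t\<^sub>0" "\<bar>t - t\<^sub>0\<bar> < r"
  shows "0 \<le> \<bar>t - t\<^sub>0\<bar> / r" "\<bar>t - t\<^sub>0\<bar> / r < 1"
  using assms by (auto simp: expansion_at_def)

lemma expansion_tail:
  assumes "expansion_at r \<sigma> K c u t\<^sub>0" "\<bar>t - t\<^sub>0\<bar> < r"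
  shows "norm (u t k - (\<Sum>i<N. (t - t\<^sub>0) ^ i *\<^sub>R c i k))
     \<le> K * (\<bar>t - t\<^sub>0\<bar> / r) ^ N / (1 - \<bar>t - t\<^sub>0\<bar> / r) * exp (- \<sigma> * freq_l1 k)"
proof -
  have "(\<lambda>i. (t - t\<^sub>0) ^ i *\<^sub>R c i k) sums u t k" using assms by (simp add: expansion_at_def)
  from geometric_tail[OF expansion_term[OF assms(1)] expansion_ratio[OF assms] this, of N]
  show ?thesis by (simp add: mult_ac)
qed

lemma expansion_decay:
  assumes "expansion_at r \<sigma> K c u t\<^sub>0" "\<bar>t - t\<^sub>0\<bar> < r"
  shows "exp_decay (K / (1 - \<bar>t - t\<^sub>0\<bar> / r)) \<sigma> (u t)"
  using expansion_tail[OF assms, of _ 0] by (simp add: exp_decay_def)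

lemma expansion_shrink:
  assumes "expansion_at r \<sigma> K c u t\<^sub>0" "0 < r'" "r' \<le> r"
  shows "expansion_at r' \<sigma> K c u t\<^sub>0"
  unfolding expansion_at_def
proof (intro conjI allI impI)
  fix i
  have "K * (1 / r) ^ i \<le> K * (1 / r') ^ i"
    using assms expansion_K[OF assms(1)]
    by (intro mult_left_mono power_mono) (auto simp: field_simps expansion_at_def)
  then show "exp_decay (K * (1 / r') ^ i) \<sigma> (c i)"
    using assms(1) by (auto simp: expansion_at_def intro: exp_decay_mono)
qed (use assms in \<open>auto simp: expansion_at_def\<close>)

lemma expansion_cong:
  assumes "expansion_at r \<sigma> K c u t\<^sub>0" "\<And>t. \<bar>t - t\<^sub>0\<bar> < r \<Longrightarrow> v t = u t"
  shows "expansion_at r \<sigma> K c v t\<^sub>0"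
  using assms by (simp add: expansion_at_def)

lemma expansion_at_centre:
  assumes "expansion_at r \<sigma> K c u t\<^sub>0"
  shows "c 0 = u t\<^sub>0"
proof
  fix k
  have "\<bar>t\<^sub>0 - t\<^sub>0\<bar> < r" using assms by (simp add: expansion_at_def)
  then have "(\<lambda>i. (t\<^sub>0 - t\<^sub>0) ^ i *\<^sub>R c i k) sums u t\<^sub>0 k" using assms unfolding expansion_at_def by blast
  moreover have "(\<lambda>i. (t\<^sub>0 - t\<^sub>0) ^ i *\<^sub>R c i k) = (\<lambda>i. if i = 0 then c 0 k else 0)"
    by (auto simp: power_0_left)
  moreover have "(\<lambda>i. if i = 0 then c 0 k else 0) sums c 0 k" using sums_single[of 0 "\<lambda>_. c 0 k"] by simp
  ultimately show "c 0 k = u t\<^sub>0 k" using sums_unique2 by metis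
qed

section \<open>Substitution of a time series into the nonlinearity\<close>

lemma bounded_bilinear_euler_term:
  "bounded_bilinear (\<lambda>a b. cdot a (freq_vec l) *s leray k b)"
proof (rule bounded_bilinear.intro)
  show "\<exists>C. \<forall>a b. norm (cdot a (freq_vec l) *s leray k b) \<le> norm a * norm b * C"
  proof (intro exI allI)
    fix a b show "norm (cdot a (freq_vec l) *s leray k b) \<le> norm a * norm b * (2 * freq_norm l)"
      using norm_euler_term[of a l k b] by (simp add: mult_ac)
  qed
qed (simp_all add: cdot_add_left cdot_scaleR_left leray_add leray_scaleR vec_eq_iff algebra_simps
    scaleR_conv_of_real[where 'a = complex])

lemma bounded_linear_smult_complex: "bounded_linear (\<lambda>x :: complex ^ 3. c *s x)"
  by (rule bounded_linear_intro[of _ "norm c"])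
    (simp_all add: norm_vector_smult mult.commute scaleR_eq_smult vec_eq_iff algebra_simps)

lemma euler_P_sum:
  assumes "v \<in> Asp" "w \<in> Asp"
  shows "((\<lambda>h. cdot (v h) (freq_vec (k - h)) *s leray k (w (k - h))) has_sum \<i> *s euler_P v w k) UNIV"
proof -
  have "\<i> *s euler_P v w k = (\<Sum>\<^sub>\<infinity>h. cdot (v h) (freq_vec (k - h)) *s leray k (w (k - h)))"
    by (simp add: euler_P_def vector_smult_assoc)
  then show ?thesis using has_sum_infsum[OF abs_summable_summable[OF euler_term_summable[OF assms]]] by simp
qed

text \<open>The decay of \<open>w\<close> pays for the derivative and the decay of \<open>v\<close>
  is kept for the sum over \<open>h\<close>, so the bound does not involve \<open>k\<close>.\<close>

lemma euler_term_decay_bound: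
  assumes v: "exp_decay K \<sigma> v" and w: "exp_decay L \<sigma> w" and s: "\<sigma> > 0"
  shows "norm (cdot (v h) (freq_vec (k - h)) *s leray k (w (k - h))) \<le> 2 * K * L / \<sigma> * exp (- \<sigma> * freq_l1 h)"
proof -
  have K: "K \<ge> 0" and L: "L \<ge> 0" using exp_decay_nonneg v w by auto
  have "freq_norm (k - h) * norm (w (k - h)) \<le> (exp (\<sigma> * freq_l1 (k - h)) / \<sigma>) * (L * exp (- \<sigma> * freq_l1 (k - h)))"
  proof (rule mult_mono)
    show "freq_norm (k - h) \<le> exp (\<sigma> * freq_l1 (k - h)) / \<sigma>"
      using freq_norm_le_l1[of "k - h"] le_exp_mult[OF s, of "freq_l1 (k - h)"] by linarith
  qed (use w s in \<open>auto simp: exp_decay_def\<close>)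
  also have "\<dots> = L / \<sigma>" by (simp add: exp_minus)
  finally have l: "freq_norm (k - h) * norm (w (k - h)) \<le> L / \<sigma>" .
  have "norm (v h) * (freq_norm (k - h) * norm (w (k - h))) \<le> (K * exp (- \<sigma> * freq_l1 h)) * (L / \<sigma>)"
    using v K s by (intro mult_mono l) (auto simp: exp_decay_def)
  then have "2 * (norm (v h) * (freq_norm (k - h) * norm (w (k - h)))) \<le> 2 * ((K * exp (- \<sigma> * freq_l1 h)) * (L / \<sigma>))"
    by (rule mult_left_mono) simp
  also have "\<dots> = 2 * K * L / \<sigma> * exp (- \<sigma> * freq_l1 h)" by simp
  finally have "2 * (norm (v h) * (freq_norm (k - h) * norm (w (k - h)))) \<le> 2 * K * L / \<sigma> * exp (- \<sigma> * freq_l1 h)" .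
  then show ?thesis by (rule order_trans[OF norm_euler_term])
qed

lemma wiener_fin_of_decay: "exp_decay K \<sigma> v \<Longrightarrow> \<sigma> > 0 \<Longrightarrow> wiener_fin 0 v \<and> wiener_fin (0 + \<sigma> / 2) v"
  using exp_decay_wiener(1)[of K \<sigma> v 0] exp_decay_wiener(1)[of K \<sigma> v "\<sigma> / 2"] by auto

text \<open>For each \<open>h\<close> the convolution term is a Cauchy product in time. The sums
  over \<open>h\<close> and over powers of time may be exchanged because the double family is
  dominated by a product of a summable exponential in \<open>h\<close> and a summable series in
  \<open>i\<close>.\<close>

lemma euler_P_expansion:
  assumes E: "expansion_at r \<sigma> K c u t\<^sub>0" and t: "\<bar>t - t\<^sub>0\<bar> < r"
  shows "(\<lambda>i. (t - t\<^sub>0) ^ i *\<^sub>R (\<Sum>l\<le>i. euler_P (c l) (c (i - l)) k)) sums euler_P (u t) (u t) k"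
proof -
  define s where "s = t - t\<^sub>0"
  have r: "r > 0" and sg: "\<sigma> > 0" and cd: "\<And>i. exp_decay (K * (1 / r) ^ i) \<sigma> (c i)"
    using E by (auto simp: expansion_at_def)
  define y where "y = \<bar>s\<bar> / r"
  have y: "0 \<le> y" "y < 1" using expansion_ratio[OF E t] by (auto simp: y_def s_def)
  define B where "B = (\<lambda>h a b. cdot a (freq_vec (k - h)) *s leray k b)"
  have bl: "bounded_bilinear (B h)" for h unfolding B_def by (rule bounded_bilinear_euler_term)
  define G where "G = (\<lambda>h i. s ^ i *\<^sub>R (\<Sum>l\<le>i. B h (c l h) (c (i - l) (k - h))))"
  have Gi: "(\<lambda>i. G h i) sums B h (u t h) (u t (k - h))" for h
  proof -
    let ?a = "\<lambda>h i. s ^ i *\<^sub>R c i h"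
    have sm: "summable (\<lambda>i. norm (?a h i))" for h
      by (rule geometric_summable_norm[OF expansion_term[OF E] y[unfolded y_def]])
    have su: "suminf (?a h) = u t h" for h
      using E t unfolding expansion_at_def s_def by (metis sums_unique)
    have "(\<lambda>i. \<Sum>l\<le>i. B h (?a h l) (?a (k - h) (i - l))) sums B h (u t h) (u t (k - h))"
      using bilinear_Cauchy_product_sums[OF bl sm sm, of h h "k - h"] by (simp only: su)
    moreover have "(\<Sum>l\<le>i. B h (?a h l) (?a (k - h) (i - l))) = G h i" for i
    proof -
      have "B h (?a h l) (?a (k - h) (i - l)) = s ^ i *\<^sub>R B h (c l h) (c (i - l) (k - h))" if "l \<le> i" for l
      proof -
        have "s ^ (i - l) * s ^ l = s ^ i" using that by (simp add: power_add[symmetric])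
        then show ?thesis
          by (simp add: bounded_bilinear.scaleR_left[OF bl] bounded_bilinear.scaleR_right[OF bl])
      qed
      then show ?thesis unfolding G_def scaleR_sum_right by (intro sum.cong) auto
    qed
    ultimately show ?thesis by simp
  qed
  \<comment> \<open>The i + 1 equal terms y^i are kept as a Cauchy product of two geometric series,
    whose summability is then immediate.\<close>
  have Gb: "norm (G h i) \<le> exp (- \<sigma> * freq_l1 h) * ((2 * K\<^sup>2 / \<sigma>) * (\<Sum>l\<le>i. y ^ l * y ^ (i - l)))" for h i
  proof -
    have "norm (B h (c l h) (c (i - l) (k - h))) \<le> (2 * K\<^sup>2 / \<sigma>) * (1 / r) ^ i * exp (- \<sigma> * freq_l1 h)" if "l \<le> i" for l
    proof -
      have e: "(1 / r) ^ l * (1 / r) ^ (i - l) = (1 / r) ^ i" using that by (simp add: power_add[symmetric])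
      have "norm (B h (c l h) (c (i - l) (k - h)))
         \<le> 2 * (K * (1 / r) ^ l) * (K * (1 / r) ^ (i - l)) / \<sigma> * exp (- \<sigma> * freq_l1 h)"
        unfolding B_def by (rule euler_term_decay_bound[OF cd cd sg])
      also have "\<dots> = (2 * K\<^sup>2 / \<sigma>) * ((1 / r) ^ l * (1 / r) ^ (i - l)) * exp (- \<sigma> * freq_l1 h)"
        by (simp add: power2_eq_square)
      finally show ?thesis by (simp only: e)
    qed
    then have "norm (\<Sum>l\<le>i. B h (c l h) (c (i - l) (k - h))) \<le> (\<Sum>l\<le>i. (2 * K\<^sup>2 / \<sigma>) * (1 / r) ^ i * exp (- \<sigma> * freq_l1 h))"
      by (intro sum_norm_le) auto
    then have "norm (G h i) \<le> \<bar>s\<bar> ^ i * (\<Sum>l\<le>i. (2 * K\<^sup>2 / \<sigma>) * (1 / r) ^ i * exp (- \<sigma> * freq_l1 h))"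
      unfolding G_def norm_scaleR power_abs by (rule mult_left_mono) simp
    also have "\<dots> = exp (- \<sigma> * freq_l1 h) * ((2 * K\<^sup>2 / \<sigma>) * (\<Sum>l\<le>i. y ^ i))"
      by (simp add: y_def power_divide)
    also have "(\<Sum>l\<le>i. y ^ i) = (\<Sum>l\<le>i. y ^ l * y ^ (i - l))"
      by (rule sum.cong) (auto simp: power_add[symmetric])
    finally show ?thesis .
  qed
  have sy: "summable (\<lambda>i. (2 * K\<^sup>2 / \<sigma>) * (\<Sum>l\<le>i. y ^ l * y ^ (i - l)))"
    by (intro summable_mult summable_Cauchy_product) (use y in \<open>auto simp: norm_power intro!: summable_geometric\<close>)
  then have sy': "(\<lambda>i. (2 * K\<^sup>2 / \<sigma>) * (\<Sum>l\<le>i. y ^ l * y ^ (i - l))) summable_on UNIV"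
    by (rule summable_nonneg_imp_summable_on) (use y sg in \<open>auto intro!: mult_nonneg_nonneg divide_nonneg_nonneg sum_nonneg\<close>)
  have "(\<lambda>(h, i). exp (- \<sigma> * freq_l1 h) * ((2 * K\<^sup>2 / \<sigma>) * (\<Sum>l\<le>i. y ^ l * y ^ (i - l)))) summable_on UNIV \<times> UNIV"
  proof (rule summable_on_SigmaI)
    show "(\<lambda>h::freq. exp (- \<sigma> * freq_l1 h) * infsum (\<lambda>i. (2 * K\<^sup>2 / \<sigma>) * (\<Sum>l\<le>i. y ^ l * y ^ (i - l))) UNIV) summable_on UNIV"
      by (rule summable_on_cmult_left[OF summable_on_exp_freq[OF sg]])
    show "((\<lambda>i. case (h, i) of (h, i) \<Rightarrow> exp (- \<sigma> * freq_l1 h) * ((2 * K\<^sup>2 / \<sigma>) * (\<Sum>l\<le>i. y ^ l * y ^ (i - l))))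
      has_sum exp (- \<sigma> * freq_l1 h) * infsum (\<lambda>i. (2 * K\<^sup>2 / \<sigma>) * (\<Sum>l\<le>i. y ^ l * y ^ (i - l))) UNIV) UNIV" for h :: freq
      using has_sum_cmult_right[OF has_sum_infsum[OF sy'], of "exp (- \<sigma> * freq_l1 h)"] by simp
  qed (use y sg in \<open>auto intro!: mult_nonneg_nonneg divide_nonneg_nonneg sum_nonneg\<close>)
  then have Gsum: "(\<lambda>(h, i). G h i) summable_on UNIV \<times> UNIV"
  proof (rule abs_summable_summable[OF Infinite_Sum.abs_summable_on_comparison_test'])
    fix x :: "freq \<times> nat"
    show "norm (case x of (h, i) \<Rightarrow> G h i)
      \<le> (case x of (h, i) \<Rightarrow> exp (- \<sigma> * freq_l1 h) * ((2 * K\<^sup>2 / \<sigma>) * (\<Sum>l\<le>i. y ^ l * y ^ (i - l))))"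
      by (cases x) (simp only: prod.case Gb)
  qed
  have "(\<Sum>\<^sub>\<infinity>h. \<Sum>\<^sub>\<infinity>i. G h i) = (\<Sum>\<^sub>\<infinity>h. B h (u t h) (u t (k - h)))"
  proof (rule infsum_cong)
    fix h
    have "summable (\<lambda>i. norm (G h i))"
      by (rule summable_comparison_test'[OF summable_mult[OF sy]]) (use Gb in auto)
    then show "(\<Sum>\<^sub>\<infinity>i. G h i) = B h (u t h) (u t (k - h))"
      by (intro infsumI norm_summable_imp_has_sum Gi)
  qed
  then have tot: "(\<Sum>\<^sub>\<infinity>i. \<Sum>\<^sub>\<infinity>h. G h i) = (\<Sum>\<^sub>\<infinity>h. B h (u t h) (u t (k - h)))"
    using infsum_swap_banach[OF Gsum] by simp
  have Gh: "(\<Sum>\<^sub>\<infinity>h. G h i) = s ^ i *\<^sub>R (\<Sum>l\<le>i. \<Sum>\<^sub>\<infinity>h. B h (c l h) (c (i - l) (k - h)))" for i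
  proof -
    have hs: "((\<lambda>h. B h (c l h) (c (i - l) (k - h))) has_sum (\<Sum>\<^sub>\<infinity>h. B h (c l h) (c (i - l) (k - h)))) UNIV" for l
      unfolding B_def using wiener_fin_of_decay[OF cd sg] sg
      by (intro has_sum_infsum abs_summable_summable[OF wiener_euler(1)[where \<sigma> = 0 and \<epsilon> = "\<sigma> / 2"]]) auto
    show ?thesis unfolding G_def infsum_scaleR_right
      by (rule arg_cong[of _ _ "scaleR _"]) (rule infsumI[OF has_sum_sum], auto intro: hs)
  qed
  have "(\<lambda>i. \<Sum>\<^sub>\<infinity>h. G h i) summable_on UNIV"
    using summable_on_Sigma_banach[of "\<lambda>i h. G h i" UNIV "\<lambda>_. UNIV"] Gsum
    by (subst (asm) summable_on_reindex_bij_witness[where i = prod.swap and j = prod.swap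
          and T = "UNIV \<times> UNIV" and h = "\<lambda>(i, h). G h i"]) auto
  then have "((\<lambda>i. \<Sum>\<^sub>\<infinity>h. G h i) has_sum (\<Sum>\<^sub>\<infinity>h. B h (u t h) (u t (k - h)))) UNIV"
    by (simp add: has_sum_iff tot)
  then have "(\<lambda>i. \<Sum>\<^sub>\<infinity>h. G h i) sums (\<Sum>\<^sub>\<infinity>h. B h (u t h) (u t (k - h)))" by (rule has_sum_imp_sums)
  then have "(\<lambda>i. (- \<i>) *s (\<Sum>\<^sub>\<infinity>h. G h i)) sums ((- \<i>) *s (\<Sum>\<^sub>\<infinity>h. B h (u t h) (u t (k - h))))"
    by (rule bounded_linear.sums[OF bounded_linear_smult_complex])
  moreover have "(- \<i>) *s (\<Sum>\<^sub>\<infinity>h. G h i) = s ^ i *\<^sub>R (\<Sum>l\<le>i. euler_P (c l) (c (i - l)) k)" for i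
    unfolding Gh euler_P_def B_def
    by (simp add: vec.scale_sum_right scaleR_eq_smult vector_smult_assoc mult.commute)
  moreover have "(- \<i>) *s (\<Sum>\<^sub>\<infinity>h. B h (u t h) (u t (k - h))) = euler_P (u t) (u t) k"
    by (simp add: euler_P_def B_def)
  ultimately show ?thesis by (simp add: s_def)
qed

subsection \<open>Complex extension\<close>

text \<open>The component \<open>p\<close> of the coefficient at \<open>k\<close> as a function of a
  complex increment of time. Complex time makes Cauchy's inequality and the identity theorem
  available, and the bounds stay uniform in \<open>k\<close>.\<close>

definition cext :: "(nat \<Rightarrow> vfield) \<Rightarrow> freq \<Rightarrow> 3 \<Rightarrow> complex \<Rightarrow> complex" where
  "cext c k p z = (\<Sum>i. (c i k $ p) * z ^ i)"

lemma norm_le_component_bound: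
  fixes x :: "complex ^ 3"
  assumes "\<And>p. norm (x $ p) \<le> M"
  shows "norm x \<le> 3 * M"
proof -
  have "norm x \<le> (\<Sum>p\<in>UNIV. norm (x $ p))" unfolding norm_vec_def by (rule L2_set_le_sum) simp
  also have "\<dots> \<le> (\<Sum>p\<in>(UNIV::3 set). M)" by (rule sum_mono) (rule assms)
  finally show ?thesis by simp
qed

lemma cext_term:
  assumes E: "expansion_at r \<sigma> K c u t\<^sub>0"
  shows "norm ((c i k $ p) * z ^ i) \<le> K * exp (- \<sigma> * freq_l1 k) * (norm z / r) ^ i"
proof -
  have "norm ((c i k $ p) * z ^ i) \<le> norm (norm z ^ i *\<^sub>R c i k)"
    using Finite_Cartesian_Product.norm_nth_le[of "c i k" p] by (simp add: norm_mult norm_power mult.commute mult_left_mono)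
  then show ?thesis using expansion_term[OF E, of "norm z" i k] by simp
qed

lemma cext_sums:
  assumes E: "expansion_at r \<sigma> K c u t\<^sub>0" and z: "norm z < r"
  shows "(\<lambda>i. (c i k $ p) * z ^ i) sums cext c k p z"
    and "norm (cext c k p z) \<le> K / (1 - norm z / r) * exp (- \<sigma> * freq_l1 k)"
proof -
  have r: "r > 0" using E by (simp add: expansion_at_def)
  have y: "0 \<le> norm z / r" "norm z / r < 1" using r z by auto
  show s: "(\<lambda>i. (c i k $ p) * z ^ i) sums cext c k p z"
    unfolding cext_def
    by (intro summable_sums summable_norm_cancel[OF geometric_summable_norm[OF cext_term[OF E] y]])
  show "norm (cext c k p z) \<le> K / (1 - norm z / r) * exp (- \<sigma> * freq_l1 k)"
    using geometric_tail[OF cext_term[OF E] y s, of 0] by (simp add: mult_ac)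
qed

lemma cext_real:
  assumes E: "expansion_at r \<sigma> K c u t\<^sub>0" and t: "\<bar>t - t\<^sub>0\<bar> < r"
  shows "cext c k p (of_real (t - t\<^sub>0)) = u t k $ p"
proof -
  have "(\<lambda>i. (t - t\<^sub>0) ^ i *\<^sub>R c i k) sums u t k" using E t by (simp add: expansion_at_def)
  then have "(\<lambda>i. ((t - t\<^sub>0) ^ i *\<^sub>R c i k) $ p) sums (u t k $ p)"
    by (rule bounded_linear.sums[OF bounded_linear_vec_nth])
  then have "(\<lambda>i. (c i k $ p) * of_real (t - t\<^sub>0) ^ i) sums (u t k $ p)"
    by (simp add: scaleR_conv_of_real[where 'a = complex] mult.commute)
  then show ?thesis unfolding cext_def by (simp add: sums_iff)
qed

lemma cext_holomorphic:
  assumes E: "expansion_at r \<sigma> K c u t\<^sub>0"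
  shows "cext c k p holomorphic_on ball 0 r"
  by (rule power_series_holomorphic[of _ _ "\<lambda>i. c i k $ p"]) (use cext_sums(1)[OF E] in \<open>simp add: dist_norm\<close>)

lemma expansion_has_vector_derivative:
  assumes E: "expansion_at r \<sigma> K c u t\<^sub>0" and t: "\<bar>t - t\<^sub>0\<bar> < r"
  shows "\<exists>D. ((\<lambda>t. u t k) has_vector_derivative D) (at t)
     \<and> (\<lambda>i. (t - t\<^sub>0) ^ i *\<^sub>R (real (Suc i) *\<^sub>R c (Suc i) k)) sums D"
proof -
  let ?z = "complex_of_real (t - t\<^sub>0)"
  obtain q where q: "\<bar>t - t\<^sub>0\<bar> < q" "q < r" using t dense by blast
  define D :: "complex ^ 3" where "D = (\<chi> p. \<Sum>i. diffs (\<lambda>i. c i k $ p) i * ?z ^ i)"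
  have sm: "summable (\<lambda>i. (c i k $ p) * complex_of_real q ^ i)" for p
    using cext_sums(1)[OF E, of "complex_of_real q"] q by (auto simp: sums_iff)
  have nz: "norm ?z < norm (complex_of_real q)" using q by (simp only: norm_of_real)
  have D1: "(cext c k p has_field_derivative D $ p) (at ?z)" for p
    unfolding D_def cext_def[abs_def] using termdiffs_strong[OF sm nz] by simp
  have D2: "(\<lambda>i. diffs (\<lambda>i. c i k $ p) i * ?z ^ i) sums (D $ p)" for p
    unfolding D_def
    using termdiff_converges[of ?z "norm (complex_of_real q)" "\<lambda>i. c i k $ p"] nz
      cext_sums(1)[OF E] q by (force simp: sums_iff)
  have D3: "((\<lambda>t. cext c k p (of_real (t - t\<^sub>0))) has_vector_derivative (D $ p)) (at t)" for p
  proof -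
    have "((\<lambda>t. complex_of_real (t - t\<^sub>0)) has_vector_derivative 1) (at t)"
      by (auto intro!: derivative_eq_intros simp: of_real_def)
    from field_vector_diff_chain_at[OF this D1] show ?thesis by (simp add: o_def)
  qed
  have Dp: "((\<lambda>t. u t k $ p) has_vector_derivative (D $ p)) (at t)" for p
  proof (rule has_vector_derivative_transform_within_open[OF D3])
    show "open (ball t\<^sub>0 r)" "t \<in> ball t\<^sub>0 r" using t by (auto simp: dist_real_def)
    show "cext c k p (of_real (x - t\<^sub>0)) = u x k $ p" if "x \<in> ball t\<^sub>0 r" for x
      using that by (intro cext_real[OF E]) (auto simp: dist_real_def)
  qed
  have "((\<lambda>t. u t k) has_vector_derivative D) (at t)"
    unfolding has_vector_derivative_iff_quotient
  proof (rule vec_tendstoI)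
    fix p
    show "((\<lambda>h. ((1 / h) *\<^sub>R u (t + h) k + (- 1 / h) *\<^sub>R u t k) $ p) \<longlongrightarrow> D $ p) (at 0)"
      using Dp[of p] unfolding has_vector_derivative_iff_quotient by simp
  qed
  moreover have "(\<lambda>i. (t - t\<^sub>0) ^ i *\<^sub>R (real (Suc i) *\<^sub>R c (Suc i) k)) sums D"
    unfolding sums_def
  proof (rule vec_tendstoI)
    fix p
    have "diffs (\<lambda>i. c i k $ p) i * ?z ^ i = ((t - t\<^sub>0) ^ i *\<^sub>R (real (Suc i) *\<^sub>R c (Suc i) k)) $ p" for i
      by (simp add: diffs_def scaleR_conv_of_real[where 'a = complex] mult_ac)
    then show "(\<lambda>n. (\<Sum>i<n. (t - t\<^sub>0) ^ i *\<^sub>R (real (Suc i) *\<^sub>R c (Suc i) k)) $ p) \<longlonglongrightarrow> D $ p"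
      using D2[of p] by (simp add: sums_def)
  qed
  ultimately show ?thesis by blast
qed

section \<open>The equation in time and the recursion for the coefficients\<close>

definition solves_euler_at :: "(real \<Rightarrow> vfield) \<Rightarrow> real \<Rightarrow> bool" where
  "solves_euler_at u t \<longleftrightarrow> (\<forall>k. ((\<lambda>t. u t k) has_vector_derivative euler_P (u t) (u t) k) (at t))"

text \<open>Both sides of the equation are power series about the same centre, one by termwise
  differentiation and the other by \<open>euler_P_expansion\<close>; uniqueness of coefficients
  gives the recursion.\<close>

lemma expansion_recursion:
  assumes E: "expansion_at r \<sigma> K c u t\<^sub>0"
    and ode: "\<And>t. \<bar>t - t\<^sub>0\<bar> < r \<Longrightarrow> solves_euler_at u t"
  shows "euler_recursion c"
proof -
  have r: "r > 0" and sg: "\<sigma> > 0" and cd: "\<And>i. exp_decay (K * (1 / r) ^ i) \<sigma> (c i)"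
    using E by (auto simp: expansion_at_def)
  have K: "K \<ge> 0" by (rule expansion_K[OF E])
  obtain C where C: "C \<ge> 0" "\<And>K L v w. exp_decay K \<sigma> v \<Longrightarrow> exp_decay L \<sigma> w \<Longrightarrow> exp_decay (C * K * L) (\<sigma> / 4) (euler_P v w)"
    using exp_decay_euler[OF sg] by blast
  have "real (Suc j) *\<^sub>R c (Suc j) k - (\<Sum>l\<le>j. euler_P (c l) (c (j - l)) k) = 0" for j k
  proof (rule power_series_zero_unique[where e = "\<lambda>j. real (Suc j) *\<^sub>R c (Suc j) k - (\<Sum>l\<le>j. euler_P (c l) (c (j - l)) k)"])
    define M where "M = K / r + C * K * K"
    show "r / 2 > 0" using r by simp
    fix i
    \<comment> \<open>Differentiation produces a factor i + 1, and the Cauchy product has i + 1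
      terms; halving the radius absorbs both.\<close>
    have i2: "real (Suc i) \<le> 2 ^ i" by (induction i) auto
    have 1: "norm (c (Suc i) k) \<le> K / r * (1 / r) ^ i"
    proof -
      have "norm (c (Suc i) k) \<le> K * (1 / r) ^ Suc i * exp (- \<sigma> * freq_l1 k)"
        using cd[of "Suc i"] unfolding exp_decay_def by blast
      also have "\<dots> \<le> K * (1 / r) ^ Suc i * 1"
        using K r sg by (intro mult_left_mono) auto
      finally show ?thesis by simp
    qed
    have 2: "norm (euler_P (c l) (c (i - l)) k) \<le> C * K * K * (1 / r) ^ i" if "l \<le> i" for l
    proof -
      have "exp_decay (C * (K * (1 / r) ^ l) * (K * (1 / r) ^ (i - l))) (\<sigma> / 4) (euler_P (c l) (c (i - l)))"
        by (rule C(2)[OF cd cd])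
      then have "norm (euler_P (c l) (c (i - l)) k) \<le> C * (K * (1 / r) ^ l) * (K * (1 / r) ^ (i - l)) * exp (- (\<sigma> / 4) * freq_l1 k)"
        by (simp add: exp_decay_def)
      also have "\<dots> \<le> C * (K * (1 / r) ^ l) * (K * (1 / r) ^ (i - l)) * 1"
        using C K r sg by (intro mult_left_mono) auto
      also have "\<dots> = C * K * K * ((1 / r) ^ l * (1 / r) ^ (i - l))" by simp
      also have "(1 / r) ^ l * (1 / r) ^ (i - l) = (1 / r) ^ i" using that by (simp add: power_add[symmetric])
      finally show ?thesis .
    qed
    have "norm (real (Suc i) *\<^sub>R c (Suc i) k - (\<Sum>l\<le>i. euler_P (c l) (c (i - l)) k))
       \<le> norm (real (Suc i) *\<^sub>R c (Suc i) k) + (\<Sum>l\<le>i. norm (euler_P (c l) (c (i - l)) k))"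
      by (rule order_trans[OF norm_triangle_ineq4 add_left_mono[OF norm_sum]])
    also have "\<dots> \<le> real (Suc i) * (K / r * (1 / r) ^ i) + (\<Sum>l\<le>i. C * K * K * (1 / r) ^ i)"
    proof (intro add_mono sum_mono)
      show "norm (real (Suc i) *\<^sub>R c (Suc i) k) \<le> real (Suc i) * (K / r * (1 / r) ^ i)"
        unfolding norm_scaleR abs_of_nat by (rule mult_left_mono[OF 1]) simp
    qed (use 2 in auto)
    also have "\<dots> = real (Suc i) * (M * (1 / r) ^ i)"
      by (simp add: M_def algebra_simps)
    also have "\<dots> \<le> 2 ^ i * (M * (1 / r) ^ i)"
      using C K r i2 by (intro mult_right_mono) (auto simp: M_def)
    also have "\<dots> = M * (1 / (r / 2)) ^ i" by (simp add: power_divide)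
    finally show "norm (real (Suc i) *\<^sub>R c (Suc i) k - (\<Sum>l\<le>i. euler_P (c l) (c (i - l)) k)) \<le> M * (1 / (r / 2)) ^ i" .
  next
    fix s :: real assume s: "0 < s" "s < r / 2"
    define t where "t = t\<^sub>0 + s"
    have t: "\<bar>t - t\<^sub>0\<bar> < r" "t - t\<^sub>0 = s" using s r by (auto simp: t_def)
    obtain D where D: "((\<lambda>t. u t k) has_vector_derivative D) (at t)"
      "(\<lambda>i. s ^ i *\<^sub>R (real (Suc i) *\<^sub>R c (Suc i) k)) sums D"
      using expansion_has_vector_derivative[OF E t(1), of k] unfolding t(2) by blast
    have "D = euler_P (u t) (u t) k"
      using D(1) ode[OF t(1)] unfolding solves_euler_at_def by (metis vector_derivative_unique_at)
    with sums_diff[OF D(2) euler_P_expansion[OF E t(1), of k, unfolded t(2)]]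
    show "(\<lambda>i. s ^ i *\<^sub>R (real (Suc i) *\<^sub>R c (Suc i) k - (\<Sum>l\<le>i. euler_P (c l) (c (i - l)) k))) sums 0"
      unfolding scaleR_diff_right by simp
  qed
  then have e: "real (Suc j) *\<^sub>R c (Suc j) k = (\<Sum>l\<le>j. euler_P (c l) (c (j - l)) k)" for j k by simp
  have "c (Suc j) k = (1 / real (Suc j)) *\<^sub>R (\<Sum>l\<le>j. euler_P (c l) (c (j - l)) k)" for j k
    unfolding e[symmetric] by (simp del: of_nat_Suc)
  then show ?thesis unfolding euler_recursion_def by blast
qed

lemma recursion_expansion_solves:
  assumes E: "expansion_at r \<sigma> K c u t\<^sub>0" and rec: "euler_recursion c" and t: "\<bar>t - t\<^sub>0\<bar> < r"
  shows "solves_euler_at u t"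
  unfolding solves_euler_at_def
proof
  fix k
  obtain D where D: "((\<lambda>t. u t k) has_vector_derivative D) (at t)"
    "(\<lambda>i. (t - t\<^sub>0) ^ i *\<^sub>R (real (Suc i) *\<^sub>R c (Suc i) k)) sums D"
    using expansion_has_vector_derivative[OF E t] by blast
  have "real (Suc i) *\<^sub>R c (Suc i) k = (\<Sum>l\<le>i. euler_P (c l) (c (i - l)) k)" for i
    using rec by (simp add: euler_recursion_def del: of_nat_Suc)
  with D(2) have "(\<lambda>i. (t - t\<^sub>0) ^ i *\<^sub>R (\<Sum>l\<le>i. euler_P (c l) (c (i - l)) k)) sums D" by (simp only:)
  with euler_P_expansion[OF E t, of k] have "D = euler_P (u t) (u t) k"
    by (rule sums_unique2[rotated])
  with D(1) show "((\<lambda>t. u t k) has_vector_derivative euler_P (u t) (u t) k) (at t)" by simp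
qed

lemma real_field_limit:
  assumes "\<And>k. (\<lambda>i. f i k) sums v k" "\<And>i. real_field (f i)"
  shows "real_field v"
  unfolding real_field_iff
proof
  fix k
  have "(\<lambda>i. cnj_vec (f i k)) sums cnj_vec (v k)"
    by (rule bounded_linear.sums[OF bounded_linear_cnj_vec assms(1)])
  moreover have "(\<lambda>i. cnj_vec (f i k)) = (\<lambda>i. f i (- k))" using assms(2) by (simp add: real_field_iff)
  ultimately show "v (- k) = cnj_vec (v k)" using assms(1)[of "- k"] by (metis sums_unique2)
qed

lemma mdf_limit:
  assumes "\<And>k. (\<lambda>i. f i k) sums v k" "\<And>i. mean_free_div_free (f i)"
  shows "mean_free_div_free v"
  unfolding mean_free_div_free_def
proof (intro conjI allI)
  show "v 0 = 0" using assms(1)[of 0] assms(2) sums_unique2[OF _ sums_zero] by (simp add: mean_free_div_free_def)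
  fix k
  have "(\<lambda>i. cdot (freq_vec k) (f i k)) sums cdot (freq_vec k) (v k)"
    by (rule bounded_linear.sums[OF bounded_linear_cdot_right assms(1)])
  then show "cdot (freq_vec k) (v k) = 0"
    using assms(2) sums_unique2[OF _ sums_zero] by (simp add: mean_free_div_free_def)
qed

lemma expansion_Asp:
  assumes E: "expansion_at r \<sigma> K c u t\<^sub>0" and c: "\<And>i. c i \<in> Asp" and t: "\<bar>t - t\<^sub>0\<bar> < r"
  shows "u t \<in> Asp"
  unfolding Asp_iff
proof (intro conjI exI)
  let ?f = "\<lambda>i. lincomb ((t - t\<^sub>0) ^ i) (c i) 0 (c i)"
  have s: "(\<lambda>i. ?f i k) sums u t k" for k using E t by (simp add: expansion_at_def lincomb_def)
  have f: "?f i \<in> Asp" for i by (rule Asp_lincomb[OF c c])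
  show "real_field (u t)" by (rule real_field_limit[OF s]) (use f in \<open>auto simp: Asp_iff\<close>)
  show "mean_free_div_free (u t)" by (rule mdf_limit[OF s]) (use f in \<open>auto simp: Asp_iff\<close>)
  show "\<sigma> > 0" using E by (simp add: expansion_at_def)
  show "exp_decay (K / (1 - \<bar>t - t\<^sub>0\<bar> / r)) \<sigma> (u t)" by (rule expansion_decay[OF E t])
qed

text \<open>Cauchy's inequality for the complex extensions about the new centre. Their bound on the
  disc contains the factor exp(-\<open>\<sigma>\<close>|k|), so the new coefficients decay at the
  same spatial rate; the 3 in \<open>K'\<close> passes from components to vectors.\<close>

lemma expansion_recentre:
  assumes E: "expansion_at r \<sigma> K c u t\<^sub>0" and t1: "\<bar>t\<^sub>1 - t\<^sub>0\<bar> < r"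
  shows "locally_analytic u t\<^sub>1"
proof -
  have r: "r > 0" and sg: "\<sigma> > 0" using E by (auto simp: expansion_at_def)
  have K: "K \<ge> 0" by (rule expansion_K[OF E])
  \<comment> \<open>Half the distance to the boundary: the closed disc of this radius about the new
    centre lies in |z| \<le> \<open>q\<close> with \<open>q\<close> strictly below \<open>r\<close>,
    where the extensions are bounded.\<close>
  define \<rho> where "\<rho> = (r - \<bar>t\<^sub>1 - t\<^sub>0\<bar>) / 2"
  have rho: "\<rho> > 0" using t1 by (simp add: \<rho>_def)
  define z1 where "z1 = complex_of_real (t\<^sub>1 - t\<^sub>0)"
  define q where "q = (\<bar>t\<^sub>1 - t\<^sub>0\<bar> + r) / 2"
  have q: "0 \<le> q" "q < r" using t1 r by (auto simp: q_def)
  have zq: "norm z \<le> q" if "z \<in> cball z1 \<rho>" for z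
  proof -
    have "norm z \<le> norm z1 + norm (z - z1)" by (metis add.commute diff_add_cancel norm_triangle_ineq)
    also have "\<dots> \<le> \<bar>t\<^sub>1 - t\<^sub>0\<bar> + \<rho>"
      using that unfolding z1_def norm_of_real by (simp add: dist_norm norm_minus_commute)
    also have "\<dots> = q" by (simp add: q_def \<rho>_def field_simps)
    finally show ?thesis .
  qed
  have sub: "cball z1 \<rho> \<subseteq> ball 0 r" using zq q by (force simp: dist_norm)
  define d :: "nat \<Rightarrow> vfield" where
    "d = (\<lambda>i k. \<chi> p. (deriv ^^ i) (cext c k p) z1 / fact i)"
  define K' where "K' = 3 * (K / (1 - q / r))"
  have hol: "cext c k p holomorphic_on ball z1 \<rho>" and cont: "continuous_on (cball z1 \<rho>) (cext c k p)" for k p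
    using cext_holomorphic[OF E] sub
    by (meson ball_subset_cball holomorphic_on_subset subset_trans,
        meson cext_holomorphic[OF E] holomorphic_on_imp_continuous_on holomorphic_on_subset sub)
  have bd: "norm (cext c k p z) \<le> K / (1 - q / r) * exp (- \<sigma> * freq_l1 k)" if "z \<in> cball z1 \<rho>" for z k p
  proof -
    have "norm (cext c k p z) \<le> K / (1 - norm z / r) * exp (- \<sigma> * freq_l1 k)"
      using zq[OF that] q by (intro cext_sums(2)[OF E]) auto
    also have "\<dots> \<le> K / (1 - q / r) * exp (- \<sigma> * freq_l1 k)"
    proof -
      have "norm z / r \<le> q / r" "q / r < 1" using zq[OF that] q r by (auto simp: divide_right_mono)
      then show ?thesis using K by (intro mult_right_mono divide_left_mono mult_pos_pos) auto
    qed
    finally show ?thesis .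
  qed
  have "expansion_at \<rho> \<sigma> K' d u t\<^sub>1"
    unfolding expansion_at_def
  proof (intro conjI allI impI rho sg)
    fix i
    show "exp_decay (K' * (1 / \<rho>) ^ i) \<sigma> (d i)"
      unfolding exp_decay_def
    proof
      fix k
      have "norm (d i k $ p) \<le> K / (1 - q / r) * exp (- \<sigma> * freq_l1 k) / \<rho> ^ i" for p
      proof -
        have "norm ((deriv ^^ i) (cext c k p) z1) \<le> fact i * (K / (1 - q / r) * exp (- \<sigma> * freq_l1 k)) / \<rho> ^ i"
          by (rule Cauchy_inequality[OF hol cont rho]) (intro bd, auto simp: dist_norm norm_minus_commute)
        then show ?thesis by (simp add: d_def norm_divide field_simps)
      qed
      from norm_le_component_bound[OF this]
      show "norm (d i k) \<le> K' * (1 / \<rho>) ^ i * exp (- \<sigma> * freq_l1 k)"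
        by (simp add: K'_def power_divide)
    qed
  next
    fix t k assume t: "\<bar>t - t\<^sub>1\<bar> < \<rho>"
    have tin: "complex_of_real (t - t\<^sub>0) \<in> ball z1 \<rho>"
    proof -
      have "z1 - complex_of_real (t - t\<^sub>0) = complex_of_real (t\<^sub>1 - t)" by (simp add: z1_def)
      then show ?thesis using t by (simp add: dist_norm del: of_real_diff)
    qed
    have "\<bar>t - t\<^sub>0\<bar> \<le> \<bar>t - t\<^sub>1\<bar> + \<bar>t\<^sub>1 - t\<^sub>0\<bar>"
      using abs_triangle_ineq[of "t - t\<^sub>1" "t\<^sub>1 - t\<^sub>0"] by simp
    also have "\<dots> < \<rho> + \<bar>t\<^sub>1 - t\<^sub>0\<bar>" using t by simp
    also have "\<dots> \<le> r" using t1 by (simp add: \<rho>_def field_simps)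
    finally have tr: "\<bar>t - t\<^sub>0\<bar> < r" .
    show "(\<lambda>i. (t - t\<^sub>1) ^ i *\<^sub>R d i k) sums u t k"
      unfolding sums_def
    proof (rule vec_tendstoI)
      fix p
      have "(\<lambda>i. (deriv ^^ i) (cext c k p) z1 / fact i * (complex_of_real (t - t\<^sub>0) - z1) ^ i) sums cext c k p (of_real (t - t\<^sub>0))"
        by (rule holomorphic_power_series[OF hol tin])
      moreover have "complex_of_real (t - t\<^sub>0) - z1 = complex_of_real (t - t\<^sub>1)" by (simp add: z1_def)
      ultimately have "(\<lambda>i. (deriv ^^ i) (cext c k p) z1 / fact i * (complex_of_real (t - t\<^sub>1)) ^ i) sums (u t k $ p)"
        by (simp only: cext_real[OF E tr])
      then show "(\<lambda>n. (\<Sum>i<n. (t - t\<^sub>1) ^ i *\<^sub>R d i k) $ p) \<longlonglongrightarrow> u t k $ p"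
        by (simp add: sums_def d_def scaleR_conv_of_real[where 'a = complex] mult.commute)
    qed
  qed
  then show ?thesis unfolding locally_analytic_def by blast
qed

subsection \<open>Coefficientwise description of analytic solutions\<close>

text \<open>Replaces \<open>A_solution\<close> by conditions that are local in time and refer to
  coefficients only; on a time domain containing 0 the two notions agree, by
  \<open>A_solution_imp_analytic_solution\<close> and
  \<open>analytic_solution_imp_A_solution\<close>. Arbitrary sets of times are allowed for the sake
  of gluing.\<close>

definition analytic_solution_on :: "real set \<Rightarrow> (real \<Rightarrow> vfield) \<Rightarrow> bool" where
  "analytic_solution_on I u \<longleftrightarrow> (\<forall>t\<in>I. u t \<in> Asp \<and> locally_analytic u t \<and> solves_euler_at u t)"

lemma open_time_dom: "open (time_dom Tm Tp)"
proof -
  have "time_dom Tm Tp = ereal -` {- Tm <..< Tp}" by (auto simp: time_dom_def)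
  moreover have "open (ereal -` {- Tm <..< Tp})" by (rule open_ereal_vimage) simp
  ultimately show ?thesis by simp
qed

lemma open_realE:
  assumes "open I" "t \<in> (I :: real set)"
  obtains e where "e > 0" "\<And>s. \<bar>s - t\<bar> < e \<Longrightarrow> s \<in> I"
  using assms by (metis dist_real_def open_dist)

lemma power_partial_sum_Asp:
  assumes "\<And>j. a j \<in> Asp"
  shows "power_partial_sum a t N \<in> Asp"
proof (cases N)
  case 0
  have "power_partial_sum a t 0 = lincomb 0 (a 0) 0 (a 0)" by (simp add: power_partial_sum_def lincomb_def)
  then show ?thesis using 0 Asp_lincomb[OF assms assms] by metis
next
  case (Suc m)
  have "(\<lambda>k. 1 *\<^sub>R (\<Sum>j\<in>{..<N}. lincomb (t ^ j) (a j) 0 (a j) k)) \<in> Asp"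
    by (rule Asp_sum) (use Suc in \<open>auto intro!: Asp_lincomb assms\<close>)
  then show ?thesis by (simp add: power_partial_sum_def lincomb_def)
qed

text \<open>The analogue of Abel's lemma: each term is the difference of two consecutive partial
  sums, and these are bounded in a common step by \<open>limitin_A_uniform_decay\<close>.\<close>

lemma A_convergent_terms_decay:
  assumes a: "\<And>j. a j \<in> Asp" and lim: "limitin A_topology (power_partial_sum a s) l sequentially" and s: "s \<noteq> 0"
  shows "\<exists>K \<sigma>. \<sigma> > 0 \<and> (\<forall>j. exp_decay (K * (1 / \<bar>s\<bar>) ^ j) \<sigma> (a j))"
proof -
  obtain K \<sigma> where K: "\<sigma> > 0" "\<And>N. exp_decay K \<sigma> (lincomb 1 (power_partial_sum a s N) (- 1) l)"
    using limitin_A_uniform_decay[OF lim power_partial_sum_Asp[OF a]] by blast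
  have "exp_decay (2 * K * (1 / \<bar>s\<bar>) ^ j) \<sigma> (a j)" for j
  proof -
    define d where "d = (\<lambda>N. lincomb 1 (power_partial_sum a s N) (- 1) l)"
    have "exp_decay (\<bar>1 / s ^ j\<bar> * K + \<bar>- 1 / s ^ j\<bar> * K) \<sigma> (lincomb (1 / s ^ j) (d (Suc j)) (- 1 / s ^ j) (d j))"
      by (rule exp_decay_lincomb) (use K in \<open>auto simp: d_def\<close>)
    moreover have "lincomb (1 / s ^ j) (d (Suc j)) (- 1 / s ^ j) (d j) = a j"
      using s by (auto simp: d_def lincomb_def power_partial_sum_def scaleR_diff_right scaleR_add_right)
    ultimately show ?thesis by (simp add: power_divide power_abs)
  qed
  then show ?thesis using K(1) by blast
qed

lemma A_solution_imp_analytic_solution: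
  assumes "A_solution u\<^sub>0 Tm Tp u"
  shows "analytic_solution_on (time_dom Tm Tp) u"
  unfolding analytic_solution_on_def
proof (intro ballI conjI)
  fix t0 assume t0: "t0 \<in> time_dom Tm Tp"
  show "u t0 \<in> Asp" using assms t0 by (simp add: A_solution_def)
  have "A_has_derivative u (euler_P (u t0) (u t0)) t0" using assms t0 by (simp add: A_solution_def)
  then show "solves_euler_at u t0"
    unfolding A_has_derivative_def solves_euler_at_def has_vector_derivative_iff_quotient
    by (auto dest: limitin_A_coeff simp: lincomb_def)
  obtain e a where ea: "e > 0" "\<And>j. a j \<in> Asp"
    "\<And>t. t \<in> time_dom Tm Tp \<Longrightarrow> \<bar>t - t0\<bar> < e \<Longrightarrow> limitin A_topology (power_partial_sum a (t - t0)) (u t) sequentially"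
    using assms t0 unfolding A_solution_def A_real_analytic_on_def by blast
  obtain \<delta> where d: "\<delta> > 0" "\<And>t. \<bar>t - t0\<bar> < \<delta> \<Longrightarrow> t \<in> time_dom Tm Tp"
    using open_realE[OF open_time_dom t0] by blast
  \<comment> \<open>Convergence at the single time \<open>t0 + s\<close> bounds all coefficients
    with time radius \<open>s\<close>; halving keeps that time inside both the expansion interval
    and the domain.\<close>
  define s where "s = min e \<delta> / 2"
  have s: "s > 0" "s < e" "s < \<delta>" using ea(1) d(1) by (auto simp: s_def min_def)
  have "limitin A_topology (power_partial_sum a (t0 + s - t0)) (u (t0 + s)) sequentially"
    by (rule ea(3)) (use d s in auto)
  then have "limitin A_topology (power_partial_sum a s) (u (t0 + s)) sequentially" by simp
  from A_convergent_terms_decay[OF ea(2) this] s obtain K \<sigma> where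
    K: "\<sigma> > 0" "\<And>j. exp_decay (K * (1 / s) ^ j) \<sigma> (a j)" by auto
  have "expansion_at s \<sigma> K a u t0"
    unfolding expansion_at_def
  proof (intro conjI allI impI K s)
    fix t k assume t: "\<bar>t - t0\<bar> < s"
    have "limitin A_topology (power_partial_sum a (t - t0)) (u t) sequentially"
      by (rule ea(3)) (use t s d in auto)
    from limitin_A_coeff[OF this, of k] show "(\<lambda>i. (t - t0) ^ i *\<^sub>R a i k) sums u t k"
      by (simp add: sums_def power_partial_sum_def)
  qed
  then show "locally_analytic u t0" unfolding locally_analytic_def by blast
qed

lemma analytic_solution_recursion:
  assumes sol: "analytic_solution_on I u" and I: "open I" "t\<^sub>0 \<in> I"
  obtains r \<sigma> K c where "expansion_at r \<sigma> K c u t\<^sub>0" "euler_recursion c" "\<And>i. c i \<in> Asp"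
    "\<And>t. \<bar>t - t\<^sub>0\<bar> < r \<Longrightarrow> t \<in> I"
proof -
  obtain r \<sigma> K c where E: "expansion_at r \<sigma> K c u t\<^sub>0"
    using sol I unfolding analytic_solution_on_def locally_analytic_def by blast
  obtain \<delta> where d: "\<delta> > 0" "\<And>t. \<bar>t - t\<^sub>0\<bar> < \<delta> \<Longrightarrow> t \<in> I"
    using open_realE[OF I] by blast
  define r' where "r' = min r \<delta>"
  have r': "r' > 0" "r' \<le> r" "r' \<le> \<delta>" using E d by (auto simp: r'_def expansion_at_def)
  have E': "expansion_at r' \<sigma> K c u t\<^sub>0" by (rule expansion_shrink[OF E r'(1,2)])
  have inI: "\<And>t. \<bar>t - t\<^sub>0\<bar> < r' \<Longrightarrow> t \<in> I" using d(2) r'(3) by auto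
  have rec: "euler_recursion c"
    by (rule expansion_recursion[OF E']) (use inI sol in \<open>auto simp: analytic_solution_on_def\<close>)
  have "c 0 \<in> Asp" using expansion_at_centre[OF E'] sol I by (simp add: analytic_solution_on_def)
  from euler_recursion_Asp[OF rec this] show ?thesis using that[OF E' rec] inI by blast
qed

lemma analytic_solution_imp_A_solution:
  assumes sol: "analytic_solution_on (time_dom Tm Tp) u" and T: "0 < Tm" "0 < Tp"
  shows "A_solution (u 0) Tm Tp u"
  unfolding A_solution_def
proof (intro conjI T refl ballI)
  show "u t \<in> Asp" if "t \<in> time_dom Tm Tp" for t using sol that by (simp add: analytic_solution_on_def)
  show "A_real_analytic_on (time_dom Tm Tp) u"
    unfolding A_real_analytic_on_def
  proof
    fix t0 assume t0: "t0 \<in> time_dom Tm Tp"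
    obtain r \<sigma> K c where E: "expansion_at r \<sigma> K c u t0" and c: "\<And>i. c i \<in> Asp"
      using analytic_solution_recursion[OF sol open_time_dom t0] by metis
    show "\<exists>e>0. \<exists>a. (\<forall>j. a j \<in> Asp) \<and> (\<forall>t\<in>time_dom Tm Tp. \<bar>t - t0\<bar> < e \<longrightarrow>
           limitin A_topology (power_partial_sum a (t - t0)) (u t) sequentially)"
    proof (intro exI[of _ r] exI[of _ c] conjI ballI allI impI c)
      show "r > 0" using E by (simp add: expansion_at_def)
      fix t assume t: "t \<in> time_dom Tm Tp" "\<bar>t - t0\<bar> < r"
      let ?y = "\<bar>t - t0\<bar> / r"
      show "limitin A_topology (power_partial_sum c (t - t0)) (u t) sequentially"
      proof (rule limitin_A_I[where \<sigma> = \<sigma> and \<epsilon> = "\<lambda>N. K * ?y ^ N / (1 - ?y)"])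
        show "u t \<in> Asp" using sol t by (simp add: analytic_solution_on_def)
        show "\<sigma> > 0" using E by (simp add: expansion_at_def)
        show "\<forall>\<^sub>F x in sequentially. power_partial_sum c (t - t0) x \<in> Asp"
          by (simp add: power_partial_sum_Asp[OF c])
        show "\<forall>\<^sub>F N in sequentially. exp_decay (K * ?y ^ N / (1 - ?y)) \<sigma> (lincomb 1 (power_partial_sum c (t - t0) N) (- 1) (u t))"
          unfolding exp_decay_def lincomb_def power_partial_sum_def
          using expansion_tail[OF E t(2)] by (simp add: norm_minus_commute)
        have "(\<lambda>N. ?y ^ N) \<longlonglongrightarrow> 0" using expansion_ratio[OF E t(2)] by (intro LIMSEQ_power_zero) simp
        then have "(\<lambda>N. K * ?y ^ N / (1 - ?y)) \<longlonglongrightarrow> K * 0 / (1 - ?y)"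
          by (intro tendsto_divide tendsto_mult tendsto_const) (use expansion_ratio[OF E t(2)] in auto)
        then show "(\<lambda>N. K * ?y ^ N / (1 - ?y)) \<longlonglongrightarrow> 0" by simp
      qed
    qed
  qed
  fix t assume t: "t \<in> time_dom Tm Tp"
  obtain r \<sigma> K c where E: "expansion_at r \<sigma> K c u t" and c: "\<And>i. c i \<in> Asp" and rec: "euler_recursion c"
    and inI: "\<And>s. \<bar>s - t\<bar> < r \<Longrightarrow> s \<in> time_dom Tm Tp"
    using analytic_solution_recursion[OF sol open_time_dom t] by metis
  have r: "r > 0" using E by (simp add: expansion_at_def)
  have c1: "c 1 = euler_P (u t) (u t)"
    using rec expansion_at_centre[OF E] unfolding euler_recursion_def by (auto dest: spec[of _ 0])
  have K: "K \<ge> 0" by (rule expansion_K[OF E])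
  show "A_has_derivative u (euler_P (u t) (u t)) t"
    unfolding A_has_derivative_def c1[symmetric]
  \<comment> \<open>The difference quotient minus \<open>c 1\<close> is the Taylor remainder of
    order 2 divided by \<open>h\<close>. The factor 2 bounds 1/(1 - |h|/r) for |h| < r/2.\<close>
  proof (rule limitin_A_I[where \<sigma> = \<sigma> and \<epsilon> = "\<lambda>h. 2 * K / r\<^sup>2 * \<bar>h\<bar>"])
    show "c 1 \<in> Asp" by (rule c)
    show "\<sigma> > 0" using E by (simp add: expansion_at_def)
    have ev: "\<forall>\<^sub>F h in at 0. h \<noteq> 0 \<and> \<bar>h\<bar> < r / 2"
      unfolding eventually_at using r by (intro exI[of _ "r / 2"]) (auto simp: dist_real_def)
    show "\<forall>\<^sub>F h in at 0. lincomb (1 / h) (u (t + h)) (- 1 / h) (u t) \<in> Asp"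
      using ev
    proof (rule eventually_mono)
      fix h assume "h \<noteq> 0 \<and> \<bar>h\<bar> < r / 2"
      then have "t + h \<in> time_dom Tm Tp" using r by (intro inI) auto
      then show "lincomb (1 / h) (u (t + h)) (- 1 / h) (u t) \<in> Asp"
        using sol t by (intro Asp_lincomb) (auto simp: analytic_solution_on_def)
    qed
    show "\<forall>\<^sub>F h in at 0. exp_decay (2 * K / r\<^sup>2 * \<bar>h\<bar>) \<sigma> (lincomb 1 (lincomb (1 / h) (u (t + h)) (- 1 / h) (u t)) (- 1) (c 1))"
      using ev
    proof (rule eventually_mono)
      fix h assume h: "h \<noteq> 0 \<and> \<bar>h\<bar> < r / 2"
      then have hr: "\<bar>t + h - t\<bar> < r" using r by simp
      show "exp_decay (2 * K / r\<^sup>2 * \<bar>h\<bar>) \<sigma> (lincomb 1 (lincomb (1 / h) (u (t + h)) (- 1 / h) (u t)) (- 1) (c 1))"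
        unfolding exp_decay_def
      proof
        fix k
        have tail: "1 / \<bar>h\<bar> * norm (u (t + h) k - (\<Sum>i<2. (t + h - t) ^ i *\<^sub>R c i k))
            \<le> 1 / \<bar>h\<bar> * (K * (\<bar>h\<bar> / r) ^ 2 / (1 - \<bar>h\<bar> / r) * exp (- \<sigma> * freq_l1 k))"
          using expansion_tail[OF E hr, of k 2] by (intro mult_left_mono) auto
        have "lincomb 1 (lincomb (1 / h) (u (t + h)) (- 1 / h) (u t)) (- 1) (c 1) k
           = (1 / h) *\<^sub>R (u (t + h) k - (\<Sum>i<2. (t + h - t) ^ i *\<^sub>R c i k))"
          using h expansion_at_centre[OF E]
          by (simp add: lincomb_def numeral_2_eq_2 scaleR_diff_right scaleR_add_right)
        then have "norm (lincomb 1 (lincomb (1 / h) (u (t + h)) (- 1 / h) (u t)) (- 1) (c 1) k)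
           \<le> (1 / \<bar>h\<bar>) * (K * (\<bar>h\<bar> / r) ^ 2 / (1 - \<bar>h\<bar> / r) * exp (- \<sigma> * freq_l1 k))"
          using tail by (simp add: mult_left_mono)
        also have "\<dots> \<le> (1 / \<bar>h\<bar>) * (K * (\<bar>h\<bar> / r) ^ 2 / (1 / 2) * exp (- \<sigma> * freq_l1 k))"
          using h r K by (intro mult_left_mono mult_right_mono divide_left_mono) (auto simp: field_simps)
        also have "\<dots> = 2 * K / r\<^sup>2 * \<bar>h\<bar> * exp (- \<sigma> * freq_l1 k)"
        proof -
          have "1 / a * (K * (a / r) ^ 2 / (1 / 2) * e) = 2 * K / r\<^sup>2 * a * e" if "a \<noteq> 0" for a e
            using that by (simp add: power2_eq_square)
          then show ?thesis using h by simp
        qed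
        finally show "norm (lincomb 1 (lincomb (1 / h) (u (t + h)) (- 1 / h) (u t)) (- 1) (c 1) k)
           \<le> 2 * K / r\<^sup>2 * \<bar>h\<bar> * exp (- \<sigma> * freq_l1 k)" .
      qed
    qed
    have "((\<lambda>h. 2 * K / r\<^sup>2 * \<bar>h\<bar>) \<longlongrightarrow> 2 * K / r\<^sup>2 * \<bar>0\<bar>) (at 0)" by (intro tendsto_intros)
    then show "((\<lambda>h. 2 * K / r\<^sup>2 * \<bar>h\<bar>) \<longlongrightarrow> 0) (at 0)" by simp
  qed
qed

section \<open>Propagation of analyticity\<close>

subsection \<open>Inequalities for sums over the lattice\<close>

lemma infsum_Cauchy_Schwarz:
  fixes x y :: "'a \<Rightarrow> real"
  assumes x: "(\<lambda>i. (x i)\<^sup>2) summable_on A" "\<And>i. 0 \<le> x i"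
    and y: "(\<lambda>i. (y i)\<^sup>2) summable_on A" "\<And>i. 0 \<le> y i"
  shows "(\<lambda>i. x i * y i) summable_on A"
    and "(\<Sum>\<^sub>\<infinity>i\<in>A. x i * y i) \<le> sqrt (\<Sum>\<^sub>\<infinity>i\<in>A. (x i)\<^sup>2) * sqrt (\<Sum>\<^sub>\<infinity>i\<in>A. (y i)\<^sup>2)"
proof -
  have le: "x i * y i \<le> (x i)\<^sup>2 + (y i)\<^sup>2" for i
    using sum_squares_bound[of "x i" "y i"] mult_nonneg_nonneg[OF x(2)[of i] y(2)[of i]] by linarith
  show s: "(\<lambda>i. x i * y i) summable_on A"
    by (rule summable_on_comparison_test[OF summable_on_add[OF x(1) y(1)] le]) (use x y in simp)
  show "(\<Sum>\<^sub>\<infinity>i\<in>A. x i * y i) \<le> sqrt (\<Sum>\<^sub>\<infinity>i\<in>A. (x i)\<^sup>2) * sqrt (\<Sum>\<^sub>\<infinity>i\<in>A. (y i)\<^sup>2)"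
  proof (rule infsum_le_finite_sums[OF s])
    fix F assume F: "finite F" "F \<subseteq> A"
    have "(\<Sum>i\<in>F. x i * y i) = (\<Sum>i\<in>F. \<bar>x i\<bar> * \<bar>y i\<bar>)" using x y by simp
    also have "\<dots> \<le> L2_set x F * L2_set y F" by (rule L2_set_mult_ineq)
    also have "\<dots> \<le> sqrt (\<Sum>\<^sub>\<infinity>i\<in>A. (x i)\<^sup>2) * sqrt (\<Sum>\<^sub>\<infinity>i\<in>A. (y i)\<^sup>2)"
      unfolding L2_set_def using F x y
      by (intro mult_mono real_sqrt_le_mono finite_sum_le_infsum) (auto intro!: sum_nonneg infsum_nonneg)
    finally show "(\<Sum>i\<in>F. x i * y i) \<le> sqrt (\<Sum>\<^sub>\<infinity>i\<in>A. (x i)\<^sup>2) * sqrt (\<Sum>\<^sub>\<infinity>i\<in>A. (y i)\<^sup>2)" .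
  qed
qed

definition l2 :: "(freq \<Rightarrow> real) \<Rightarrow> real" where
  "l2 f = sqrt (\<Sum>\<^sub>\<infinity>k. (f k)\<^sup>2)"

lemma l2_nonneg [simp]: "0 \<le> l2 f"
  unfolding l2_def by (simp add: infsum_nonneg)

text \<open>For fixed \<open>h\<close>, Cauchy-Schwarz in \<open>k\<close> with the translate of
  \<open>\<gamma>\<close>, whose l2 norm does not depend on \<open>h\<close>; then summation against
  \<open>\<beta>\<close> in l1.\<close>

lemma young_trilinear:
  fixes \<alpha> \<beta> \<gamma> :: "freq \<Rightarrow> real"
  assumes a: "(\<lambda>k. (\<alpha> k)\<^sup>2) summable_on UNIV" "\<And>k. 0 \<le> \<alpha> k"
    and b: "\<beta> summable_on UNIV" "\<And>k. 0 \<le> \<beta> k"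
    and c: "(\<lambda>k. (\<gamma> k)\<^sup>2) summable_on UNIV" "\<And>k. 0 \<le> \<gamma> k"
  shows "(\<lambda>(k, h). \<alpha> k * \<beta> h * \<gamma> (k - h)) summable_on UNIV"
    and "(\<Sum>\<^sub>\<infinity>(k, h). \<alpha> k * \<beta> h * \<gamma> (k - h)) \<le> l2 \<alpha> * infsum \<beta> UNIV * l2 \<gamma>"
proof -
  let ?f = "\<lambda>(h, k). \<alpha> k * \<beta> h * \<gamma> (k - h)"
  have ch: "(\<lambda>k. (\<gamma> (k - h))\<^sup>2) summable_on UNIV" "(\<Sum>\<^sub>\<infinity>k. (\<gamma> (k - h))\<^sup>2) = (\<Sum>\<^sub>\<infinity>k. (\<gamma> k)\<^sup>2)" for h
    using summable_on_freq_translate[of "\<lambda>k. (\<gamma> k)\<^sup>2" h] c(1) by auto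
  have s: "(\<lambda>k. \<alpha> k * \<gamma> (k - h)) summable_on UNIV" and
    le: "(\<Sum>\<^sub>\<infinity>k. \<alpha> k * \<gamma> (k - h)) \<le> l2 \<alpha> * l2 \<gamma>" for h
    using infsum_Cauchy_Schwarz[OF a ch(1) c(2), of h] unfolding ch(2) l2_def by auto
  have hs: "((\<lambda>k. \<alpha> k * \<beta> h * \<gamma> (k - h)) has_sum \<beta> h * (\<Sum>\<^sub>\<infinity>k. \<alpha> k * \<gamma> (k - h))) UNIV" for h
    using has_sum_cmult_right[OF has_sum_infsum[OF s], of "\<beta> h" h] by (simp add: mult_ac)
  have bl: "\<beta> h * (\<Sum>\<^sub>\<infinity>k. \<alpha> k * \<gamma> (k - h)) \<le> \<beta> h * (l2 \<alpha> * l2 \<gamma>)" for h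
    by (rule mult_left_mono[OF le b(2)])
  have nn: "0 \<le> \<beta> h * (\<Sum>\<^sub>\<infinity>k. \<alpha> k * \<gamma> (k - h))" for h
    using a b c by (auto intro!: mult_nonneg_nonneg infsum_nonneg)
  have g: "(\<lambda>h. \<beta> h * (\<Sum>\<^sub>\<infinity>k. \<alpha> k * \<gamma> (k - h))) summable_on UNIV"
    by (rule summable_on_comparison_test[OF summable_on_cmult_left[OF b(1)] bl nn])
  have f: "?f summable_on UNIV \<times> UNIV"
    by (rule summable_on_SigmaI[OF _ g]) (use hs a b c in auto)
  then have f2: "(\<lambda>(k, h). \<alpha> k * \<beta> h * \<gamma> (k - h)) summable_on UNIV \<times> UNIV"
    by (subst summable_on_reindex_bij_witness[where i = prod.swap and j = prod.swap
          and T = "UNIV \<times> UNIV" and h = ?f]) auto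
  then show "(\<lambda>(k, h). \<alpha> k * \<beta> h * \<gamma> (k - h)) summable_on UNIV" by simp
  have "(\<Sum>\<^sub>\<infinity>(k, h). \<alpha> k * \<beta> h * \<gamma> (k - h)) = infsum ?f UNIV"
    by (rule infsum_reindex_bij_witness[where i = prod.swap and j = prod.swap]) auto
  also have "\<dots> = (\<Sum>\<^sub>\<infinity>h. \<Sum>\<^sub>\<infinity>k. \<alpha> k * \<beta> h * \<gamma> (k - h))"
    using infsum_Sigma_banach[OF f] by simp
  also have "\<dots> = (\<Sum>\<^sub>\<infinity>h. \<beta> h * (\<Sum>\<^sub>\<infinity>k. \<alpha> k * \<gamma> (k - h)))"
    by (rule infsum_cong) (rule infsumI[OF hs])
  also have "\<dots> \<le> (\<Sum>\<^sub>\<infinity>h. \<beta> h * (l2 \<alpha> * l2 \<gamma>))"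
    by (rule infsum_mono[OF g summable_on_cmult_left[OF b(1)] bl])
  finally show "(\<Sum>\<^sub>\<infinity>(k, h). \<alpha> k * \<beta> h * \<gamma> (k - h)) \<le> l2 \<alpha> * infsum \<beta> UNIV * l2 \<gamma>"
    by (simp only: infsum_cmult_left') (simp add: mult_ac)
qed

lemma young_trilinear':
  fixes \<alpha> \<beta> \<gamma> :: "freq \<Rightarrow> real"
  assumes a: "(\<lambda>k. (\<alpha> k)\<^sup>2) summable_on UNIV" "\<And>k. 0 \<le> \<alpha> k"
    and c: "(\<lambda>k. (\<gamma> k)\<^sup>2) summable_on UNIV" "\<And>k. 0 \<le> \<gamma> k"
    and b: "\<beta> summable_on UNIV" "\<And>k. 0 \<le> \<beta> k"
  shows "(\<lambda>(k, h). \<alpha> k * \<gamma> h * \<beta> (k - h)) summable_on UNIV"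
    and "(\<Sum>\<^sub>\<infinity>(k, h). \<alpha> k * \<gamma> h * \<beta> (k - h)) \<le> l2 \<alpha> * l2 \<gamma> * infsum \<beta> UNIV"
proof -
  let ?i = "\<lambda>(k, h). (k, k - h) :: freq \<times> freq"
  have "(\<lambda>(k, h). \<alpha> k * \<gamma> h * \<beta> (k - h)) summable_on UNIV \<longleftrightarrow> (\<lambda>(k, h). \<alpha> k * \<beta> h * \<gamma> (k - h)) summable_on UNIV"
    by (rule summable_on_reindex_bij_witness[where i = ?i and j = ?i]) auto
  then show "(\<lambda>(k, h). \<alpha> k * \<gamma> h * \<beta> (k - h)) summable_on UNIV" using young_trilinear(1)[OF a b c] by simp
  have "(\<Sum>\<^sub>\<infinity>(k, h). \<alpha> k * \<gamma> h * \<beta> (k - h)) = (\<Sum>\<^sub>\<infinity>(k, h). \<alpha> k * \<beta> h * \<gamma> (k - h))"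
    by (rule infsum_reindex_bij_witness[where i = ?i and j = ?i]) auto
  then show "(\<Sum>\<^sub>\<infinity>(k, h). \<alpha> k * \<gamma> h * \<beta> (k - h)) \<le> l2 \<alpha> * l2 \<gamma> * infsum \<beta> UNIV"
    using young_trilinear(2)[OF a b c] by (simp add: mult_ac)
qed

text \<open>The l2 norm of |k|^(-(r-1)), that is, the constant by which |k|^r f in l2 controls |k| f
  in l1. The sum converges when 2(r-1) > 3, which is the threshold r > 5/2.\<close>

definition sobolev_const :: "real \<Rightarrow> real" where
  "sobolev_const r = sqrt (\<Sum>\<^sub>\<infinity>k. freq_norm k powr (- (2 * (r - 1))))"

lemma sobolev_const_nonneg [simp]: "0 \<le> sobolev_const r"
  unfolding sobolev_const_def by (simp add: infsum_nonneg)

lemma l1_le_l2: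
  fixes f :: "freq \<Rightarrow> real"
  assumes r: "r > 5 / 2" and f: "(\<lambda>k. (freq_norm k powr r * f k)\<^sup>2) summable_on UNIV" "\<And>k. 0 \<le> f k"
  shows "(\<lambda>k. freq_norm k * f k) summable_on UNIV"
    and "(\<Sum>\<^sub>\<infinity>k. freq_norm k * f k) \<le> sobolev_const r * l2 (\<lambda>k. freq_norm k powr r * f k)"
proof -
  have sq: "(freq_norm k powr (- (r - 1)))\<^sup>2 = freq_norm k powr (- (2 * (r - 1)))" for k
    by (simp add: power2_eq_square powr_add[symmetric])
  have s: "(\<lambda>k. (freq_norm k powr (- (r - 1)))\<^sup>2) summable_on UNIV"
    unfolding sq by (rule summable_on_freq_norm_powr) (use r in simp)
  have e: "freq_norm k powr (- (r - 1)) * (freq_norm k powr r * f k) = freq_norm k * f k" for k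
  proof (cases "k = 0")
    case False
    then have "freq_norm k > 0" using freq_norm_ge_1[OF False] by simp
    then have "freq_norm k powr (- (r - 1)) * freq_norm k powr r = freq_norm k"
      by (simp add: powr_add[symmetric])
    then show ?thesis by (simp add: mult.assoc[symmetric])
  qed simp
  show "(\<lambda>k. freq_norm k * f k) summable_on UNIV"
    using infsum_Cauchy_Schwarz(1)[OF s _ f(1)] f(2) unfolding e by simp
  show "(\<Sum>\<^sub>\<infinity>k. freq_norm k * f k) \<le> sobolev_const r * l2 (\<lambda>k. freq_norm k powr r * f k)"
    using infsum_Cauchy_Schwarz(2)[OF s _ f(1)] f(2) unfolding e sq l2_def sobolev_const_def by simp
qed

subsection \<open>The truncated Gevrey weight\<close>

definition gevrey :: "real \<Rightarrow> real \<Rightarrow> real \<Rightarrow> real \<Rightarrow> real" where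
  "gevrey r N \<sigma> a = a powr r * exp (\<sigma> * min a N)"

lemma powr_diff_le:
  fixes x y r :: real
  assumes "0 \<le> x" "x \<le> y" "r \<ge> 1"
  shows "y powr r - x powr r \<le> r * (y - x) * y powr (r - 1)"
proof -
  consider "x = y" | "x = 0" "x < y" | "0 < x" "x < y" using assms by linarith
  then show ?thesis
  proof cases
    case 2
    then have "y powr r = y * y powr (r - 1)" using powr_mult_base[of y "r - 1"] by simp
    also have "\<dots> \<le> r * (y * y powr (r - 1))"
      using mult_right_mono[OF assms(3), of "y * y powr (r - 1)"] 2 by simp
    finally show ?thesis using 2 by (simp add: mult_ac)
  next
    case 3
    have "\<exists>z>x. z < y \<and> y powr r - x powr r = (y - x) * (r * z powr (r - 1))"
    proof (rule MVT2[OF 3(2)])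
      fix z assume "x \<le> z" "z \<le> y"
      then show "((\<lambda>z. z powr r) has_real_derivative r * z powr (r - 1)) (at z)"
        using 3 by (intro has_real_derivative_powr) auto
    qed
    then obtain z where z: "x < z" "z < y" "y powr r - x powr r = (y - x) * (r * z powr (r - 1))" by blast
    have "z powr (r - 1) \<le> y powr (r - 1)" using z 3 assms by (intro powr_mono2) auto
    then have "(y - x) * (r * z powr (r - 1)) \<le> (y - x) * (r * y powr (r - 1))"
      using 3 assms by (intro mult_left_mono) auto
    then show ?thesis using z(3) by (simp add: mult_ac)
  qed simp
qed

lemma powr_add_le:
  fixes b c p :: real
  assumes "0 \<le> b" "0 \<le> c" "p \<ge> 0"
  shows "(b + c) powr p \<le> 2 powr p * (b powr p + c powr p)"
proof -
  have "(b + c) powr p \<le> (2 * max b c) powr p" using assms by (intro powr_mono2) auto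
  also have "\<dots> = 2 powr p * max b c powr p" using assms by (simp add: powr_mult)
  also have "max b c powr p \<le> b powr p + c powr p" by (simp add: max_def)
  finally show ?thesis by simp
qed

text \<open>The difference gives \<open>c\<close> times the power r-1 of max a b \<le> b + c, and
  \<open>min a b \<le> b\<close> supplies one more factor \<open>b\<close>. As a result no single
  frequency on the right carries more than the power \<open>r\<close>: the derivative falls on the
  other factor.\<close>

lemma powr_diff_commutator:
  fixes a b c r :: real
  assumes abc: "0 \<le> a" "0 \<le> b" "0 \<le> c" "a \<le> b + c" "b \<le> a + c" and r: "r \<ge> 1"
  shows "\<bar>a powr r - b powr r\<bar> * min a b \<le> r * 2 powr r * (c * b powr r + c powr r * b)"
proof -
  have d: "\<bar>a powr r - b powr r\<bar> \<le> r * \<bar>a - b\<bar> * max a b powr (r - 1)"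
  proof (cases "a \<le> b")
    case True
    then have "a powr r \<le> b powr r" using abc r by (intro powr_mono2) auto
    then show ?thesis using powr_diff_le[of a b r] True abc r by (simp add: max_def)
  next
    case False
    then have "b powr r \<le> a powr r" using abc r by (intro powr_mono2) auto
    then show ?thesis using powr_diff_le[of b a r] False abc r by (simp add: max_def)
  qed
  also have "\<dots> \<le> r * c * (2 powr r * (b powr (r - 1) + c powr (r - 1)))"
  proof (intro mult_mono)
    show "\<bar>a - b\<bar> \<le> c" using abc by linarith
    have "max a b powr (r - 1) \<le> (b + c) powr (r - 1)" using abc r by (intro powr_mono2) auto
    also have "\<dots> \<le> 2 powr (r - 1) * (b powr (r - 1) + c powr (r - 1))"
      using abc r by (intro powr_add_le) auto
    also have "\<dots> \<le> 2 powr r * (b powr (r - 1) + c powr (r - 1))"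
      by (intro mult_right_mono powr_mono) auto
    finally show "max a b powr (r - 1) \<le> 2 powr r * (b powr (r - 1) + c powr (r - 1))" .
  qed (use abc r in auto)
  finally have "\<bar>a powr r - b powr r\<bar> * min a b \<le> r * c * (2 powr r * (b powr (r - 1) + c powr (r - 1))) * b"
    using abc r by (intro mult_mono) auto
  also have "\<dots> = r * 2 powr r * (c * (b * b powr (r - 1)) + (c * c powr (r - 1)) * b)"
    by (simp add: algebra_simps)
  also have "b * b powr (r - 1) = b powr r" using powr_mult_base[OF abc(2), of "r - 1"] by simp
  also have "c * c powr (r - 1) = c powr r" using powr_mult_base[OF abc(3), of "r - 1"] by simp
  finally show ?thesis .
qed

lemma exp_diff_le:
  fixes x y m :: real
  assumes "x \<le> m" "y \<le> m"
  shows "\<bar>exp x - exp y\<bar> \<le> \<bar>x - y\<bar> * exp m"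
proof -
  have *: "exp y - exp x \<le> (y - x) * exp m" if "x \<le> y" "y \<le> m" for x y
  proof -
    have "exp y - exp x = exp y * (1 - exp (x - y))" by (simp add: exp_diff right_diff_distrib)
    also have "\<dots> \<le> exp y * (y - x)"
    proof (rule mult_left_mono)
      show "1 - exp (x - y) \<le> y - x" using exp_ge_add_one_self[of "x - y"] by linarith
    qed simp
    also have "\<dots> \<le> exp m * (y - x)" using that by (intro mult_right_mono) auto
    finally show ?thesis by (simp add: mult.commute)
  qed
  show ?thesis
  proof (cases "x \<le> y")
    case True
    then show ?thesis using *[of x y] assms by simp
  next
    case False
    then show ?thesis using *[of y x] assms by simp
  qed
qed

text \<open>
  The factor \<open>min a b\<close> is what incompressibility leaves of the derivative. Both bounds for
  \<open>min a b * |G a - G b|\<close>, with \<open>G x = min x N\<close>, are free of the truncation parameter.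
\<close>

lemma gevrey_commutator:
  fixes a b c r N \<sigma> :: real
  defines "G \<equiv> \<lambda>x. min x N"
  assumes abc: "0 \<le> a" "0 \<le> b" "0 \<le> c" "a \<le> b + c" "b \<le> a + c" "c \<le> a + b"
    and r: "r \<ge> 1" and s: "\<sigma> \<ge> 0" and N: "N \<ge> 0"
  shows "\<bar>gevrey r N \<sigma> a - gevrey r N \<sigma> b\<bar> * min a b \<le>
    \<sigma> * 2 powr r * (b powr r * c * (sqrt (G a) * sqrt (G b)) + c powr r * b * (sqrt (G c) * (sqrt (G a) + sqrt (G b))))
      * exp (\<sigma> * G b) * exp (\<sigma> * G c)
    + r * 2 powr r * (c * b powr r + c powr r * b) * exp (\<sigma> * G b)"
proof -
  have G0: "0 \<le> G a" "0 \<le> G b" "0 \<le> G c" using abc N by (auto simp: G_def)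
  have sub: "G a \<le> G b + G c" "G c \<le> G a + G b" "G b \<le> G b + G c" "\<bar>G a - G b\<bar> \<le> G c"
    using abc N by (auto simp: G_def min_def)
  \<comment> \<open>If both arguments are at least \<open>N\<close>, their truncations coincide and
    the left side is 0. Otherwise min a b is itself the smaller truncation, which is at most the
    geometric mean of \<open>G a\<close> and \<open>G b\<close>: half a derivative on each of two
    factors.\<close>
  have 1: "min a b * \<bar>G a - G b\<bar> \<le> c * (sqrt (G a) * sqrt (G b))"
  proof -
    have "min a b * \<bar>G a - G b\<bar> \<le> c * min (G a) (G b)"
    proof (cases "min a b \<ge> N")
      case True
      then have "G a = N" "G b = N" by (auto simp: G_def)
      then show ?thesis using abc N by simp
    next
      case False
      moreover have "min (G a) (G b) = min (min a b) N" unfolding G_def min_def by auto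
      ultimately have "min a b = min (G a) (G b)" using False by (simp only: min.absorb1 linorder_not_le less_imp_le)
      moreover have "\<bar>G a - G b\<bar> \<le> c" using sub(4) by (simp add: G_def)
      ultimately show ?thesis using G0 by (metis min.boundedI mult.commute mult_left_mono)
    qed
    also have "min (G a) (G b) \<le> sqrt (G a) * sqrt (G b)"
    proof -
      have "min (G a) (G b) = sqrt (min (G a) (G b)) * sqrt (min (G a) (G b))" using G0 by simp
      also have "\<dots> \<le> sqrt (G a) * sqrt (G b)" using G0 by (intro mult_mono) auto
      finally show ?thesis .
    qed
    finally show ?thesis using abc by (simp add: mult_left_mono)
  qed
  \<comment> \<open>Intended for the term in which \<open>c\<close> carries the power
    \<open>r\<close>: one square root of \<open>G c\<close> stays with \<open>c\<close>, the other
    is passed to \<open>a\<close> and \<open>b\<close> through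
    \<open>G c \<le> G a + G b\<close>.\<close>
  have 2: "min a b * \<bar>G a - G b\<bar> \<le> b * (sqrt (G c) * (sqrt (G a) + sqrt (G b)))"
  proof -
    have "sqrt (G c) \<le> sqrt (G a + G b)" using sub by simp
    also have "\<dots> \<le> sqrt (G a) + sqrt (G b)" using G0(1,2) by (rule sqrt_add_le_add_sqrt)
    finally have "sqrt (G c) * sqrt (G c) \<le> sqrt (G c) * (sqrt (G a) + sqrt (G b))"
      using G0 by (intro mult_left_mono) auto
    then have "\<bar>G a - G b\<bar> \<le> sqrt (G c) * (sqrt (G a) + sqrt (G b))" using sub(4) G0 by simp
    then show ?thesis using abc by (intro mult_mono) auto
  qed
  have "gevrey r N \<sigma> a - gevrey r N \<sigma> b =
      a powr r * (exp (\<sigma> * G a) - exp (\<sigma> * G b)) + (a powr r - b powr r) * exp (\<sigma> * G b)"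
    by (simp add: gevrey_def G_def algebra_simps)
  then have "\<bar>gevrey r N \<sigma> a - gevrey r N \<sigma> b\<bar> \<le>
      a powr r * \<bar>exp (\<sigma> * G a) - exp (\<sigma> * G b)\<bar> + \<bar>a powr r - b powr r\<bar> * exp (\<sigma> * G b)"
    by (simp only:) (rule order_trans[OF abs_triangle_ineq], simp add: abs_mult)
  then have "\<bar>gevrey r N \<sigma> a - gevrey r N \<sigma> b\<bar> * min a b \<le>
      (a powr r * \<bar>exp (\<sigma> * G a) - exp (\<sigma> * G b)\<bar> + \<bar>a powr r - b powr r\<bar> * exp (\<sigma> * G b)) * min a b"
    using abc by (intro mult_right_mono) auto
  also have "\<dots> = a powr r * (\<bar>exp (\<sigma> * G a) - exp (\<sigma> * G b)\<bar> * min a b)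
      + (\<bar>a powr r - b powr r\<bar> * min a b) * exp (\<sigma> * G b)"
    by (simp add: algebra_simps)
  also have "\<dots> \<le> \<sigma> * 2 powr r * (b powr r * c * (sqrt (G a) * sqrt (G b)) + c powr r * b * (sqrt (G c) * (sqrt (G a) + sqrt (G b))))
      * exp (\<sigma> * G b) * exp (\<sigma> * G c)
    + r * 2 powr r * (c * b powr r + c powr r * b) * exp (\<sigma> * G b)"
  proof (rule add_mono)
    show "(\<bar>a powr r - b powr r\<bar> * min a b) * exp (\<sigma> * G b) \<le> r * 2 powr r * (c * b powr r + c powr r * b) * exp (\<sigma> * G b)"
      by (intro mult_right_mono powr_diff_commutator abc r) auto
    let ?e = "exp (\<sigma> * G b) * exp (\<sigma> * G c)"
    let ?m = "min a b * \<bar>G a - G b\<bar>"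
    have m0: "0 \<le> ?m" using abc by simp
    have "\<bar>exp (\<sigma> * G a) - exp (\<sigma> * G b)\<bar> \<le> \<bar>\<sigma> * G a - \<sigma> * G b\<bar> * exp (\<sigma> * G b + \<sigma> * G c)"
      using mult_left_mono[OF sub(1) s] mult_left_mono[OF sub(3) s] by (intro exp_diff_le) (auto simp: distrib_left)
    also have "\<dots> = \<sigma> * \<bar>G a - G b\<bar> * ?e" using s by (simp add: right_diff_distrib[symmetric] abs_mult exp_add)
    finally have "\<bar>exp (\<sigma> * G a) - exp (\<sigma> * G b)\<bar> * min a b \<le> \<sigma> * \<bar>G a - G b\<bar> * ?e * min a b"
      using abc by (intro mult_right_mono) auto
    then have "a powr r * (\<bar>exp (\<sigma> * G a) - exp (\<sigma> * G b)\<bar> * min a b) \<le> a powr r * (\<sigma> * \<bar>G a - G b\<bar> * ?e * min a b)"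
      by (intro mult_left_mono) auto
    also have "\<dots> = \<sigma> * ?e * (a powr r * ?m)" by (simp add: mult_ac)
    \<comment> \<open>After this splitting the first bound is used with \<open>b powr r\<close> and
      the second with \<open>c powr r\<close>, so that the high power is always accompanied by a
      square root on the same frequency.\<close>
    also have "a powr r * ?m \<le> (2 powr r * (b powr r + c powr r)) * ?m"
    proof (rule mult_right_mono[OF _ m0])
      have "a powr r \<le> (b + c) powr r" using abc r by (intro powr_mono2) auto
      also have "\<dots> \<le> 2 powr r * (b powr r + c powr r)" using abc r by (intro powr_add_le) auto
      finally show "a powr r \<le> 2 powr r * (b powr r + c powr r)" .
    qed
    also have "\<dots> = 2 powr r * (b powr r * ?m + c powr r * ?m)" by (simp add: algebra_simps)
    also have "\<dots> \<le> 2 powr r * (b powr r * (c * (sqrt (G a) * sqrt (G b))) + c powr r * (b * (sqrt (G c) * (sqrt (G a) + sqrt (G b)))))"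
      using 1 2 by (intro mult_left_mono add_mono) auto
    finally have "a powr r * (\<bar>exp (\<sigma> * G a) - exp (\<sigma> * G b)\<bar> * min a b)
       \<le> \<sigma> * ?e * (2 powr r * (b powr r * (c * (sqrt (G a) * sqrt (G b))) + c powr r * (b * (sqrt (G c) * (sqrt (G a) + sqrt (G b))))))"
      using s by (simp add: mult_left_mono)
    then show "a powr r * (\<bar>exp (\<sigma> * G a) - exp (\<sigma> * G b)\<bar> * min a b)
       \<le> \<sigma> * 2 powr r * (b powr r * c * (sqrt (G a) * sqrt (G b)) + c powr r * b * (sqrt (G c) * (sqrt (G a) + sqrt (G b))))
      * exp (\<sigma> * G b) * exp (\<sigma> * G c)"
      by (simp add: mult_ac)
  qed
  finally show ?thesis .
qed

subsection \<open>The energy estimate\<close>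

lemma inner_eq_cdot: "x \<bullet> y = Re (cdot (cnj_vec x) y)" for x y :: "complex ^ 3"
  by (simp add: inner_vec_def cdot_def cnj_vec_def inner_complex_def)

text \<open>The rate at which mode \<open>l\<close> feeds energy into mode \<open>k\<close>. The
  Leray projection is left out because pairing with the divergence free coefficient
  \<open>v k\<close> removes it, by \<open>inner_leray\<close>.\<close>

definition transfer :: "vfield \<Rightarrow> freq \<Rightarrow> freq \<Rightarrow> real" where
  "transfer v k l = v k \<bullet> ((- \<i> * cdot (v (k - l)) (freq_vec l)) *s v l)"

text \<open>Energy conservation in each pair of modes: the coefficient at k - l is orthogonal to k -
  l, so \<open>k\<close> and \<open>l\<close> may be exchanged in its product with a frequency; by
  the reality condition the exchange then conjugates both factors, while -i is not
  conjugated.\<close>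

lemma transfer_antisym:
  assumes v: "v \<in> Asp"
  shows "transfer v l k = - transfer v k l"
proof -
  have rf: "v (- k) = cnj_vec (v k)" and df: "cdot (freq_vec k) (v k) = 0" for k
    using v by (auto simp: Asp_iff real_field_iff mean_free_div_free_def)
  define \<alpha> where "\<alpha> = cdot (v (k - l)) (freq_vec l)"
  define \<beta> where "\<beta> = cdot (cnj_vec (v k)) (v l)"
  have vlk: "v (l - k) = cnj_vec (v (k - l))" using rf[of "k - l"] by simp
  have "freq_vec k = freq_vec l - freq_vec (l - k)" by (simp add: freq_vec_diff)
  then have "cdot (v (l - k)) (freq_vec k) = cdot (v (l - k)) (freq_vec l) - cdot (v (l - k)) (freq_vec (l - k))"
    by (simp only: cdot_diff_right)
  also have "cdot (v (l - k)) (freq_vec (l - k)) = 0" using df[of "l - k"] by (simp add: cdot_commute)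
  also have "cdot (v (l - k)) (freq_vec l) = cnj \<alpha>"
    unfolding vlk \<alpha>_def using cdot_cnj_vec[of "v (k - l)" "freq_vec l"] by simp
  finally have 1: "cdot (v (l - k)) (freq_vec k) = cnj \<alpha>" by simp
  have 2: "cdot (cnj_vec (v l)) (v k) = cnj \<beta>"
    unfolding \<beta>_def using cdot_cnj_vec[of "v l" "cnj_vec (v k)"] by (simp add: cdot_commute)
  have "transfer v l k = Re (- \<i> * cnj \<alpha> * cnj \<beta>)"
    unfolding transfer_def inner_eq_cdot cdot_smult_right 1 2 ..
  moreover have "transfer v k l = Re (- \<i> * \<alpha> * \<beta>)"
    unfolding transfer_def inner_eq_cdot cdot_smult_right \<alpha>_def \<beta>_def ..
  ultimately show ?thesis by simp
qed

lemma abs_transfer_le':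
  "\<bar>transfer v k l\<bar> \<le> norm (v k) * norm (v (k - l)) * norm (v l) * freq_norm l"
proof -
  have "\<bar>transfer v k l\<bar> \<le> norm (v k) * norm ((- \<i> * cdot (v (k - l)) (freq_vec l)) *s v l)"
    unfolding transfer_def by (rule Cauchy_Schwarz_ineq2)
  also have "\<dots> = norm (v k) * (norm (cdot (v (k - l)) (freq_vec l)) * norm (v l))"
    by (simp only: norm_vector_smult norm_mult) simp
  also have "\<dots> \<le> norm (v k) * ((norm (v (k - l)) * freq_norm l) * norm (v l))"
    using norm_cdot_le[of "v (k - l)" "freq_vec l"] by (intro mult_left_mono mult_right_mono) (auto simp: norm_freq_vec)
  finally show ?thesis by (simp add: mult_ac)
qed

text \<open>By antisymmetry the derivative may be placed on either mode, hence on the one of smaller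
  frequency.\<close>

lemma abs_transfer_le:
  assumes v: "v \<in> Asp"
  shows "\<bar>transfer v k l\<bar> \<le> norm (v k) * norm (v (k - l)) * norm (v l) * min (freq_norm k) (freq_norm l)"
proof -
  have "norm (v (l - k)) = norm (v (k - l))"
  proof -
    have "v (- (k - l)) = cnj_vec (v (k - l))" using v unfolding Asp_iff real_field_iff by blast
    moreover have "norm (cnj_vec x) = norm x" for x by (simp add: cnj_vec_def norm_vec_def)
    ultimately show ?thesis by simp
  qed
  then have "\<bar>transfer v k l\<bar> \<le> norm (v k) * norm (v (k - l)) * norm (v l) * freq_norm k"
    using abs_transfer_le'[of v l k] transfer_antisym[OF v, of l k] by (simp add: mult_ac)
  with abs_transfer_le'[of v k l] show ?thesis by (simp add: min_def)
qed

lemma inner_leray: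
  assumes "cdot (freq_vec k) x = 0"
  shows "x \<bullet> (c *s leray k b) = x \<bullet> (c *s b)"
proof (cases "k = 0")
  case False
  have z: "cdot (cnj_vec x) (freq_vec k) = 0"
    using assms cdot_cnj_vec[of x "freq_vec k"] by (simp add: cdot_commute)
  have "cdot (cnj_vec x) (leray k b) = cdot (cnj_vec x) b"
    using False by (simp add: leray_def cdot_diff_right cdot_smult_right z)
  then show ?thesis by (simp add: inner_eq_cdot cdot_smult_right)
qed (simp add: leray_def)

lemma inner_euler_P:
  assumes v: "v \<in> Asp"
  shows "((\<lambda>h. transfer v k (k - h)) has_sum v k \<bullet> euler_P v v k) UNIV"
proof -
  have df: "cdot (freq_vec k) (v k) = 0" using v by (auto simp: Asp_iff mean_free_div_free_def)
  have "((\<lambda>h. (- \<i>) *s (cdot (v h) (freq_vec (k - h)) *s leray k (v (k - h)))) has_sum (- \<i>) *s (\<i> *s euler_P v v k)) UNIV"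
    by (rule has_sum_bounded_linear[OF bounded_linear_smult_complex euler_P_sum[OF v v]])
  moreover have "(- \<i>) *s (\<i> *s euler_P v v k) = euler_P v v k" by (simp add: vector_smult_assoc)
  ultimately have "((\<lambda>h. (- \<i>) *s (cdot (v h) (freq_vec (k - h)) *s leray k (v (k - h)))) has_sum euler_P v v k) UNIV"
    by (simp only:)
  from has_sum_bounded_linear[OF bounded_linear_inner_right[of "v k"] this]
  have "((\<lambda>h. v k \<bullet> ((- \<i>) *s (cdot (v h) (freq_vec (k - h)) *s leray k (v (k - h))))) has_sum v k \<bullet> euler_P v v k) UNIV" .
  moreover have "v k \<bullet> ((- \<i>) *s (cdot (v h) (freq_vec (k - h)) *s leray k (v (k - h)))) = transfer v k (k - h)" for h
    unfolding vector_smult_assoc inner_leray[OF df] transfer_def by simp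
  ultimately show ?thesis by simp
qed

lemma exp_decay_weighted:
  assumes s: "\<sigma> > 0" and p: "p > 0"
  shows "\<exists>C\<ge>0. \<forall>K v. exp_decay K \<sigma> v \<longrightarrow> (\<forall>k. freq_norm k powr p * norm (v k) \<le> C * K * exp (- (\<sigma> / 2) * freq_l1 k))"
proof -
  have "\<sigma> / 2 > 0" using s by simp
  then obtain C where C: "C > 0" "\<And>x. x \<ge> 0 \<Longrightarrow> x powr p \<le> C * exp ((\<sigma> / 2) * x)"
    using powr_le_exp[OF _ p] by metis
  show ?thesis
  proof (intro exI[of _ C] conjI allI impI)
    fix K v k assume v: "exp_decay K \<sigma> v"
    have "freq_norm k powr p \<le> freq_l1 k powr p" using p by (intro powr_mono2 freq_norm_le_l1) auto
    also have "\<dots> \<le> C * exp ((\<sigma> / 2) * freq_l1 k)" by (rule C) simp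
    finally have "freq_norm k powr p * norm (v k) \<le> C * exp ((\<sigma> / 2) * freq_l1 k) * (K * exp (- \<sigma> * freq_l1 k))"
      using v C by (intro mult_mono) (auto simp: exp_decay_def)
    also have "\<dots> = C * K * (exp ((\<sigma> / 2) * freq_l1 k) * exp (- \<sigma> * freq_l1 k))" by simp
    also have "exp ((\<sigma> / 2) * freq_l1 k) * exp (- \<sigma> * freq_l1 k) = exp (- (\<sigma> / 2) * freq_l1 k)"
      by (simp add: exp_add[symmetric] algebra_simps)
    finally show "freq_norm k powr p * norm (v k) \<le> C * K * exp (- (\<sigma> / 2) * freq_l1 k)" .
  qed (use C in simp)
qed

lemma Asp_weighted_summable:
  assumes v: "v \<in> Asp" and p: "p > 0"
  shows "(\<lambda>k. freq_norm k powr p * norm (v k)) summable_on UNIV"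
    and "\<exists>B. \<forall>k. norm (v k) \<le> B"
proof -
  obtain K \<sigma> where d: "\<sigma> > 0" "exp_decay K \<sigma> v" using v by (auto simp: Asp_iff)
  obtain C where C: "\<forall>k. freq_norm k powr p * norm (v k) \<le> C * K * exp (- (\<sigma> / 2) * freq_l1 k)"
    using exp_decay_weighted[OF d(1) p] d(2) by blast
  show "(\<lambda>k. freq_norm k powr p * norm (v k)) summable_on UNIV"
    by (rule summable_on_comparison_test[OF summable_on_cmult_right[OF summable_on_exp_freq[of "\<sigma> / 2"], of "C * K"]])
      (use C d in auto)
  have "norm (v k) \<le> K" for k
  proof -
    have "norm (v k) \<le> K * exp (- \<sigma> * freq_l1 k)" using d by (simp add: exp_decay_def)
    also have "\<dots> \<le> K * 1" using d exp_decay_nonneg[OF d(2)] by (intro mult_left_mono) auto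
    finally show ?thesis by simp
  qed
  then show "\<exists>B. \<forall>k. norm (v k) \<le> B" by blast
qed

definition gevrey_energy :: "real \<Rightarrow> real \<Rightarrow> real \<Rightarrow> vfield \<Rightarrow> real" where
  "gevrey_energy r N \<sigma> v = (\<Sum>\<^sub>\<infinity>k. (gevrey r N \<sigma> (freq_norm k) * norm (v k))\<^sup>2)"

text \<open>Formally half the derivative of \<open>gevrey_energy\<close> with respect to
  \<open>\<sigma>\<close>; letting \<open>\<sigma>\<close> decrease in time turns it into
  damping.\<close>

definition gevrey_dissipation :: "real \<Rightarrow> real \<Rightarrow> real \<Rightarrow> vfield \<Rightarrow> real" where
  "gevrey_dissipation r N \<sigma> v = (\<Sum>\<^sub>\<infinity>k. min (freq_norm k) N * (gevrey r N \<sigma> (freq_norm k) * norm (v k))\<^sup>2)"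

lemma gevrey_le:
  assumes "\<sigma> \<ge> 0" "N \<ge> 0"
  shows "gevrey r N \<sigma> a \<le> exp (\<sigma> * N) * a powr r"
proof -
  have "\<sigma> * min a N \<le> \<sigma> * N" using assms by (intro mult_left_mono) auto
  then show ?thesis unfolding gevrey_def by (simp add: mult.commute mult_left_mono)
qed

lemma gevrey_nonneg [simp]: "0 \<le> gevrey r N \<sigma> a"
  by (simp add: gevrey_def)

lemma gevrey_summable:
  assumes v: "v \<in> Asp" and r: "r > 0" and s: "\<sigma> \<ge> 0" and N: "N \<ge> 0"
  shows "(\<lambda>k. (freq_norm k powr r * norm (v k))\<^sup>2) summable_on UNIV"
    and "(\<lambda>k. (gevrey r N \<sigma> (freq_norm k) * norm (v k))\<^sup>2) summable_on UNIV"
    and "(\<lambda>k. min (freq_norm k) N * (gevrey r N \<sigma> (freq_norm k) * norm (v k))\<^sup>2) summable_on UNIV"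
    and "(\<lambda>k. (gevrey r N \<sigma> (freq_norm k))\<^sup>2 * norm (v k)) summable_on UNIV"
proof -
  obtain B where B: "\<And>k. norm (v k) \<le> B" using Asp_weighted_summable(2)[OF v r] by blast
  have s2: "(\<lambda>k. freq_norm k powr (2 * r) * norm (v k)) summable_on UNIV"
    by (rule Asp_weighted_summable(1)[OF v]) (use r in simp)
  have pw: "(x powr r)\<^sup>2 = x powr (2 * r)" for x :: real by (simp add: power2_eq_square powr_add[symmetric])
  show 1: "(\<lambda>k. (freq_norm k powr r * norm (v k))\<^sup>2) summable_on UNIV"
  proof (rule summable_on_comparison_test[OF summable_on_cmult_left[OF s2, of B]])
    fix k
    have "(freq_norm k powr r * norm (v k))\<^sup>2 = freq_norm k powr (2 * r) * norm (v k) * norm (v k)"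
      unfolding power_mult_distrib pw by (simp add: power2_eq_square)
    also have "\<dots> \<le> freq_norm k powr (2 * r) * norm (v k) * B"
      by (intro mult_left_mono B) auto
    finally show "(freq_norm k powr r * norm (v k))\<^sup>2 \<le> freq_norm k powr (2 * r) * norm (v k) * B" .
  qed simp
  have g: "(gevrey r N \<sigma> (freq_norm k) * norm (v k))\<^sup>2 \<le> (exp (\<sigma> * N))\<^sup>2 * (freq_norm k powr r * norm (v k))\<^sup>2" for k
    unfolding power_mult_distrib[symmetric]
    using mult_right_mono[OF gevrey_le[OF s N], of "norm (v k)" r "freq_norm k"]
    by (intro power_mono) (auto simp: mult_ac)
  show 2: "(\<lambda>k. (gevrey r N \<sigma> (freq_norm k) * norm (v k))\<^sup>2) summable_on UNIV"
    by (rule summable_on_comparison_test[OF summable_on_cmult_right[OF 1] g]) simp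
  show "(\<lambda>k. min (freq_norm k) N * (gevrey r N \<sigma> (freq_norm k) * norm (v k))\<^sup>2) summable_on UNIV"
    by (rule summable_on_comparison_test[OF summable_on_cmult_right[OF 2, of N]])
      (use N in \<open>auto intro!: mult_right_mono\<close>)
  show "(\<lambda>k. (gevrey r N \<sigma> (freq_norm k))\<^sup>2 * norm (v k)) summable_on UNIV"
  proof (rule summable_on_comparison_test[OF summable_on_cmult_right[OF s2, of "(exp (\<sigma> * N))\<^sup>2"]])
    fix k
    have "(gevrey r N \<sigma> (freq_norm k))\<^sup>2 \<le> (exp (\<sigma> * N) * freq_norm k powr r)\<^sup>2"
      by (intro power_mono gevrey_le s N) auto
    then show "(gevrey r N \<sigma> (freq_norm k))\<^sup>2 * norm (v k) \<le> (exp (\<sigma> * N))\<^sup>2 * (freq_norm k powr (2 * r) * norm (v k))"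
      by (simp add: power_mult_distrib pw mult.assoc[symmetric] mult_right_mono)
  qed simp
qed

lemma Hnorm_eq_l2: "Hnorm r v = l2 (\<lambda>k. freq_norm k powr r * norm (v k))"
proof -
  have "(x powr r)\<^sup>2 = x powr (2 * r)" for x :: real by (simp add: power2_eq_square powr_add[symmetric])
  then show ?thesis unfolding Hnorm_def l2_def power_mult_distrib by simp
qed

lemma product_summable:
  fixes x :: "'a \<Rightarrow> real" and y :: "'b \<Rightarrow> real"
  assumes "x summable_on UNIV" "\<And>i. 0 \<le> x i" "y summable_on UNIV" "\<And>i. 0 \<le> y i"
  shows "(\<lambda>(i, j). x i * y j) summable_on UNIV"
proof -
  have "(\<lambda>(i, j). x i * y j) summable_on UNIV \<times> UNIV"
  proof (rule summable_on_SigmaI)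
    show "((\<lambda>j. case (i, j) of (i, j) \<Rightarrow> x i * y j) has_sum x i * infsum y UNIV) UNIV" for i
      using has_sum_cmult_right[OF has_sum_infsum[OF assms(3)], of "x i"] by simp
    show "(\<lambda>i. x i * infsum y UNIV) summable_on UNIV" by (rule summable_on_cmult_left[OF assms(1)])
  qed (use assms in auto)
  then show ?thesis by simp
qed

text \<open>The double sum with the symmetric weight \<open>\<phi> k * \<phi> l\<close> vanishes by
  antisymmetry of \<open>transfer\<close>. Subtracting it replaces the weight
  \<open>(\<phi> k)\<^sup>2\<close> by \<open>\<phi> k\<close> times a difference of weights. Both
  double families are absolutely summable because the truncated weight grows only like a
  power.\<close>

lemma energy_transfer:
  assumes v: "v \<in> Asp" and r: "r > 0" and s: "\<sigma> \<ge> 0" and N: "N \<ge> 0"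
  defines "\<phi> \<equiv> \<lambda>k. gevrey r N \<sigma> (freq_norm k)"
  shows "(\<lambda>k. (\<phi> k)\<^sup>2 * (v k \<bullet> euler_P v v k)) summable_on UNIV"
    and "(\<Sum>\<^sub>\<infinity>k. (\<phi> k)\<^sup>2 * (v k \<bullet> euler_P v v k)) = (\<Sum>\<^sub>\<infinity>(k, h). \<phi> k * (\<phi> k - \<phi> (k - h)) * transfer v k (k - h))"
    and "(\<lambda>(k, h). \<phi> k * (\<phi> k - \<phi> (k - h)) * transfer v k (k - h)) summable_on UNIV"
proof -
  obtain B where B: "\<And>k. norm (v k) \<le> B" using Asp_weighted_summable(2)[OF v r] by blast
  have B0: "B \<ge> 0" using B[of 0] norm_ge_zero order_trans by blast
  have s1: "(\<lambda>k. freq_norm k * norm (v k)) summable_on UNIV"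
    using Asp_weighted_summable(1)[OF v, of 1] by simp
  have s2: "(\<lambda>k. (\<phi> k)\<^sup>2 * norm (v k)) summable_on UNIV" unfolding \<phi>_def by (rule gevrey_summable(4)[OF v r s N])
  have s3: "(\<lambda>k. exp (\<sigma> * N) * (freq_norm k powr r * norm (v k))) summable_on UNIV"
    by (rule summable_on_cmult_right[OF Asp_weighted_summable(1)[OF v r]])
  have ph: "\<phi> k \<le> exp (\<sigma> * N) * freq_norm k powr r" for k unfolding \<phi>_def by (rule gevrey_le[OF s N])
  have p0: "0 \<le> \<phi> k" for k by (simp add: \<phi>_def)
  have s4: "(\<lambda>k. \<phi> k * norm (v k)) summable_on UNIV"
    by (rule summable_on_comparison_test[OF s3])
      (use mult_right_mono[OF ph norm_ge_zero] p0 in \<open>auto simp: mult.assoc\<close>)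
  have s5: "(\<lambda>k. exp (\<sigma> * N) * (freq_norm k powr (r + 1) * norm (v k))) summable_on UNIV"
    by (rule summable_on_cmult_right[OF Asp_weighted_summable(1)[OF v]]) (use r in simp)
  have s6: "(\<lambda>k. \<phi> k * freq_norm k * norm (v k)) summable_on UNIV"
  proof (rule summable_on_comparison_test[OF s5])
    fix k
    have "\<phi> k * (freq_norm k * norm (v k)) \<le> exp (\<sigma> * N) * freq_norm k powr r * (freq_norm k * norm (v k))"
      by (intro mult_right_mono ph) auto
    also have "\<dots> = exp (\<sigma> * N) * (freq_norm k powr (r + 1) * norm (v k))"
      using powr_mult_base[of "freq_norm k" r] by (simp add: mult_ac add.commute)
    finally show "\<phi> k * freq_norm k * norm (v k) \<le> exp (\<sigma> * N) * (freq_norm k powr (r + 1) * norm (v k))"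
      by (simp add: mult_ac)
  qed (use p0 in auto)
  have tb: "\<bar>transfer v k l\<bar> \<le> B * (norm (v k) * (freq_norm l * norm (v l)))" for k l
  proof -
    have "\<bar>transfer v k l\<bar> \<le> norm (v k) * norm (v (k - l)) * norm (v l) * freq_norm l" by (rule abs_transfer_le')
    also have "\<dots> \<le> norm (v k) * B * norm (v l) * freq_norm l"
      by (intro mult_right_mono mult_left_mono B) auto
    finally show ?thesis by (simp add: mult_ac)
  qed
  have A1: "(\<lambda>(k, l). (\<phi> k)\<^sup>2 * transfer v k l) summable_on UNIV"
  proof (rule abs_summable_summable[OF Infinite_Sum.abs_summable_on_comparison_test'])
    show "(\<lambda>(k, l). B * ((\<phi> k)\<^sup>2 * norm (v k)) * (freq_norm l * norm (v l))) summable_on UNIV"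
      by (rule product_summable[where x = "\<lambda>k. B * ((\<phi> k)\<^sup>2 * norm (v k))" and y = "\<lambda>l. freq_norm l * norm (v l)"])
        (use B0 in \<open>auto intro!: summable_on_cmult_right s2 s1\<close>)
    fix x :: "freq \<times> freq"
    show "norm (case x of (k, l) \<Rightarrow> (\<phi> k)\<^sup>2 * transfer v k l)
      \<le> (case x of (k, l) \<Rightarrow> B * ((\<phi> k)\<^sup>2 * norm (v k)) * (freq_norm l * norm (v l)))"
    proof (cases x)
      case (Pair k l)
      show ?thesis using mult_left_mono[OF tb, of "(\<phi> k)\<^sup>2" k l] by (simp add: Pair abs_mult mult_ac)
    qed
  qed
  have A2: "(\<lambda>(k, l). \<phi> k * \<phi> l * transfer v k l) summable_on UNIV"
  proof (rule abs_summable_summable[OF Infinite_Sum.abs_summable_on_comparison_test'])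
    show "(\<lambda>(k, l). B * (\<phi> k * norm (v k)) * (\<phi> l * freq_norm l * norm (v l))) summable_on UNIV"
      by (rule product_summable[where x = "\<lambda>k. B * (\<phi> k * norm (v k))" and y = "\<lambda>l. \<phi> l * freq_norm l * norm (v l)"])
        (use B0 p0 in \<open>auto intro!: summable_on_cmult_right s4 s6\<close>)
    fix x :: "freq \<times> freq"
    show "norm (case x of (k, l) \<Rightarrow> \<phi> k * \<phi> l * transfer v k l)
      \<le> (case x of (k, l) \<Rightarrow> B * (\<phi> k * norm (v k)) * (\<phi> l * freq_norm l * norm (v l)))"
    proof (cases x)
      case (Pair k l)
      show ?thesis using mult_left_mono[OF tb, of "\<phi> k * \<phi> l" k l] p0
        by (simp add: Pair abs_mult mult_ac)
    qed
  qed
  have Z: "(\<Sum>\<^sub>\<infinity>(k, l). \<phi> k * \<phi> l * transfer v k l) = 0"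
  proof -
    have "(\<Sum>\<^sub>\<infinity>(k, l). \<phi> k * \<phi> l * transfer v k l) = (\<Sum>\<^sub>\<infinity>(k, l). \<phi> k * \<phi> l * transfer v l k)"
      by (rule infsum_reindex_bij_witness[where i = prod.swap and j = prod.swap]) auto
    also have "\<dots> = (\<Sum>\<^sub>\<infinity>x. - (case x of (k, l) \<Rightarrow> \<phi> k * \<phi> l * transfer v k l))"
    proof (rule infsum_cong)
      fix x :: "freq \<times> freq"
      show "(case x of (k, l) \<Rightarrow> \<phi> k * \<phi> l * transfer v l k) = - (case x of (k, l) \<Rightarrow> \<phi> k * \<phi> l * transfer v k l)"
        using transfer_antisym[OF v, of "snd x" "fst x"] by (simp add: case_prod_unfold)
    qed
    also have "\<dots> = - (\<Sum>\<^sub>\<infinity>(k, l). \<phi> k * \<phi> l * transfer v k l)" by (rule infsum_uminus)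
    finally show ?thesis by simp
  qed
  have in1: "(\<Sum>\<^sub>\<infinity>l. (\<phi> k)\<^sup>2 * transfer v k l) = (\<phi> k)\<^sup>2 * (v k \<bullet> euler_P v v k)" for k
  proof -
    have "(\<Sum>\<^sub>\<infinity>l. transfer v k l) = (\<Sum>\<^sub>\<infinity>h. transfer v k (k - h))" by (rule summable_on_freq_shift(2)[symmetric])
    also have "\<dots> = v k \<bullet> euler_P v v k" by (rule infsumI[OF inner_euler_P[OF v]])
    finally show ?thesis by (simp add: infsum_cmult_right')
  qed
  show "(\<lambda>k. (\<phi> k)\<^sup>2 * (v k \<bullet> euler_P v v k)) summable_on UNIV"
    using summable_on_Sigma_banach[of "\<lambda>k l. (\<phi> k)\<^sup>2 * transfer v k l" UNIV "\<lambda>_. UNIV"] A1 by (simp add: in1)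
  have E: "(\<Sum>\<^sub>\<infinity>k. (\<phi> k)\<^sup>2 * (v k \<bullet> euler_P v v k)) = (\<Sum>\<^sub>\<infinity>(k, l). (\<phi> k)\<^sup>2 * transfer v k l)"
    using infsum_Sigma'_banach[of "\<lambda>k l. (\<phi> k)\<^sup>2 * transfer v k l" UNIV "\<lambda>_. UNIV"] A1 by (simp add: in1)
  define S where "S = (\<Sum>\<^sub>\<infinity>k. (\<phi> k)\<^sup>2 * (v k \<bullet> euler_P v v k))"
  have H1: "((\<lambda>(k, l). (\<phi> k)\<^sup>2 * transfer v k l) has_sum S) UNIV"
    using has_sum_infsum[OF A1] unfolding E[symmetric] S_def .
  have H2: "((\<lambda>(k, l). \<phi> k * \<phi> l * transfer v k l) has_sum 0) UNIV"
    using has_sum_infsum[OF A2] unfolding Z .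
  have H3: "((\<lambda>x. (case x of (k, l) \<Rightarrow> (\<phi> k)\<^sup>2 * transfer v k l) + - (case x of (k, l) \<Rightarrow> \<phi> k * \<phi> l * transfer v k l))
     has_sum S + - 0) UNIV"
    by (rule has_sum_add[OF H1 has_sum_uminusI[OF H2]])
  have "(\<lambda>x. (case x of (k, l) \<Rightarrow> (\<phi> k)\<^sup>2 * transfer v k l) + - (case x of (k, l) \<Rightarrow> \<phi> k * \<phi> l * transfer v k l))
     = (\<lambda>(k, l). \<phi> k * (\<phi> k - \<phi> l) * transfer v k l)"
    by (rule ext) (simp add: case_prod_unfold power2_eq_square algebra_simps)
  with H3 have H4: "((\<lambda>(k, l). \<phi> k * (\<phi> k - \<phi> l) * transfer v k l) has_sum S) UNIV" by simp
  have "((\<lambda>(k, h). \<phi> k * (\<phi> k - \<phi> (k - h)) * transfer v k (k - h)) has_sum S) UNIV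
     \<longleftrightarrow> ((\<lambda>(k, l). \<phi> k * (\<phi> k - \<phi> l) * transfer v k l) has_sum S) UNIV"
    by (rule has_sum_reindex_bij_witness[where i = "\<lambda>(k, h). (k, k - h)" and j = "\<lambda>(k, h). (k, k - h)"]) auto
  with H4 have H: "((\<lambda>(k, h). \<phi> k * (\<phi> k - \<phi> (k - h)) * transfer v k (k - h)) has_sum (\<Sum>\<^sub>\<infinity>k. (\<phi> k)\<^sup>2 * (v k \<bullet> euler_P v v k))) UNIV"
    unfolding S_def by simp
  show "(\<Sum>\<^sub>\<infinity>k. (\<phi> k)\<^sup>2 * (v k \<bullet> euler_P v v k)) = (\<Sum>\<^sub>\<infinity>(k, h). \<phi> k * (\<phi> k - \<phi> (k - h)) * transfer v k (k - h))"
    by (rule infsumI[OF H, symmetric])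
  show "(\<lambda>(k, h). \<phi> k * (\<phi> k - \<phi> (k - h)) * transfer v k (k - h)) summable_on UNIV"
    by (rule has_sum_imp_summable[OF H])
qed

text \<open>The 3 counts the terms with half derivatives; \<open>r\<close> and
  \<open>2 powr r\<close> come from the commutator of the powers, and \<open>sobolev_const\<close>
  from the factor measured in l1.\<close>

definition energy_const :: "real \<Rightarrow> real" where
  "energy_const r = 3 * r * 2 powr r * sobolev_const r"

text \<open>The commutator of the weight has two parts. Its power part leaves one factor without
  exponential weight, so the energy is multiplied by the H^n norm only. Its exponential part carries
  the factor \<open>\<sigma>\<close> and two half derivatives, which form the dissipation. The
  constant is free of \<open>N\<close>.\<close>

lemma energy_estimate:
  assumes v: "v \<in> Asp" and r: "r > 5 / 2" and s: "\<sigma> \<ge> 0" and N: "N \<ge> 0"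
  shows "(\<Sum>\<^sub>\<infinity>k. (gevrey r N \<sigma> (freq_norm k))\<^sup>2 * (v k \<bullet> euler_P v v k))
    \<le> energy_const r * (Hnorm r v * gevrey_energy r N \<sigma> v + \<sigma> * sqrt (gevrey_energy r N \<sigma> v) * gevrey_dissipation r N \<sigma> v)"
proof -
  define \<phi> where "\<phi> = (\<lambda>k. gevrey r N \<sigma> (freq_norm k))"
  define g where "g = (\<lambda>k. min (freq_norm k) N)"
  \<comment> \<open>\<open>y\<close> contains the half derivative: the square of \<open>l2 y\<close>
    is the dissipation, that of \<open>l2 x\<close> the energy, and \<open>l2 m\<close> the H^n
    norm. \<open>b1\<close>, \<open>b2\<close>, \<open>b3\<close> have the power 1 in place of
    \<open>r\<close>; they are measured in l1 and controlled by \<open>x\<close>, \<open>y\<close>,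
    \<open>m\<close> respectively.\<close>
  define A where "A = (\<lambda>k. exp (\<sigma> * g k) * norm (v k))"
  define x where "x = (\<lambda>k. freq_norm k powr r * A k)"
  define y where "y = (\<lambda>k. freq_norm k powr r * (sqrt (g k) * A k))"
  define m where "m = (\<lambda>k. freq_norm k powr r * norm (v k))"
  define b1 where "b1 = (\<lambda>k. freq_norm k * A k)"
  define b2 where "b2 = (\<lambda>k. freq_norm k * (sqrt (g k) * A k))"
  define b3 where "b3 = (\<lambda>k. freq_norm k * norm (v k))"
  let ?L = "sobolev_const r"
  have r0: "r > 0" "r \<ge> 1" using r by auto
  have g0: "0 \<le> g k" for k using N by (simp add: g_def)
  have A0: "0 \<le> A k" for k by (simp add: A_def)
  have xe: "x k = \<phi> k * norm (v k)" for k by (simp add: x_def A_def \<phi>_def gevrey_def g_def)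
  have ye: "(y k)\<^sup>2 = min (freq_norm k) N * (\<phi> k * norm (v k))\<^sup>2" for k
  proof -
    have "(y k)\<^sup>2 = g k * (x k)\<^sup>2" using g0[of k] by (simp add: y_def x_def power_mult_distrib mult_ac)
    then show ?thesis by (simp only: xe g_def)
  qed
  note sm = gevrey_summable[OF v r0(1) s N]
  have xs: "(\<lambda>k. (x k)\<^sup>2) summable_on UNIV" using sm(2) unfolding xe \<phi>_def .
  have ys: "(\<lambda>k. (y k)\<^sup>2) summable_on UNIV" using sm(3) unfolding ye \<phi>_def .
  have ms: "(\<lambda>k. (m k)\<^sup>2) summable_on UNIV" using sm(1) unfolding m_def .
  have nn: "0 \<le> x k" "0 \<le> y k" "0 \<le> m k" "0 \<le> b1 k" "0 \<le> b2 k" "0 \<le> b3 k" for k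
    using A0 g0 by (auto simp: x_def y_def m_def b1_def b2_def b3_def)
  have X: "l2 x = sqrt (gevrey_energy r N \<sigma> v)" unfolding l2_def gevrey_energy_def xe \<phi>_def ..
  have Y: "l2 y * l2 y = gevrey_dissipation r N \<sigma> v"
    unfolding l2_def gevrey_dissipation_def ye \<phi>_def using g0 by (simp add: infsum_nonneg g_def)
  have M: "l2 m = Hnorm r v" unfolding Hnorm_eq_l2 m_def ..
  have b1: "b1 summable_on UNIV" "infsum b1 UNIV \<le> ?L * l2 x"
    unfolding b1_def x_def by (rule l1_le_l2[OF r xs[unfolded x_def] A0])+
  have b2: "b2 summable_on UNIV" "infsum b2 UNIV \<le> ?L * l2 y"
    unfolding b2_def y_def using l1_le_l2[OF r ys[unfolded y_def]] g0 A0 by auto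
  have b3: "b3 summable_on UNIV" "infsum b3 UNIV \<le> ?L * l2 m"
    unfolding b3_def m_def by (rule l1_le_l2[OF r ms[unfolded m_def] norm_ge_zero])+
  define c1 where "c1 = \<sigma> * 2 powr r"
  define c2 where "c2 = r * 2 powr r"
  have c0: "c1 \<ge> 0" "c2 \<ge> 0" using s r0 by (auto simp: c1_def c2_def)
  \<comment> \<open>\<open>M1\<close> to \<open>M3\<close> come from the exponential part and
    contain two half derivatives, in \<open>M3\<close> one of them inside \<open>b2\<close>.
    \<open>M4\<close> and \<open>M5\<close> come from the power part and contain one factor without
    the exponential.\<close>
  define M1 where "M1 = (\<lambda>(k, h). y k * b1 h * y (k - h))"
  define M2 where "M2 = (\<lambda>(k, h). y k * y h * b1 (k - h))"
  define M3 where "M3 = (\<lambda>(k, h). x k * y h * b2 (k - h))"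
  define M4 where "M4 = (\<lambda>(k, h). x k * b3 h * x (k - h))"
  define M5 where "M5 = (\<lambda>(k, h). x k * m h * b1 (k - h))"
  note defs = M1_def M2_def M3_def M4_def M5_def
  have S1: "M1 summable_on UNIV" "infsum M1 UNIV \<le> l2 y * infsum b1 UNIV * l2 y"
    unfolding M1_def by (rule young_trilinear[OF ys nn(2) b1(1) nn(4) ys nn(2)])+
  have S2: "M2 summable_on UNIV" "infsum M2 UNIV \<le> l2 y * l2 y * infsum b1 UNIV"
    unfolding M2_def by (rule young_trilinear'[OF ys nn(2) ys nn(2) b1(1) nn(4)])+
  have S3: "M3 summable_on UNIV" "infsum M3 UNIV \<le> l2 x * l2 y * infsum b2 UNIV"
    unfolding M3_def by (rule young_trilinear'[OF xs nn(1) ys nn(2) b2(1) nn(5)])+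
  have S4: "M4 summable_on UNIV" "infsum M4 UNIV \<le> l2 x * infsum b3 UNIV * l2 x"
    unfolding M4_def by (rule young_trilinear[OF xs nn(1) b3(1) nn(6) xs nn(1)])+
  have S5: "M5 summable_on UNIV" "infsum M5 UNIV \<le> l2 x * l2 m * infsum b1 UNIV"
    unfolding M5_def by (rule young_trilinear'[OF xs nn(1) ms nn(3) b1(1) nn(4)])+
  define R where "R = (\<lambda>p. c1 * (M1 p + M2 p + M3 p) + c2 * (M4 p + M5 p))"
  have Rs: "(R has_sum c1 * (infsum M1 UNIV + infsum M2 UNIV + infsum M3 UNIV) + c2 * (infsum M4 UNIV + infsum M5 UNIV)) UNIV"
    unfolding R_def by (intro has_sum_add has_sum_cmult_right has_sum_infsum S1 S2 S3 S4 S5)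
  have pt: "(case p of (k, h) \<Rightarrow> \<phi> k * (\<phi> k - \<phi> (k - h)) * transfer v k (k - h)) \<le> R p" for p
  proof (cases p)
    case (Pair k h)
    define l where "l = k - h"
    define a b c where "a = freq_norm k" and "b = freq_norm l" and "c = freq_norm h"
    have abc: "0 \<le> a" "0 \<le> b" "0 \<le> c" "a \<le> b + c" "b \<le> a + c" "c \<le> a + b"
      using freq_norm_triangle[of l h] freq_norm_triangle[of k "- h"] freq_norm_triangle[of k "- l"] freq_norm_minus[of "k - h"]
      by (auto simp: a_def b_def c_def l_def)
    have kl: "k - l = h" by (simp add: l_def)
    have "\<phi> k * (\<phi> k - \<phi> l) * transfer v k l \<le> \<bar>\<phi> k * (\<phi> k - \<phi> l) * transfer v k l\<bar>" by simp
    also have "\<dots> = \<phi> k * \<bar>\<phi> k - \<phi> l\<bar> * \<bar>transfer v k l\<bar>" by (simp add: abs_mult \<phi>_def)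
    also have "\<dots> \<le> \<phi> k * \<bar>\<phi> k - \<phi> l\<bar> * (norm (v k) * norm (v h) * norm (v l) * min a b)"
      using abs_transfer_le[OF v, of k l] unfolding kl a_def b_def by (intro mult_left_mono) (auto simp: \<phi>_def)
    also have "\<dots> = (x k * norm (v h) * norm (v l)) * (\<bar>gevrey r N \<sigma> a - gevrey r N \<sigma> b\<bar> * min a b)"
      by (simp add: xe \<phi>_def a_def b_def mult_ac)
    also have "\<dots> \<le> (x k * norm (v h) * norm (v l)) *
       (\<sigma> * 2 powr r * (b powr r * c * (sqrt (g k) * sqrt (g l)) + c powr r * b * (sqrt (g h) * (sqrt (g k) + sqrt (g l))))
      * exp (\<sigma> * g l) * exp (\<sigma> * g h) + r * 2 powr r * (c * b powr r + c powr r * b) * exp (\<sigma> * g l))"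
      using gevrey_commutator[OF abc r0(2) s N] nn(1)[of k] unfolding g_def a_def b_def c_def
      by (intro mult_left_mono) auto
    also have "\<dots> = R p"
    proof -
      have e: "x k * sqrt (g k) = y k" by (simp add: x_def y_def)
      have "R p = c1 * (y k * b1 h * y l + y k * y h * b1 l + x k * y h * b2 l) + c2 * (x k * b3 h * x l + x k * m h * b1 l)"
        by (simp add: R_def defs Pair l_def)
      then show ?thesis unfolding e[symmetric]
        unfolding y_def b1_def b2_def b3_def m_def x_def A_def c1_def c2_def a_def b_def c_def
        by (simp add: algebra_simps)
    qed
    finally show ?thesis by (simp add: Pair l_def)
  qed
  have "(\<Sum>\<^sub>\<infinity>k. (\<phi> k)\<^sup>2 * (v k \<bullet> euler_P v v k)) = (\<Sum>\<^sub>\<infinity>(k, h). \<phi> k * (\<phi> k - \<phi> (k - h)) * transfer v k (k - h))"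
    unfolding \<phi>_def by (rule energy_transfer(2)[OF v r0(1) s N])
  also have "\<dots> \<le> c1 * (infsum M1 UNIV + infsum M2 UNIV + infsum M3 UNIV) + c2 * (infsum M4 UNIV + infsum M5 UNIV)"
  proof (rule has_sum_mono[OF has_sum_infsum Rs pt])
    show "(\<lambda>(k, h). \<phi> k * (\<phi> k - \<phi> (k - h)) * transfer v k (k - h)) summable_on UNIV"
      unfolding \<phi>_def by (rule energy_transfer(3)[OF v r0(1) s N])
  qed
  also have "\<dots> \<le> c1 * (3 * ?L * l2 x * (l2 y * l2 y)) + c2 * (2 * ?L * l2 m * (l2 x * l2 x))"
  proof (intro add_mono mult_left_mono c0)
    have "l2 y * infsum b1 UNIV * l2 y \<le> l2 y * (?L * l2 x) * l2 y"
      by (intro mult_right_mono mult_left_mono b1(2)) auto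
    moreover have "l2 y * l2 y * infsum b1 UNIV \<le> l2 y * l2 y * (?L * l2 x)"
      by (intro mult_left_mono b1(2)) auto
    moreover have "l2 x * l2 y * infsum b2 UNIV \<le> l2 x * l2 y * (?L * l2 y)"
      by (intro mult_left_mono b2(2)) auto
    ultimately have "infsum M1 UNIV + infsum M2 UNIV + infsum M3 UNIV \<le> l2 y * (?L * l2 x) * l2 y + l2 y * l2 y * (?L * l2 x) + l2 x * l2 y * (?L * l2 y)"
      using S1(2) S2(2) S3(2) by linarith
    also have "\<dots> = 3 * ?L * l2 x * (l2 y * l2 y)" by (simp add: algebra_simps)
    finally show "infsum M1 UNIV + infsum M2 UNIV + infsum M3 UNIV \<le> 3 * ?L * l2 x * (l2 y * l2 y)" .
    have "l2 x * infsum b3 UNIV * l2 x \<le> l2 x * (?L * l2 m) * l2 x"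
      by (intro mult_right_mono mult_left_mono b3(2)) auto
    moreover have "l2 x * l2 m * infsum b1 UNIV \<le> l2 x * l2 m * (?L * l2 x)"
      by (intro mult_left_mono b1(2)) auto
    ultimately have "infsum M4 UNIV + infsum M5 UNIV \<le> l2 x * (?L * l2 m) * l2 x + l2 x * l2 m * (?L * l2 x)"
      using S4(2) S5(2) by linarith
    also have "\<dots> = 2 * ?L * l2 m * (l2 x * l2 x)" by (simp add: algebra_simps)
    finally show "infsum M4 UNIV + infsum M5 UNIV \<le> 2 * ?L * l2 m * (l2 x * l2 x)" .
  qed
  also have "\<dots> \<le> energy_const r * (l2 m * (l2 x * l2 x) + \<sigma> * l2 x * (l2 y * l2 y))"
  proof -
    have "c1 * (3 * ?L * l2 x * (l2 y * l2 y)) = (3 * 2 powr r * ?L) * (\<sigma> * l2 x * (l2 y * l2 y))"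
      by (simp add: c1_def mult_ac)
    also have "\<dots> \<le> energy_const r * (\<sigma> * l2 x * (l2 y * l2 y))"
    proof (rule mult_right_mono)
      show "3 * 2 powr r * ?L \<le> energy_const r"
        unfolding energy_const_def using mult_right_mono[OF r0(2), of "3 * 2 powr r * ?L"] by (simp add: mult_ac)
    qed (use s in auto)
    finally have 1: "c1 * (3 * ?L * l2 x * (l2 y * l2 y)) \<le> energy_const r * (\<sigma> * l2 x * (l2 y * l2 y))" .
    have "c2 * (2 * ?L * l2 m * (l2 x * l2 x)) = (2 * r * 2 powr r * ?L) * (l2 m * (l2 x * l2 x))"
      by (simp add: c2_def mult_ac)
    also have "\<dots> \<le> energy_const r * (l2 m * (l2 x * l2 x))"
      unfolding energy_const_def using r0 by (intro mult_right_mono) auto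
    finally show ?thesis using 1 by (simp add: distrib_left)
  qed
  also have "l2 x * l2 x = gevrey_energy r N \<sigma> v"
    unfolding X by (simp add: gevrey_energy_def infsum_nonneg)
  finally show ?thesis unfolding \<phi>_def Y M X .
qed

subsection \<open>Time evolution of the energy\<close>

text \<open>Dominated convergence for unordered sums, needed for differentiating the energy under
  the sum: a finite set carries the majorant up to \<open>\<epsilon> / 8\<close>, and on it the
  convergence is termwise.\<close>

lemma tendsto_infsum_dominated:
  fixes q :: "'b \<Rightarrow> 'a \<Rightarrow> real"
  assumes lim: "\<And>k. ((\<lambda>x. q x k) \<longlongrightarrow> L k) G"
    and bd: "eventually (\<lambda>x. \<forall>k. \<bar>q x k\<bar> \<le> C k) G" and Lb: "\<And>k. \<bar>L k\<bar> \<le> C k"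
    and C: "C summable_on UNIV"
  shows "((\<lambda>x. \<Sum>\<^sub>\<infinity>k. q x k) \<longlongrightarrow> (\<Sum>\<^sub>\<infinity>k. L k)) G"
proof (rule tendstoI)
  fix \<epsilon> :: real assume e: "\<epsilon> > 0"
  have C0: "0 \<le> C k" for k using Lb[of k] by linarith
  obtain F where F: "finite F" "dist (sum C F) (infsum C UNIV) \<le> \<epsilon> / 8"
    using infsum_finite_approximation[OF C, of "\<epsilon> / 8"] e by auto
  have CF: "C summable_on (- F)" by (rule summable_on_subset_banach[OF C]) simp
  have "infsum C UNIV = infsum C (F \<union> - F)" by simp
  also have "\<dots> = sum C F + infsum C (- F)"
    using F CF by (subst infsum_Un_disjoint) auto
  finally have tail: "infsum C (- F) \<le> \<epsilon> / 8" using F(2) by (simp add: dist_real_def)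
  have "((\<lambda>x. \<Sum>k\<in>F. \<bar>q x k - L k\<bar>) \<longlongrightarrow> (\<Sum>k\<in>F. \<bar>L k - L k\<bar>)) G"
    by (intro tendsto_intros lim)
  then have "eventually (\<lambda>x. (\<Sum>k\<in>F. \<bar>q x k - L k\<bar>) < \<epsilon> / 2) G"
    by (rule order_tendstoD) (use e in simp)
  with bd show "eventually (\<lambda>x. dist (\<Sum>\<^sub>\<infinity>k. q x k) (\<Sum>\<^sub>\<infinity>k. L k) < \<epsilon>) G"
  proof eventually_elim
    case (elim x)
    have qs: "q x summable_on UNIV" and Ls: "L summable_on UNIV"
      using elim(1) Lb by (auto intro!: abs_summable_summable[OF Infinite_Sum.abs_summable_on_comparison_test'[OF C]])
    define d where "d = (\<lambda>k. \<bar>q x k - L k\<bar>)"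
    have dC: "d k \<le> 2 * C k" for k
      using elim(1)[rule_format, of k] Lb[of k] abs_triangle_ineq4[of "q x k" "L k"] by (simp add: d_def)
    have C2: "(\<lambda>k. 2 * C k) summable_on A" for A
      by (rule summable_on_cmult_right[OF summable_on_subset_banach[OF C]]) simp
    have ds: "d summable_on A" for A
      by (rule summable_on_comparison_test[OF C2 dC]) (simp add: d_def)
    have "((\<lambda>k. q x k + - L k) has_sum infsum (q x) UNIV + - infsum L UNIV) UNIV"
      using qs Ls by (intro has_sum_add has_sum_uminusI has_sum_infsum)
    then have "dist (\<Sum>\<^sub>\<infinity>k. q x k) (\<Sum>\<^sub>\<infinity>k. L k) \<le> infsum d UNIV"
      unfolding dist_real_def using norm_infsum_le[OF _ has_sum_infsum[OF ds]] by (force simp: d_def)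
    also have "infsum d UNIV = infsum d (F \<union> - F)" by simp
    also have "\<dots> = sum d F + infsum d (- F)"
      using F ds by (subst infsum_Un_disjoint) auto
    also have "infsum d (- F) \<le> 2 * infsum C (- F)"
      using infsum_mono[OF ds C2 dC, of "- F"] by (simp only: infsum_cmult_right')
    finally have "dist (\<Sum>\<^sub>\<infinity>k. q x k) (\<Sum>\<^sub>\<infinity>k. L k) \<le> sum d F + 2 * infsum C (- F)" by simp
    then show ?case using elim(2) tail e unfolding d_def by linarith
  qed
qed

lemma has_real_derivative_infsum:
  fixes f f' :: "real \<Rightarrow> 'a \<Rightarrow> real"
  assumes d: "\<delta> > 0" and f: "\<And>t k. \<bar>t - t\<^sub>0\<bar> < \<delta> \<Longrightarrow> ((\<lambda>t. f t k) has_real_derivative f' t k) (at t)"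
    and b: "\<And>t k. \<bar>t - t\<^sub>0\<bar> < \<delta> \<Longrightarrow> \<bar>f' t k\<bar> \<le> C k" and C: "C summable_on UNIV"
    and s: "\<And>t. \<bar>t - t\<^sub>0\<bar> < \<delta> \<Longrightarrow> f t summable_on UNIV"
  shows "((\<lambda>t. \<Sum>\<^sub>\<infinity>k. f t k) has_real_derivative (\<Sum>\<^sub>\<infinity>k. f' t\<^sub>0 k)) (at t\<^sub>0)"
proof -
  have ev: "eventually (\<lambda>h. h \<noteq> 0 \<and> \<bar>h\<bar> < \<delta>) (at (0::real))"
    unfolding eventually_at using d by (intro exI[of _ \<delta>]) (auto simp: dist_real_def)
  have lim: "((\<lambda>h. \<Sum>\<^sub>\<infinity>k. (f (t\<^sub>0 + h) k - f t\<^sub>0 k) / h) \<longlongrightarrow> (\<Sum>\<^sub>\<infinity>k. f' t\<^sub>0 k)) (at 0)"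
  proof (rule tendsto_infsum_dominated[OF _ _ _ C])
    show "((\<lambda>h. (f (t\<^sub>0 + h) k - f t\<^sub>0 k) / h) \<longlongrightarrow> f' t\<^sub>0 k) (at 0)" for k
      using f[of t\<^sub>0 k] d by (simp add: DERIV_def)
    show "\<bar>f' t\<^sub>0 k\<bar> \<le> C k" for k using b[of t\<^sub>0 k] d by simp
    show "\<forall>\<^sub>F h in at 0. \<forall>k. \<bar>(f (t\<^sub>0 + h) k - f t\<^sub>0 k) / h\<bar> \<le> C k"
      using ev
    proof (rule eventually_mono, intro allI)
      fix h k assume h: "h \<noteq> 0 \<and> \<bar>h\<bar> < \<delta>"
      have "norm (f (t\<^sub>0 + h) k - f t\<^sub>0 k) \<le> C k * norm (t\<^sub>0 + h - t\<^sub>0)"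
        by (rule field_differentiable_bound[where S = "ball t\<^sub>0 \<delta>" and f = "\<lambda>t. f t k" and f' = "\<lambda>t. f' t k"])
          (use f b d h in \<open>auto simp: dist_real_def abs_minus_commute intro: has_field_derivative_at_within\<close>)
      then show "\<bar>(f (t\<^sub>0 + h) k - f t\<^sub>0 k) / h\<bar> \<le> C k"
        using h by (simp add: abs_divide divide_le_eq)
    qed
  qed
  have ev2: "eventually (\<lambda>h. (\<Sum>\<^sub>\<infinity>k. (f (t\<^sub>0 + h) k - f t\<^sub>0 k) / h) = ((\<Sum>\<^sub>\<infinity>k. f (t\<^sub>0 + h) k) - (\<Sum>\<^sub>\<infinity>k. f t\<^sub>0 k)) / h) (at 0)"
    using ev
  proof (rule eventually_mono)
    fix h assume h: "h \<noteq> 0 \<and> \<bar>h\<bar> < \<delta>"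
    have "((\<lambda>k. (f (t\<^sub>0 + h) k + - f t\<^sub>0 k) * (1 / h)) has_sum (infsum (f (t\<^sub>0 + h)) UNIV + - infsum (f t\<^sub>0) UNIV) * (1 / h)) UNIV"
      by (intro has_sum_cmult_left has_sum_add has_sum_uminusI has_sum_infsum s) (use h d in auto)
    then show "(\<Sum>\<^sub>\<infinity>k. (f (t\<^sub>0 + h) k - f t\<^sub>0 k) / h) = ((\<Sum>\<^sub>\<infinity>k. f (t\<^sub>0 + h) k) - (\<Sum>\<^sub>\<infinity>k. f t\<^sub>0 k)) / h"
      by (intro infsumI) simp
  qed
  show ?thesis unfolding DERIV_def using lim tendsto_cong[OF ev2] by blast
qed

text \<open>The derivative of \<open>\<sigma>\<close> is -\<open>\<mu>\<sigma>\<close>, which brings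
  in the dissipation. Differentiation under the sum is dominated because fields at nearby times
  share one exponential decay bound, which beats the power weight, while the truncation keeps the
  exponential factor below \<open>G\<close>.\<close>

lemma energy_derivative:
  assumes sol: "analytic_solution_on I u" and I: "open I" "t\<^sub>0 \<in> I"
    and r: "r > 5 / 2" and N: "N \<ge> 0" and s0: "s\<^sub>0 \<ge> 0" and lam: "\<mu> \<ge> 0"
  defines "\<sigma> \<equiv> \<lambda>t. s\<^sub>0 * exp (- \<mu> * t)"
  shows "((\<lambda>t. gevrey_energy r N (\<sigma> t) (u t)) has_real_derivative
     (- 2 * \<mu> * \<sigma> t\<^sub>0 * gevrey_dissipation r N (\<sigma> t\<^sub>0) (u t\<^sub>0)
      + 2 * (\<Sum>\<^sub>\<infinity>k. (gevrey r N (\<sigma> t\<^sub>0) (freq_norm k))\<^sup>2 * (u t\<^sub>0 k \<bullet> euler_P (u t\<^sub>0) (u t\<^sub>0) k)))) (at t\<^sub>0)"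
proof -
  obtain \<rho> \<tau> K c where E: "expansion_at \<rho> \<tau> K c u t\<^sub>0" and inI: "\<And>t. \<bar>t - t\<^sub>0\<bar> < \<rho> \<Longrightarrow> t \<in> I"
    using analytic_solution_recursion[OF sol I] by metis
  have rho: "\<rho> > 0" and tau: "\<tau> > 0" using E by (auto simp: expansion_at_def)
  have K0: "K \<ge> 0" by (rule expansion_K[OF E])
  \<comment> \<open>Within \<open>\<rho> / 2\<close> of the centre the constant K/(1 - |t -
    \<open>t\<^sub>0\<close>|/\<open>\<rho>\<close>) is at most 2K; the cap 1 gives the bound
    \<open>S\<close> for \<open>\<sigma> t\<close>.\<close>
  define \<delta> where "\<delta> = min (\<rho> / 2) 1"
  have d: "\<delta> > 0" "\<delta> \<le> \<rho> / 2" "\<delta> \<le> 1" using rho by (auto simp: \<delta>_def)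
  have near: "t \<in> I" "exp_decay (2 * K) \<tau> (u t)" if t: "\<bar>t - t\<^sub>0\<bar> < \<delta>" for t
  proof -
    have tr: "\<bar>t - t\<^sub>0\<bar> < \<rho>" using t d rho by linarith
    show "t \<in> I" by (rule inI[OF tr])
    have h: "\<bar>t - t\<^sub>0\<bar> / \<rho> \<le> 1 / 2" using t d rho by (simp add: field_simps)
    have "K / (1 - \<bar>t - t\<^sub>0\<bar> / \<rho>) \<le> K / (1 / 2)"
      by (intro divide_left_mono mult_pos_pos) (use h K0 in linarith)+
    then show "exp_decay (2 * K) \<tau> (u t)" using exp_decay_mono[OF expansion_decay[OF E tr]] by simp
  qed
  have ut: "u t \<in> Asp" "solves_euler_at u t" if "\<bar>t - t\<^sub>0\<bar> < \<delta>" for t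
    using sol near(1)[OF that] by (auto simp: analytic_solution_on_def)
  obtain Cp where Cp: "Cp \<ge> 0" "\<And>K L v w. exp_decay K \<tau> v \<Longrightarrow> exp_decay L \<tau> w \<Longrightarrow> exp_decay (Cp * K * L) (\<tau> / 4) (euler_P v w)"
    using exp_decay_euler[OF tau] by blast
  have "2 * r > 0" using r by simp
  then obtain Cw where Cw: "Cw \<ge> 0" "\<And>K v k. exp_decay K \<tau> v \<Longrightarrow> freq_norm k powr (2 * r) * norm (v k) \<le> Cw * K * exp (- (\<tau> / 2) * freq_l1 k)"
    using exp_decay_weighted[OF tau] by metis
  define g where "g = (\<lambda>k. min (freq_norm k) N)"
  have g0: "0 \<le> g k" "g k \<le> N" for k using N by (auto simp: g_def)
  define p where "p = (\<lambda>k. freq_norm k powr (2 * r))"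
  have pw: "(x powr r)\<^sup>2 = x powr (2 * r)" for x :: real by (simp add: power2_eq_square powr_add[symmetric])
  have gsq: "(gevrey r N s (freq_norm k))\<^sup>2 = p k * exp (2 * (s * g k))" for s k
    by (simp add: gevrey_def power_mult_distrib pw p_def g_def exp_double)
  define f where "f = (\<lambda>t k. (gevrey r N (\<sigma> t) (freq_norm k) * norm (u t k))\<^sup>2)"
  define P where "P = (\<lambda>t. euler_P (u t) (u t))"
  define f' where "f' = (\<lambda>t k. - 2 * \<mu> * \<sigma> t * (g k * f t k) + 2 * ((gevrey r N (\<sigma> t) (freq_norm k))\<^sup>2 * (u t k \<bullet> P t k)))"
  have fe: "f t k = p k * exp (2 * (\<sigma> t * g k)) * (u t k \<bullet> u t k)" for t k
    unfolding f_def power_mult_distrib gsq by (simp add: power2_norm_eq_inner)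
  have sig0: "0 \<le> \<sigma> t" for t using s0 by (simp add: \<sigma>_def)
  define S where "S = s\<^sub>0 * exp (\<mu> * (1 + \<bar>t\<^sub>0\<bar>))"
  have sS: "\<sigma> t \<le> S" if t: "\<bar>t - t\<^sub>0\<bar> < \<delta>" for t
  proof -
    have "- t \<le> 1 + \<bar>t\<^sub>0\<bar>" using t d by linarith
    then have "\<mu> * (- t) \<le> \<mu> * (1 + \<bar>t\<^sub>0\<bar>)" by (rule mult_left_mono[OF _ lam])
    then show ?thesis unfolding \<sigma>_def S_def using s0 by (intro mult_left_mono) auto
  qed
  have S0: "S \<ge> 0" using s0 by (simp add: S_def)
  define G where "G = exp (2 * (S * N))"
  have D: "((\<lambda>t. f t k) has_real_derivative f' t k) (at t)" if t: "\<bar>t - t\<^sub>0\<bar> < \<delta>" for t k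
  proof -
    have "((\<lambda>t. u t k) has_vector_derivative P t k) (at t)"
      using ut(2)[OF t] by (simp add: solves_euler_at_def P_def)
    from bounded_bilinear.has_vector_derivative[OF bounded_bilinear_inner this this]
    have "((\<lambda>t. u t k \<bullet> u t k) has_real_derivative 2 * (u t k \<bullet> P t k)) (at t)"
      by (simp add: has_real_derivative_iff_has_vector_derivative inner_commute)
    moreover have "(\<sigma> has_real_derivative - \<mu> * \<sigma> t) (at t)"
      unfolding \<sigma>_def by (auto intro!: derivative_eq_intros)
    ultimately have "((\<lambda>t. p k * exp (2 * (\<sigma> t * g k)) * (u t k \<bullet> u t k)) has_real_derivative
       (p k * (exp (2 * (\<sigma> t * g k)) * (2 * (- \<mu> * \<sigma> t * g k)))) * (u t k \<bullet> u t k) + (p k * exp (2 * (\<sigma> t * g k))) * (2 * (u t k \<bullet> P t k))) (at t)"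
      by (auto intro!: derivative_eq_intros)
    then show ?thesis unfolding fe[abs_def] f'_def gsq fe by (simp add: algebra_simps)
  qed
  define C where "C = (\<lambda>k::freq. (2 * \<mu> * S * N * G * (2 * K) + 2 * G * (Cp * (2 * K) * (2 * K))) * (Cw * (2 * K) * exp (- (\<tau> / 2) * freq_l1 k)))"
  have Cs: "C summable_on UNIV" unfolding C_def
    using tau by (intro summable_on_cmult_right summable_on_exp_freq) simp
  have B: "\<bar>f' t k\<bar> \<le> C k" if t: "\<bar>t - t\<^sub>0\<bar> < \<delta>" for t k
  proof -
    have u2: "norm (u t k) \<le> 2 * K"
    proof -
      have "norm (u t k) \<le> 2 * K * exp (- \<tau> * freq_l1 k)" using near(2)[OF t] by (simp add: exp_decay_def)
      also have "\<dots> \<le> 2 * K * 1" using K0 tau by (intro mult_left_mono) auto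
      finally show ?thesis by simp
    qed
    have P2: "norm (P t k) \<le> Cp * (2 * K) * (2 * K)"
    proof -
      have "norm (P t k) \<le> Cp * (2 * K) * (2 * K) * exp (- (\<tau> / 4) * freq_l1 k)"
        using Cp(2)[OF near(2)[OF t] near(2)[OF t]] by (simp add: exp_decay_def P_def)
      also have "\<dots> \<le> Cp * (2 * K) * (2 * K) * 1" using K0 tau Cp by (intro mult_left_mono) auto
      finally show ?thesis by simp
    qed
    have eG: "exp (2 * (\<sigma> t * g k)) \<le> G"
      unfolding G_def using sS[OF t] g0[of k] sig0[of t] S0 by (auto intro!: mult_mono)
    have p0: "0 \<le> p k" by (simp add: p_def)
    have pu: "p k * norm (u t k) \<le> Cw * (2 * K) * exp (- (\<tau> / 2) * freq_l1 k)"
      unfolding p_def by (rule Cw(2)[OF near(2)[OF t]])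
    have G0: "G \<ge> 0" by (simp add: G_def)
    have fb: "f t k \<le> G * (2 * K) * (p k * norm (u t k))"
    proof -
      have "f t k = exp (2 * (\<sigma> t * g k)) * (norm (u t k) * (p k * norm (u t k)))"
        unfolding fe by (simp add: dot_square_norm power2_eq_square)
      also have "\<dots> \<le> G * (2 * K * (p k * norm (u t k)))"
        using p0 K0 G0 by (intro mult_mono eG mult_right_mono u2) auto
      finally show ?thesis by (simp add: mult_ac)
    qed
    have f0: "0 \<le> f t k" by (simp add: f_def)
    have 1: "\<bar>- 2 * \<mu> * \<sigma> t * (g k * f t k)\<bar> \<le> 2 * \<mu> * S * N * G * (2 * K) * (p k * norm (u t k))"
    proof -
      have "\<bar>- 2 * \<mu> * \<sigma> t * (g k * f t k)\<bar> = 2 * \<mu> * (\<sigma> t * (g k * f t k))"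
        using lam sig0[of t] g0[of k] f0 by (simp add: abs_mult)
      also have "\<dots> \<le> 2 * \<mu> * (S * (N * (G * (2 * K) * (p k * norm (u t k)))))"
        using lam sS[OF t] g0[of k] S0 N f0 fb by (intro mult_left_mono mult_mono) auto
      finally show ?thesis by (simp add: mult_ac)
    qed
    have 2: "\<bar>2 * ((gevrey r N (\<sigma> t) (freq_norm k))\<^sup>2 * (u t k \<bullet> P t k))\<bar> \<le> 2 * G * (Cp * (2 * K) * (2 * K)) * (p k * norm (u t k))"
    proof -
      have "\<bar>u t k \<bullet> P t k\<bar> \<le> norm (u t k) * norm (P t k)" by (rule Cauchy_Schwarz_ineq2)
      also have "\<dots> \<le> norm (u t k) * (Cp * (2 * K) * (2 * K))" by (intro mult_left_mono P2) auto
      finally have "p k * exp (2 * (\<sigma> t * g k)) * \<bar>u t k \<bullet> P t k\<bar> \<le> p k * G * (norm (u t k) * (Cp * (2 * K) * (2 * K)))"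
        using p0 G0 eG by (intro mult_mono) auto
      then show ?thesis unfolding gsq using p0 by (simp add: abs_mult mult_ac)
    qed
    have "\<bar>f' t k\<bar> \<le> (2 * \<mu> * S * N * G * (2 * K) + 2 * G * (Cp * (2 * K) * (2 * K))) * (p k * norm (u t k))"
      unfolding f'_def distrib_right by (rule order_trans[OF abs_triangle_ineq add_mono[OF 1 2]])
    also have "\<dots> \<le> C k"
      unfolding C_def using lam S0 N G0 K0 Cp by (intro mult_left_mono pu) (auto intro!: add_nonneg_nonneg mult_nonneg_nonneg)
    finally show ?thesis .
  qed
  have fs: "f t summable_on UNIV" if t: "\<bar>t - t\<^sub>0\<bar> < \<delta>" for t
    unfolding f_def by (rule gevrey_summable(2)[OF ut(1)[OF t] _ sig0 N]) (use r in simp)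
  have "((\<lambda>t. \<Sum>\<^sub>\<infinity>k. f t k) has_real_derivative (\<Sum>\<^sub>\<infinity>k. f' t\<^sub>0 k)) (at t\<^sub>0)"
    by (rule has_real_derivative_infsum[OF d(1) D B Cs fs])
  moreover have "(\<Sum>\<^sub>\<infinity>k. f' t\<^sub>0 k) = - 2 * \<mu> * \<sigma> t\<^sub>0 * gevrey_dissipation r N (\<sigma> t\<^sub>0) (u t\<^sub>0)
      + 2 * (\<Sum>\<^sub>\<infinity>k. (gevrey r N (\<sigma> t\<^sub>0) (freq_norm k))\<^sup>2 * (u t\<^sub>0 k \<bullet> euler_P (u t\<^sub>0) (u t\<^sub>0) k))"
  proof (rule infsumI)
    have u0: "u t\<^sub>0 \<in> Asp" using ut(1)[of t\<^sub>0] d by simp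
    have r0: "r > 0" using r by simp
    show "(f' t\<^sub>0 has_sum - 2 * \<mu> * \<sigma> t\<^sub>0 * gevrey_dissipation r N (\<sigma> t\<^sub>0) (u t\<^sub>0)
      + 2 * (\<Sum>\<^sub>\<infinity>k. (gevrey r N (\<sigma> t\<^sub>0) (freq_norm k))\<^sup>2 * (u t\<^sub>0 k \<bullet> euler_P (u t\<^sub>0) (u t\<^sub>0) k))) UNIV"
      unfolding f'_def gevrey_dissipation_def f_def g_def P_def
      by (intro has_sum_add has_sum_cmult_right has_sum_infsum gevrey_summable(3)[OF u0 r0 sig0 N] energy_transfer(1)[OF u0 r0 sig0 N])
  qed
  moreover have "gevrey_energy r N (\<sigma> t) (u t) = (\<Sum>\<^sub>\<infinity>k. f t k)" for t
    by (simp add: gevrey_energy_def f_def)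
  ultimately show ?thesis by simp
qed

text \<open>The differential inequality is available only while \<open>f\<close> is below
  \<open>B\<close>. Up to the first time at which \<open>f\<close> reaches \<open>B\<close>
  Gronwall's inequality applies and gives at most E exp(\<open>\<kappa>\<close>T), which is strictly
  less than \<open>B\<close>: that time does not exist.\<close>

lemma gronwall_bootstrap:
  fixes f f' :: "real \<Rightarrow> real"
  assumes d: "\<And>t. 0 \<le> t \<Longrightarrow> t < T \<Longrightarrow> (f has_real_derivative f' t) (at t)"
    and g: "\<And>t. 0 \<le> t \<Longrightarrow> t < T \<Longrightarrow> f t \<le> B \<Longrightarrow> f' t \<le> \<kappa> * f t"
    and f0: "0 \<le> f 0" "f 0 \<le> E" and B: "E * exp (\<kappa> * T) < B" and k: "\<kappa> \<ge> 0"
    and t: "0 \<le> t" "t < T"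
  shows "f t \<le> B"
proof (rule ccontr)
  assume neg: "\<not> f t \<le> B"
  define S where "S = {x \<in> {0..t}. B \<le> f x}"
  have cont: "continuous_on {0..t} f"
  proof (rule continuous_at_imp_continuous_on, rule ballI)
    fix x assume "x \<in> {0..t}"
    then show "isCont f x" using d[of x] t by (auto intro: DERIV_isCont)
  qed
  have cl: "closed S"
    unfolding S_def using continuous_on_closed_Collect_le[OF continuous_on_const cont] by simp
  have tS: "t \<in> S" using neg t by (simp add: S_def)
  have bb: "bdd_below S" by (rule bdd_belowI[of _ 0]) (simp add: S_def)
  define s where "s = Inf S"
  have sS: "s \<in> S" unfolding s_def by (rule closed_contains_Inf[OF _ bb cl]) (use tS in auto)
  have E0: "E \<ge> 0" using f0 by linarith
  \<comment> \<open>At \<open>s\<close> itself the bound is obtained as a limit from the left, so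
    that the differential inequality holds on the whole closed interval [0,s].\<close>
  have le: "f x \<le> B" if x: "0 \<le> x" "x \<le> s" for x
  proof (cases "x < s")
    case True
    then have "x \<notin> S" using cInf_lower[OF _ bb] unfolding s_def by force
    then show ?thesis using x sS by (auto simp: S_def)
  next
    case False
    then have xs: "x = s" using x by simp
    have "f s \<le> B"
    proof (cases "s = 0")
      case True
      have "1 \<le> exp (\<kappa> * T)" using k t by simp
      then have "E \<le> E * exp (\<kappa> * T)" using E0 by (simp add: mult_le_cancel_left1)
      then show ?thesis using True f0 B by simp
    next
      case False
      have s: "0 < s" "s < T" using False sS t by (auto simp: S_def)
      have "isCont f s" using d[of s] s by (auto intro: DERIV_isCont)
      then have "(f \<longlongrightarrow> f s) (at_left s)" by (simp add: isCont_def filterlim_at_split)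
      moreover have "eventually (\<lambda>x. f x \<le> B) (at_left s)"
        unfolding eventually_at_left_field
      proof (intro exI[of _ 0] conjI allI impI s(1))
        fix y assume y: "0 < y" "y < s"
        then have "y \<notin> S" using cInf_lower[OF _ bb] unfolding s_def by force
        then show "f y \<le> B" using y sS by (auto simp: S_def)
      qed
      ultimately show ?thesis by (rule tendsto_upperbound) simp
    qed
    then show ?thesis using xs by simp
  qed
  have s: "0 \<le> s" "s < T" "B \<le> f s" using sS t by (auto simp: S_def)
  have "f s * exp (- \<kappa> * s) \<le> f 0 * exp (- \<kappa> * 0)"
  proof (rule DERIV_nonpos_imp_nonincreasing[OF s(1)])
    fix x assume x: "0 \<le> x" "x \<le> s"
    have "((\<lambda>x. f x * exp (- \<kappa> * x)) has_real_derivative (f' x * exp (- \<kappa> * x) + (exp (- \<kappa> * x) * - \<kappa>) * f x)) (at x)"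
      using d[of x] x s by (auto intro!: derivative_eq_intros)
    moreover have "f' x * exp (- \<kappa> * x) + (exp (- \<kappa> * x) * - \<kappa>) * f x = (f' x - \<kappa> * f x) * exp (- \<kappa> * x)"
      by (simp add: algebra_simps)
    moreover have "(f' x - \<kappa> * f x) * exp (- \<kappa> * x) \<le> 0"
      using g[of x] x s le[OF x] by (intro mult_nonpos_nonneg) auto
    ultimately show "\<exists>y. ((\<lambda>x. f x * exp (- \<kappa> * x)) has_real_derivative y) (at x) \<and> y \<le> 0" by metis
  qed
  then have "f s \<le> f 0 * exp (\<kappa> * s)" by (simp add: exp_minus field_simps)
  also have "\<dots> \<le> E * exp (\<kappa> * T)"
    using f0 s k by (intro mult_mono) (auto intro: mult_left_mono)
  finally show False using B s(3) by linarith
qed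

text \<open>With \<open>\<mu>\<close> equal to \<open>energy_const r * sqrt B\<close>, the damping
  cancels the dissipation in \<open>energy_estimate\<close> as long as the energy is at most
  \<open>B\<close>. There is no circularity: \<open>B\<close> is fixed by E, M and T, then
  \<open>\<mu>\<close> by \<open>B\<close>, and nothing depends on \<open>N\<close>.\<close>

lemma energy_bound:
  assumes sol: "analytic_solution_on I u" and I: "open I" "{0..<T} \<subseteq> I"
    and r: "r > 5 / 2" and N: "N \<ge> 0" and s0: "s\<^sub>0 \<ge> 0"
    and M: "\<And>t. 0 \<le> t \<Longrightarrow> t < T \<Longrightarrow> Hnorm r (u t) \<le> M"
    and E: "gevrey_energy r N s\<^sub>0 (u 0) \<le> E"
    and B: "E * exp (2 * energy_const r * \<bar>M\<bar> * T) < B"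
    and t: "0 \<le> t" "t < T"
  shows "gevrey_energy r N (s\<^sub>0 * exp (- (energy_const r * sqrt B) * t)) (u t) \<le> B"
proof -
  define c where "c = energy_const r"
  have c0: "c \<ge> 0" unfolding c_def energy_const_def using r by simp
  define \<mu> where "\<mu> = c * sqrt B"
  have en0: "0 \<le> gevrey_energy r N s v" for s v unfolding gevrey_energy_def by (rule infsum_nonneg) simp
  have ds0: "0 \<le> gevrey_dissipation r N s v" for s v
    unfolding gevrey_dissipation_def using N by (intro infsum_nonneg) auto
  have "E \<ge> 0" using E en0 order_trans by blast
  then have "E * exp (2 * c * \<bar>M\<bar> * T) \<ge> 0" by simp
  then have B0: "B \<ge> 0" using B unfolding c_def by linarith
  have mu: "\<mu> \<ge> 0" using c0 B0 by (simp add: \<mu>_def)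
  define \<sigma> where "\<sigma> = (\<lambda>t. s\<^sub>0 * exp (- \<mu> * t))"
  have sig0: "\<sigma> t \<ge> 0" for t using s0 by (simp add: \<sigma>_def)
  define f where "f = (\<lambda>t. gevrey_energy r N (\<sigma> t) (u t))"
  define T1 where "T1 = (\<lambda>t. \<Sum>\<^sub>\<infinity>k. (gevrey r N (\<sigma> t) (freq_norm k))\<^sup>2 * (u t k \<bullet> euler_P (u t) (u t) k))"
  define f' where "f' = (\<lambda>t. - 2 * \<mu> * \<sigma> t * gevrey_dissipation r N (\<sigma> t) (u t) + 2 * T1 t)"
  have "f t \<le> B"
  proof (rule gronwall_bootstrap[where f = f and t = t and f' = f' and \<kappa> = "2 * c * \<bar>M\<bar>" and E = E and T = T])
    fix t assume t: "0 \<le> t" "t < T"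
    then have tI: "t \<in> I" using I by auto
    then have ut: "u t \<in> Asp" using sol by (simp add: analytic_solution_on_def)
    show "(f has_real_derivative f' t) (at t)"
      unfolding f_def f'_def T1_def \<sigma>_def by (rule energy_derivative[OF sol I(1) tI r N s0 mu])
    assume fB: "f t \<le> B"
    let ?D = "gevrey_dissipation r N (\<sigma> t) (u t)"
    have "T1 t \<le> c * (Hnorm r (u t) * f t + \<sigma> t * sqrt (f t) * ?D)"
      unfolding T1_def c_def f_def by (rule energy_estimate[OF ut r sig0 N])
    also have "\<dots> \<le> c * (\<bar>M\<bar> * f t + \<sigma> t * sqrt B * ?D)"
    proof (intro mult_left_mono add_mono c0)
      show "Hnorm r (u t) * f t \<le> \<bar>M\<bar> * f t"
        using M[OF t] en0 unfolding f_def by (intro mult_right_mono) auto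
      show "\<sigma> t * sqrt (f t) * ?D \<le> \<sigma> t * sqrt B * ?D"
        using fB ds0 sig0[of t] by (intro mult_right_mono mult_left_mono) auto
    qed
    also have "\<dots> = c * \<bar>M\<bar> * f t + \<mu> * \<sigma> t * ?D" by (simp add: \<mu>_def algebra_simps)
    finally show "f' t \<le> 2 * c * \<bar>M\<bar> * f t" by (simp add: f'_def)
  next
    show "0 \<le> f 0" using en0 by (simp add: f_def)
    show "f 0 \<le> E" using E by (simp add: f_def \<sigma>_def)
  qed (use B c0 t in \<open>auto simp: c_def\<close>)
  then show ?thesis by (simp add: f_def \<sigma>_def \<mu>_def c_def)
qed

section \<open>A radius of analyticity uniform up to the end time\<close>

lemma gevrey_energy_initial_bound:
  assumes v: "v \<in> Asp" and r: "r > 0"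
  shows "\<exists>s>0. \<exists>E. \<forall>N\<ge>0. gevrey_energy r N s v \<le> E"
proof -
  obtain K \<sigma> where d: "\<sigma> > 0" "exp_decay K \<sigma> v" using v by (auto simp: Asp_iff)
  define s where "s = \<sigma> / 2"
  have s: "s > 0" using d by (simp add: s_def)
  define w :: vfield where "w = (\<lambda>k. exp (s * freq_l1 k) *\<^sub>R v k)"
  have w: "exp_decay K s w"
    unfolding exp_decay_def
  proof
    fix k
    have "norm (w k) \<le> exp (s * freq_l1 k) * (K * exp (- \<sigma> * freq_l1 k))"
      using d by (simp add: w_def exp_decay_def mult_left_mono)
    also have "\<dots> = K * (exp (s * freq_l1 k) * exp (- \<sigma> * freq_l1 k))" by simp
    also have "exp (s * freq_l1 k) * exp (- \<sigma> * freq_l1 k) = exp (- s * freq_l1 k)"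
      by (simp add: exp_add[symmetric] s_def field_simps)
    finally show "norm (w k) \<le> K * exp (- s * freq_l1 k)" .
  qed
  obtain C where C: "\<And>k. freq_norm k powr r * norm (w k) \<le> C * K * exp (- (s / 2) * freq_l1 k)"
    using exp_decay_weighted[OF s r] w by blast
  have sq: "(\<lambda>k::freq. (C * K)\<^sup>2 * exp (- s * freq_l1 k)) summable_on UNIV"
    by (rule summable_on_cmult_right[OF summable_on_exp_freq[OF s]])
  have le: "(gevrey r N s (freq_norm k) * norm (v k))\<^sup>2 \<le> (C * K)\<^sup>2 * exp (- s * freq_l1 k)" for N k
  proof -
    have "s * min (freq_norm k) N \<le> s * freq_l1 k"
      using s freq_norm_le_l1[of k] by (intro mult_left_mono) auto
    then have "gevrey r N s (freq_norm k) * norm (v k) \<le> freq_norm k powr r * exp (s * freq_l1 k) * norm (v k)"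
      unfolding gevrey_def by (intro mult_right_mono mult_left_mono) auto
    also have "\<dots> \<le> C * K * exp (- (s / 2) * freq_l1 k)" using C[of k] by (simp add: w_def mult_ac)
    finally have "(gevrey r N s (freq_norm k) * norm (v k))\<^sup>2 \<le> (C * K * exp (- (s / 2) * freq_l1 k))\<^sup>2"
      by (intro power_mono) auto
    then show ?thesis by (simp add: power_mult_distrib exp_double[symmetric])
  qed
  have "gevrey_energy r N s v \<le> (\<Sum>\<^sub>\<infinity>k::freq. (C * K)\<^sup>2 * exp (- s * freq_l1 k))" if "N \<ge> 0" for N
    unfolding gevrey_energy_def
    by (rule infsum_mono[OF gevrey_summable(2)[OF v r less_imp_le[OF s] that] sq le])
  then show ?thesis using s by blast
qed

lemma uniform_decay:
  assumes sol: "analytic_solution_on I u" and I: "open I" "{0..<T} \<subseteq> I" and T: "T > 0"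
    and r: "r > 5 / 2" and M: "\<And>t. 0 \<le> t \<Longrightarrow> t < T \<Longrightarrow> Hnorm r (u t) \<le> M"
  shows "\<exists>K \<sigma>. \<sigma> > 0 \<and> (\<forall>t. 0 \<le> t \<longrightarrow> t < T \<longrightarrow> exp_decay K \<sigma> (u t))"
proof -
  have "0 \<in> I" using I T by auto
  then have u0: "u 0 \<in> Asp" using sol by (simp add: analytic_solution_on_def)
  obtain s E where sE: "s > 0" "\<And>N. N \<ge> 0 \<Longrightarrow> gevrey_energy r N s (u 0) \<le> E"
    using gevrey_energy_initial_bound[OF u0, of r] r by auto
  define B where "B = E * exp (2 * energy_const r * \<bar>M\<bar> * T) + 1"
  have BE: "E * exp (2 * energy_const r * \<bar>M\<bar> * T) < B" by (simp add: B_def)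
  define \<mu> where "\<mu> = energy_const r * sqrt B"
  have "E \<ge> 0"
  proof -
    have "0 \<le> gevrey_energy r 0 s (u 0)" unfolding gevrey_energy_def by (rule infsum_nonneg) simp
    then show ?thesis using sE(2)[of 0] by simp
  qed
  then have B0: "B \<ge> 0" by (simp add: B_def)
  have mu: "\<mu> \<ge> 0" unfolding \<mu>_def energy_const_def using r B0 by simp
  define \<sigma> where "\<sigma> = s * exp (- \<mu> * T)"
  have sg: "\<sigma> > 0" using sE by (simp add: \<sigma>_def)
  \<comment> \<open>\<open>\<sigma>\<close> is the value of the decreasing rate at the end time. The
    division by 3 converts the Euclidean norm in the weight into \<open>freq_l1\<close>.\<close>
  have "exp_decay (sqrt B) (\<sigma> / 3) (u t)" if t: "0 \<le> t" "t < T" for t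
    unfolding exp_decay_def
  proof
    fix k
    have "t \<in> I" using I t by auto
    then have ut: "u t \<in> Asp" using sol by (simp add: analytic_solution_on_def)
    show "norm (u t k) \<le> sqrt B * exp (- (\<sigma> / 3) * freq_l1 k)"
    proof (cases "k = 0")
      case True
      have "u t 0 = 0" using ut by (simp add: Asp_iff mean_free_div_free_def)
      then show ?thesis using True B0 by simp
    next
      case False
      let ?s = "s * exp (- \<mu> * t)"
      have "\<mu> * t \<le> \<mu> * T" by (rule mult_left_mono) (use t mu in auto)
      then have ss: "\<sigma> \<le> ?s" unfolding \<sigma>_def using sE by (intro mult_left_mono) auto
      have s0: "?s \<ge> 0" using sE by simp
      have k1: "1 \<le> freq_norm k" by (rule freq_norm_ge_1[OF False])
      \<comment> \<open>The bound is uniform in \<open>N\<close>, so the truncation may be put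
        exactly at the frequency under consideration. There the weight is not truncated, and no
        limit in \<open>N\<close> has to be taken.\<close>
      have "gevrey_energy r (freq_norm k) ?s (u t) \<le> B"
        unfolding \<mu>_def by (rule energy_bound[OF sol I r _ less_imp_le[OF sE(1)] M sE(2) BE t]) auto
      moreover have "(\<Sum>l\<in>{k}. (gevrey r (freq_norm k) ?s (freq_norm l) * norm (u t l))\<^sup>2) \<le> gevrey_energy r (freq_norm k) ?s (u t)"
        unfolding gevrey_energy_def
        by (rule finite_sum_le_infsum[OF gevrey_summable(2)[OF ut _ s0 freq_norm_nonneg]]) (use r in auto)
      ultimately have "(gevrey r (freq_norm k) ?s (freq_norm k) * norm (u t k))\<^sup>2 \<le> B" by simp
      then have "gevrey r (freq_norm k) ?s (freq_norm k) * norm (u t k) \<le> sqrt B"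
        by (rule real_le_rsqrt)
      moreover have "exp ((\<sigma> / 3) * freq_l1 k) \<le> gevrey r (freq_norm k) ?s (freq_norm k)"
      proof -
        have "(\<sigma> / 3) * freq_l1 k \<le> (\<sigma> / 3) * (3 * freq_norm k)"
          using sg freq_l1_le_norm[of k] by (intro mult_left_mono) auto
        also have "\<dots> \<le> ?s * freq_norm k" using mult_right_mono[OF ss, of "freq_norm k"] by simp
        finally have 1: "exp ((\<sigma> / 3) * freq_l1 k) \<le> exp (?s * freq_norm k)" by simp
        have "1 \<le> freq_norm k powr r" using k1 r by (simp add: ge_one_powr_ge_zero)
        then have "1 * exp (?s * freq_norm k) \<le> freq_norm k powr r * exp (?s * freq_norm k)"
          by (intro mult_right_mono) auto
        moreover have "gevrey r (freq_norm k) ?s (freq_norm k) = freq_norm k powr r * exp (?s * freq_norm k)"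
          by (simp add: gevrey_def)
        ultimately show ?thesis using 1 by linarith
      qed
      ultimately have "exp ((\<sigma> / 3) * freq_l1 k) * norm (u t k) \<le> sqrt B"
        by (meson mult_right_mono norm_ge_zero order_trans)
      then show ?thesis by (simp add: exp_minus field_simps)
    qed
  qed
  then show ?thesis using sg by (meson zero_less_divide_iff zero_less_numeral)
qed

section \<open>Continuation of analytic solutions\<close>

text \<open>In a common disc both sides extend to holomorphic functions of complex time, and the
  real times near \<open>s\<close> where they agree accumulate at \<open>s\<close>. The point
  \<open>s\<close> need not be the centre.\<close>

lemma expansion_identity:
  assumes E: "expansion_at r \<sigma> K c u t" and E': "expansion_at r' \<sigma>' K' c' v t"
    and s: "\<bar>s - t\<bar> < min r r'" and e: "e > 0" "\<And>x. \<bar>x - s\<bar> < e \<Longrightarrow> u x k = v x k"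
    and x: "\<bar>x - t\<bar> < min r r'"
  shows "u x k = v x k"
proof -
  define q where "q = min r r'"
  have q: "q \<le> r" "q \<le> r'" by (auto simp: q_def)
  have "u x k $ p = v x k $ p" for p
  proof -
    define F where "F = (\<lambda>z. cext c k p z - cext c' k p z)"
    have hol: "F holomorphic_on ball 0 q"
      unfolding F_def
      by (intro holomorphic_on_diff holomorphic_on_subset[OF cext_holomorphic[OF E]]
          holomorphic_on_subset[OF cext_holomorphic[OF E']] subset_ball q)
    have Fr: "F (of_real (y - t)) = u y k $ p - v y k $ p" if "\<bar>y - t\<bar> < q" for y
      unfolding F_def using cext_real[OF E, of y] cext_real[OF E', of y] that q by simp
    define U where "U = (\<lambda>y. complex_of_real (y - t)) ` {y. \<bar>y - s\<bar> < e \<and> \<bar>y - t\<bar> < q}"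
    have lim: "complex_of_real (s - t) islimpt U"
      unfolding islimpt_approachable
    proof (intro allI impI)
      fix \<epsilon> :: real assume eps: "\<epsilon> > 0"
      define d where "d = min (min \<epsilon> e) (q - \<bar>s - t\<bar>) / 2"
      have d: "d > 0" "d < \<epsilon>" "d < e" "d < q - \<bar>s - t\<bar>"
        using eps e(1) s by (auto simp: d_def q_def min_def)
      have "complex_of_real (s + d - t) \<in> U"
        unfolding U_def using d by (intro imageI) auto
      moreover have "dist (complex_of_real (s + d - t)) (complex_of_real (s - t)) = d"
      proof -
        have "complex_of_real (s + d - t) - complex_of_real (s - t) = complex_of_real d" by simp
        then show ?thesis using d(1) by (simp only: dist_norm norm_of_real abs_of_pos)
      qed
      ultimately show "\<exists>x'\<in>U. x' \<noteq> complex_of_real (s - t) \<and> dist x' (complex_of_real (s - t)) < \<epsilon>"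
        using d by (metis dist_self less_irrefl)
    qed
    have "F (of_real (x - t)) = 0"
    proof (rule analytic_continuation[OF hol _ _ _ _ lim])
      show "U \<subseteq> ball 0 q" by (auto simp: U_def simp del: of_real_diff)
      show "complex_of_real (s - t) \<in> ball 0 q" "complex_of_real (x - t) \<in> ball 0 q"
        using s x by (auto simp: q_def simp del: of_real_diff)
      show "F z = 0" if "z \<in> U" for z
        using that Fr e(2) unfolding U_def by auto
    qed auto
    then show ?thesis using Fr[of x] x by (simp add: q_def)
  qed
  then show ?thesis by (simp add: vec_eq_iff)
qed

text \<open>The times near which the two coefficients agree form an open set, and by
  \<open>expansion_identity\<close> its complement in \<open>I\<close> is open too; connectedness
  concludes. One frequency is treated at a time.\<close>

lemma locally_analytic_identity:
  assumes I: "open I" "connected I" and u: "\<And>t. t \<in> I \<Longrightarrow> locally_analytic u t"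
    and v: "\<And>t. t \<in> I \<Longrightarrow> locally_analytic v t"
    and t1: "t\<^sub>1 \<in> I" and e: "e > 0" "\<And>t. \<bar>t - t\<^sub>1\<bar> < e \<Longrightarrow> u t k = v t k"
    and t: "t \<in> I"
  shows "u t k = v t k"
proof -
  define A where "A = {s \<in> I. \<exists>e>0. \<forall>x. \<bar>x - s\<bar> < e \<longrightarrow> u x k = v x k}"
  have oA: "open A"
    unfolding open_dist
  proof
    fix s assume s: "s \<in> A"
    then obtain d where d: "d > 0" "\<And>x. \<bar>x - s\<bar> < d \<Longrightarrow> u x k = v x k" by (auto simp: A_def)
    have "s \<in> I" using s by (simp add: A_def)
    then obtain d' where d': "d' > 0" "\<And>x. \<bar>x - s\<bar> < d' \<Longrightarrow> x \<in> I"
      using open_realE[OF I(1)] by blast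
    show "\<exists>ea>0. \<forall>y. dist y s < ea \<longrightarrow> y \<in> A"
    proof (intro exI[of _ "min (d / 2) d'"] conjI allI impI)
      fix y assume y: "dist y s < min (d / 2) d'"
      have "u x k = v x k" if "\<bar>x - y\<bar> < d / 2" for x
      proof (rule d(2))
        have "\<bar>x - s\<bar> \<le> \<bar>x - y\<bar> + \<bar>y - s\<bar>" using abs_triangle_ineq[of "x - y" "y - s"] by simp
        also have "\<dots> < d / 2 + d / 2" using that y by (intro add_strict_mono) (auto simp: dist_real_def)
        finally show "\<bar>x - s\<bar> < d" by simp
      qed
      then show "y \<in> A" using y d d' by (auto simp: A_def dist_real_def intro!: exI[of _ "d / 2"])
    qed (use d d' in auto)
  qed
  have "open (I - A)"
    unfolding open_dist
  proof
    fix s assume s: "s \<in> I - A"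
    then obtain r \<sigma> K c where E: "expansion_at r \<sigma> K c u s" using u unfolding locally_analytic_def by blast
    obtain r' \<sigma>' K' c' where E': "expansion_at r' \<sigma>' K' c' v s" using s v unfolding locally_analytic_def by blast
    obtain d' where d': "d' > 0" "\<And>x. \<bar>x - s\<bar> < d' \<Longrightarrow> x \<in> I"
      using open_realE[OF I(1), of s] s by blast
    have rr: "min r r' > 0" using E E' by (auto simp: expansion_at_def)
    have "y \<in> I - A" if y: "dist y s < min (min r r') d'" for y
    proof -
      have "y \<notin> A"
      proof
        assume "y \<in> A"
        then obtain d where d: "d > 0" "\<And>x. \<bar>x - y\<bar> < d \<Longrightarrow> u x k = v x k" by (auto simp: A_def)
        have "u x k = v x k" if "\<bar>x - s\<bar> < min r r'" for x
          by (rule expansion_identity[OF E E' _ d that]) (use y in \<open>auto simp: dist_real_def\<close>)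
        then have "s \<in> A" using s rr unfolding A_def by blast
        then show False using s by blast
      qed
      then show ?thesis using y d' by (simp add: dist_real_def)
    qed
    then show "\<exists>e>0. \<forall>y. dist y s < e \<longrightarrow> y \<in> I - A" using rr d' by (meson min_less_iff_conj)
  qed
  moreover have "A \<inter> I \<noteq> {}" using t1 e by (auto simp: A_def)
  ultimately have "(I - A) \<inter> I = {}" using connectedD[OF I(2) oA, of "I - A"] by (auto simp: A_def)
  then have "t \<in> A" using t by blast
  then obtain d where "d > 0" "\<And>x. \<bar>x - t\<bar> < d \<Longrightarrow> u x k = v x k" by (auto simp: A_def)
  then show ?thesis by simp
qed

section \<open>Locality and gluing of solutions\<close>

lemma locally_analytic_cong:
  assumes "locally_analytic u t" "e > 0" "\<And>s. \<bar>s - t\<bar> < e \<Longrightarrow> v s = u s"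
  shows "locally_analytic v t"
proof -
  obtain r \<sigma> K c where E: "expansion_at r \<sigma> K c u t" using assms(1) by (auto simp: locally_analytic_def)
  have r: "r > 0" using E by (simp add: expansion_at_def)
  have "expansion_at (min r e) \<sigma> K c v t"
    by (rule expansion_cong[OF expansion_shrink[OF E]]) (use r assms in auto)
  then show ?thesis by (auto simp: locally_analytic_def)
qed

lemma solves_euler_at_cong:
  assumes "solves_euler_at u t" "e > 0" "\<And>s. \<bar>s - t\<bar> < e \<Longrightarrow> v s = u s"
  shows "solves_euler_at v t"
  unfolding solves_euler_at_def
proof
  fix k
  have vt: "v t = u t" using assms by simp
  show "((\<lambda>t. v t k) has_vector_derivative euler_P (v t) (v t) k) (at t)"
    unfolding vt
  proof (rule has_vector_derivative_transform_within_open[where S = "ball t e"])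
    show "((\<lambda>t. u t k) has_vector_derivative euler_P (u t) (u t) k) (at t)"
      using assms(1) by (simp add: solves_euler_at_def)
  qed (use assms in \<open>auto simp: dist_real_def abs_minus_commute\<close>)
qed

lemma analytic_solution_glue:
  assumes u: "analytic_solution_on I u" and v: "analytic_solution_on J v" and I: "open I" and J: "open J"
    and eq: "\<And>t. t \<in> I \<Longrightarrow> t \<in> J \<Longrightarrow> u t = v t"
  shows "analytic_solution_on (I \<union> J) (\<lambda>t. if t \<in> I then u t else v t)"
  unfolding analytic_solution_on_def
proof
  let ?w = "\<lambda>t. if t \<in> I then u t else v t"
  fix t assume "t \<in> I \<union> J"
  then consider "t \<in> I" | "t \<in> J" by blast
  then show "?w t \<in> Asp \<and> locally_analytic ?w t \<and> solves_euler_at ?w t"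
  proof cases
    case 1
    obtain e where e: "e > 0" "\<And>s. \<bar>s - t\<bar> < e \<Longrightarrow> s \<in> I" using open_realE[OF I 1] by blast
    have w: "?w s = u s" if "\<bar>s - t\<bar> < e" for s using e(2)[OF that] by simp
    show ?thesis
      using u 1 locally_analytic_cong[OF _ e(1) w] solves_euler_at_cong[OF _ e(1) w]
      by (auto simp: analytic_solution_on_def)
  next
    case 2
    obtain e where e: "e > 0" "\<And>s. \<bar>s - t\<bar> < e \<Longrightarrow> s \<in> J" using open_realE[OF J 2] by blast
    have w: "?w s = v s" if "\<bar>s - t\<bar> < e" for s using e(2)[OF that] eq by simp
    have "?w t = v t" using w[of t] e by simp
    then show ?thesis
      using v 2 locally_analytic_cong[OF _ e(1) w] solves_euler_at_cong[OF _ e(1) w]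
      by (auto simp: analytic_solution_on_def)
  qed
qed

lemma connected_time_dom: "connected (time_dom Tm Tp)"
  unfolding is_interval_connected_1[symmetric] is_interval_1
proof (intro ballI allI impI)
  fix a b x assume ab: "a \<in> time_dom Tm Tp" "b \<in> time_dom Tm Tp" and x: "a \<le> x \<and> x \<le> b"
  have "- Tm < ereal a" "ereal a \<le> ereal x" "ereal x \<le> ereal b" "ereal b < Tp"
    using ab x by (auto simp: time_dom_def)
  then show "x \<in> time_dom Tm Tp"
    unfolding time_dom_def using less_le_trans le_less_trans by blast
qed

lemma analytic_solution_continuation:
  assumes sol: "analytic_solution_on (time_dom Tm (ereal T)) u" and Tm: "0 < Tm" and T: "0 < T"
    and r: "r > 5 / 2" and M: "\<And>t. 0 \<le> t \<Longrightarrow> t < T \<Longrightarrow> Hnorm r (u t) \<le> M"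
  shows "\<exists>T' u'. T < T' \<and> analytic_solution_on (time_dom Tm (ereal T')) u' \<and> (\<forall>t\<in>time_dom Tm (ereal T). u' t = u t)"
proof -
  let ?I = "time_dom Tm (ereal T)"
  have pos: "- Tm < ereal t" if "0 \<le> t" for t
  proof -
    have "- Tm < 0" using Tm by (simp add: ereal_uminus_less_reorder)
    then show ?thesis using that by (metis ereal_less_eq(5) less_le_trans)
  qed
  have sub: "{0..<T} \<subseteq> ?I" using pos by (auto simp: time_dom_def)
  obtain K \<sigma> where K: "\<sigma> > 0" "\<And>t. 0 \<le> t \<Longrightarrow> t < T \<Longrightarrow> exp_decay K \<sigma> (u t)"
    using uniform_decay[OF sol open_time_dom sub T r M] by blast
  define \<tau> where "\<tau> = \<sigma> / 2"
  have tau: "\<tau> > 0" "\<tau> < \<sigma>" using K by (auto simp: \<tau>_def)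
  define A where "A = K * (\<Sum>\<^sub>\<infinity>k::freq. exp (- (\<sigma> - \<tau>) * freq_l1 k)) + 1"
  have W: "wiener_fin \<tau> (u t)" "wiener \<tau> (u t) \<le> A" if "0 \<le> t" "t < T" for t
    using exp_decay_wiener[OF K(2)[OF that] tau(2)] by (auto simp: A_def)
  have A: "A > 0" unfolding A_def using exp_decay_nonneg[OF K(2)[of 0]] T
    by (intro add_nonneg_pos mult_nonneg_nonneg infsum_nonneg) auto
  \<comment> \<open>The time radius supplied by \<open>euler_recursion_decay\<close>; owing to the
    uniform bounds \<open>W\<close> it is the same for every starting time in [0,T).\<close>
  define \<delta> where "\<delta> = \<tau> / (16 * exp 1 * A)"
  have d: "\<delta> > 0" using tau A by (simp add: \<delta>_def)
  \<comment> \<open>Close enough to the end point for the series restarted at \<open>t1\<close> to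
    reach beyond \<open>T\<close>.\<close>
  define t1 where "t1 = max 0 (T - \<delta> / 2)"
  have t1: "0 \<le> t1" "t1 < T" "T < t1 + \<delta>" using d T by (auto simp: t1_def)
  have t1I: "t1 \<in> ?I" using sub t1 by auto
  obtain \<rho> \<sigma>' K' c where E: "expansion_at \<rho> \<sigma>' K' c u t1" and rec: "euler_recursion c" and c: "\<And>i. c i \<in> Asp"
    using analytic_solution_recursion[OF sol open_time_dom t1I] by metis
  have c0: "c 0 = u t1" by (rule expansion_at_centre[OF E])
  have cd: "exp_decay (2 * A * (1 / \<delta>) ^ i) (\<tau> / 2) (c i)" for i
    using euler_recursion_decay[OF rec _ _ A tau(1), of i] W[OF t1(1,2)] by (simp add: c0 \<delta>_def)
  define S where "S = (\<lambda>t k. \<Sum>i. (t - t1) ^ i *\<^sub>R c i k)"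
  have ES: "expansion_at \<delta> (\<tau> / 2) (2 * A) c S t1"
    unfolding expansion_at_def
  proof (intro conjI allI impI d cd)
    show "\<tau> / 2 > 0" using tau by simp
    fix t k assume t: "\<bar>t - t1\<bar> < \<delta>"
    have "summable (\<lambda>i. norm ((t - t1) ^ i *\<^sub>R c i k))"
    proof (rule geometric_summable_norm[where M = "2 * A * exp (- (\<tau> / 2) * freq_l1 k)" and y = "\<bar>t - t1\<bar> / \<delta>"])
      show "0 \<le> \<bar>t - t1\<bar> / \<delta>" "\<bar>t - t1\<bar> / \<delta> < 1" using t d by auto
      fix i
      have "norm ((t - t1) ^ i *\<^sub>R c i k) \<le> \<bar>t - t1\<bar> ^ i * (2 * A * (1 / \<delta>) ^ i * exp (- (\<tau> / 2) * freq_l1 k))"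
        using cd[of i] unfolding norm_scaleR power_abs exp_decay_def by (intro mult_left_mono) auto
      also have "\<dots> = 2 * A * exp (- (\<tau> / 2) * freq_l1 k) * (\<bar>t - t1\<bar> ^ i * (1 / \<delta>) ^ i)"
        by (simp only: mult_ac)
      also have "\<bar>t - t1\<bar> ^ i * (1 / \<delta>) ^ i = (\<bar>t - t1\<bar> / \<delta>) ^ i"
        by (simp only: power_mult_distrib[symmetric] times_divide_eq_right mult_1_right)
      finally show "norm ((t - t1) ^ i *\<^sub>R c i k) \<le> 2 * A * exp (- (\<tau> / 2) * freq_l1 k) * (\<bar>t - t1\<bar> / \<delta>) ^ i" .
    qed
    then show "(\<lambda>i. (t - t1) ^ i *\<^sub>R c i k) sums S t k"
      unfolding S_def by (rule summable_sums[OF summable_norm_cancel])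
  qed
  define J where "J = {t. \<bar>t - t1\<bar> < \<delta>}"
  have Jb: "J = ball t1 \<delta>" by (auto simp: J_def dist_real_def)
  have oJ: "open J" by (simp add: Jb)
  have solS: "analytic_solution_on J S"
    unfolding analytic_solution_on_def J_def
    using expansion_Asp[OF ES c] expansion_recentre[OF ES] recursion_expansion_solves[OF ES rec] by blast
  have eq: "u t = S t" if "t \<in> ?I" "t \<in> J" for t
  proof
    fix k
    show "u t k = S t k"
    proof (rule locally_analytic_identity[of "?I \<inter> J" u S t1 "min \<rho> \<delta>"])
      show "open (?I \<inter> J)" by (intro open_Int open_time_dom oJ)
      show "connected (?I \<inter> J)"
        unfolding Jb is_interval_connected_1[symmetric]
        by (intro is_interval_Int) (simp_all add: is_interval_connected_1 connected_time_dom)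
      show "locally_analytic u s" if "s \<in> ?I \<inter> J" for s using that sol by (auto simp: analytic_solution_on_def)
      show "locally_analytic S s" if "s \<in> ?I \<inter> J" for s using that solS by (auto simp: analytic_solution_on_def)
      show "t1 \<in> ?I \<inter> J" using t1I d by (simp add: J_def)
      show "min \<rho> \<delta> > 0" using d E by (simp add: expansion_at_def)
      show "t \<in> ?I \<inter> J" using that by simp
      fix s assume s: "\<bar>s - t1\<bar> < min \<rho> \<delta>"
      then have "(\<lambda>i. (s - t1) ^ i *\<^sub>R c i k) sums u s k" "(\<lambda>i. (s - t1) ^ i *\<^sub>R c i k) sums S s k"
        using E ES by (auto simp: expansion_at_def)
      then show "u s k = S s k" by (rule sums_unique2)
    qed
  qed
  let ?w = "\<lambda>t. if t \<in> ?I then u t else S t"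
  have glue: "analytic_solution_on (?I \<union> J) ?w"
    by (rule analytic_solution_glue[OF sol solS open_time_dom oJ eq])
  have "time_dom Tm (ereal (t1 + \<delta>)) \<subseteq> ?I \<union> J"
  proof
    fix t assume t: "t \<in> time_dom Tm (ereal (t1 + \<delta>))"
    show "t \<in> ?I \<union> J"
    proof (cases "t < T")
      case True
      then show ?thesis using t by (simp add: time_dom_def)
    next
      case False
      then show ?thesis using t t1 d by (simp add: time_dom_def J_def)
    qed
  qed
  then have "analytic_solution_on (time_dom Tm (ereal (t1 + \<delta>))) ?w"
    using glue unfolding analytic_solution_on_def by blast
  then show ?thesis using t1(3) by (intro exI[of _ "t1 + \<delta>"] exI[of _ ?w]) auto
qed

subsection \<open>Time reversal\<close>

text \<open>A symmetry of the equation: the nonlinearity is quadratic and does not see the sign of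
  the field, while the sign of the time derivative is compensated by that of the field.\<close>

definition time_reversal :: "(real \<Rightarrow> vfield) \<Rightarrow> real \<Rightarrow> vfield" where
  "time_reversal u t = (\<lambda>k. - u (- t) k)"

lemma euler_P_minus: "euler_P (\<lambda>k. - v k) (\<lambda>k. - w k) = euler_P v w"
proof -
  have 1: "cdot (- a) b = - cdot a b" for a b using cdot_smult_left[of "-1" a b] by simp
  have 2: "leray k (- b) = - leray k b" for k b using leray_smult[of k "-1" b] by simp
  show ?thesis unfolding euler_P_def 1 2 by (simp add: vec_eq_iff)
qed

lemma analytic_solution_time_reversal:
  assumes "analytic_solution_on I u"
  shows "analytic_solution_on (uminus ` I) (time_reversal u)"
  unfolding analytic_solution_on_def
proof
  fix t assume "t \<in> uminus ` I"
  then have t: "- t \<in> I" by auto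
  have u: "u (- t) \<in> Asp" "locally_analytic u (- t)" "solves_euler_at u (- t)"
    using assms t by (auto simp: analytic_solution_on_def)
  have "time_reversal u t = lincomb (- 1) (u (- t)) 0 (u (- t))"
    by (rule ext) (simp add: time_reversal_def lincomb_def)
  then have 1: "time_reversal u t \<in> Asp" using Asp_lincomb[OF u(1) u(1)] by simp
  obtain r \<sigma> K c where E: "expansion_at r \<sigma> K c u (- t)" using u(2) by (auto simp: locally_analytic_def)
  have "expansion_at r \<sigma> K (\<lambda>i k. ((- 1) ^ Suc i) *\<^sub>R c i k) (time_reversal u) t"
    unfolding expansion_at_def
  proof (intro conjI allI impI)
    show "r > 0" "\<sigma> > 0" using E by (auto simp: expansion_at_def)
    show "exp_decay (K * (1 / r) ^ i) \<sigma> (\<lambda>k. ((- 1) ^ Suc i) *\<^sub>R c i k)" for i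
      using E by (simp add: expansion_at_def exp_decay_def)
    fix s k assume s: "\<bar>s - t\<bar> < r"
    have "\<bar>- s - - t\<bar> < r" using s by linarith
    then have "(\<lambda>i. (- s - - t) ^ i *\<^sub>R c i k) sums u (- s) k" using E unfolding expansion_at_def by blast
    then have 1: "(\<lambda>i. - ((- s - - t) ^ i *\<^sub>R c i k)) sums - u (- s) k" by (rule sums_minus)
    have 2: "- ((- s - - t) ^ i *\<^sub>R c i k) = (s - t) ^ i *\<^sub>R ((- 1) ^ Suc i *\<^sub>R c i k)" for i
    proof -
      have "(- s - - t) ^ i = (- 1) ^ i * (s - t) ^ i" unfolding power_mult_distrib[symmetric] by simp
      then show ?thesis by (simp add: mult.commute)
    qed
    show "(\<lambda>i. (s - t) ^ i *\<^sub>R ((- 1) ^ Suc i *\<^sub>R c i k)) sums time_reversal u s k"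
      using 1 by (simp only: 2 time_reversal_def)
  qed
  then have 2: "locally_analytic (time_reversal u) t" unfolding locally_analytic_def by blast
  have 3: "solves_euler_at (time_reversal u) t"
    unfolding solves_euler_at_def
  proof
    fix k
    have "((\<lambda>s. u s k) has_vector_derivative euler_P (u (- t)) (u (- t)) k) (at (- t))"
      using u(3) by (simp add: solves_euler_at_def)
    moreover have "((\<lambda>s::real. - s) has_vector_derivative - 1) (at t)"
      by (auto intro!: derivative_eq_intros)
    ultimately have "((\<lambda>s. u (- s) k) has_vector_derivative (- 1) *\<^sub>R euler_P (u (- t)) (u (- t)) k) (at t)"
      using vector_diff_chain_at[of uminus "- 1" t "\<lambda>s. u s k"] by (simp add: o_def)
    then have "((\<lambda>s. - u (- s) k) has_vector_derivative euler_P (u (- t)) (u (- t)) k) (at t)"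
      using has_vector_derivative_minus by fastforce
    then show "((\<lambda>t. time_reversal u t k) has_vector_derivative euler_P (time_reversal u t) (time_reversal u t) k) (at t)"
      unfolding time_reversal_def euler_P_minus .
  qed
  show "time_reversal u t \<in> Asp \<and> locally_analytic (time_reversal u) t \<and> solves_euler_at (time_reversal u) t"
    using 1 2 3 by blast
qed

lemma uminus_time_dom: "uminus ` time_dom Tm Tp = time_dom Tp Tm"
proof -
  have "t \<in> uminus ` time_dom Tm Tp \<longleftrightarrow> t \<in> time_dom Tp Tm" for t
  proof -
    have "t \<in> uminus ` time_dom Tm Tp \<longleftrightarrow> - t \<in> time_dom Tm Tp" by force
    also have "\<dots> \<longleftrightarrow> t \<in> time_dom Tp Tm"
      unfolding time_dom_def using ereal_uminus_less_reorder[of Tp "ereal t"] ereal_minus_less_minus[of Tm "ereal t"]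
      by (auto simp: ereal_uminus_less_reorder)
    finally show ?thesis .
  qed
  then show ?thesis by blast
qed

section \<open>Convergence in Sobolev spaces\<close>

lemma Asp_Hsp:
  assumes v: "v \<in> Asp" and n: "n > 0"
  shows "v \<in> Hsp n"
proof -
  obtain K \<sigma> where d: "\<sigma> > 0" "exp_decay K \<sigma> v" using v by (auto simp: Asp_iff)
  have "v \<in> distributions" by (rule exp_decay_distributions[OF d(2,1)]) (use v in \<open>simp add: Asp_iff\<close>)
  moreover have "(\<lambda>k. freq_norm k powr (2 * n) * (norm (v k))\<^sup>2) summable_on UNIV"
  proof -
    have "(x powr n)\<^sup>2 = x powr (2 * n)" for x :: real by (simp add: power2_eq_square powr_add[symmetric])
    then show ?thesis using gevrey_summable(1)[OF v n order_refl order_refl] by (simp add: power_mult_distrib)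
  qed
  ultimately show ?thesis using v by (simp add: Hsp_def Asp_iff)
qed

section \<open>The H^n norm of analytic fields through finite sets of frequencies\<close>

lemma L2_set_le_Hnorm:
  assumes v: "v \<in> Asp" and n: "n > 0" and F: "finite F"
  shows "L2_set (\<lambda>k. freq_norm k powr n * norm (v k)) F \<le> Hnorm n v"
  unfolding Hnorm_eq_l2 l2_def L2_set_def
  by (intro real_sqrt_le_mono finite_sum_le_infsum gevrey_summable(1)[OF v n order_refl order_refl] F) auto

lemma Hnorm_le_finite:
  assumes v: "v \<in> Asp" and n: "n > 0" and B: "\<And>F. finite F \<Longrightarrow> L2_set (\<lambda>k. freq_norm k powr n * norm (v k)) F \<le> B"
  shows "Hnorm n v \<le> B"
proof -
  have B0: "0 \<le> B" using B[of "{}"] by simp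
  have "(\<Sum>\<^sub>\<infinity>k. (freq_norm k powr n * norm (v k))\<^sup>2) \<le> B\<^sup>2"
  proof (rule infsum_le_finite_sums[OF gevrey_summable(1)[OF v n order_refl order_refl]])
    fix F :: "freq set" assume "finite F"
    from B[OF this] show "(\<Sum>k\<in>F. (freq_norm k powr n * norm (v k))\<^sup>2) \<le> B\<^sup>2"
      unfolding L2_set_def using B0 sqrt_le_D by blast
  qed
  then show ?thesis unfolding Hnorm_eq_l2 l2_def using B0 real_le_lsqrt by blast
qed

lemma Hnorm_lincomb_le:
  assumes v: "v \<in> Asp" and w: "w \<in> Asp" and n: "n > 0"
  shows "Hnorm n (lincomb a v b w) \<le> \<bar>a\<bar> * Hnorm n v + \<bar>b\<bar> * Hnorm n w"
proof (rule Hnorm_le_finite[OF Asp_lincomb[OF v w] n])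
  fix F :: "freq set" assume F: "finite F"
  let ?f = "\<lambda>v k. freq_norm k powr n * norm (v k :: complex ^ 3)"
  have "L2_set (?f (lincomb a v b w)) F \<le> L2_set (\<lambda>k. \<bar>a\<bar> * ?f v k + \<bar>b\<bar> * ?f w k) F"
  proof (rule L2_set_mono)
    fix k
    have "norm (lincomb a v b w k) \<le> \<bar>a\<bar> * norm (v k) + \<bar>b\<bar> * norm (w k)"
      unfolding lincomb_def using norm_triangle_ineq[of "a *\<^sub>R v k" "b *\<^sub>R w k"] by simp
    then have "freq_norm k powr n * norm (lincomb a v b w k) \<le> freq_norm k powr n * (\<bar>a\<bar> * norm (v k) + \<bar>b\<bar> * norm (w k))"
      by (intro mult_left_mono) auto
    then show "freq_norm k powr n * norm (lincomb a v b w k) \<le> \<bar>a\<bar> * ?f v k + \<bar>b\<bar> * ?f w k"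
      by (simp add: algebra_simps)
  qed simp
  also have "\<dots> \<le> L2_set (\<lambda>k. \<bar>a\<bar> * ?f v k) F + L2_set (\<lambda>k. \<bar>b\<bar> * ?f w k) F"
    by (rule L2_set_triangle_ineq)
  also have "\<dots> = \<bar>a\<bar> * L2_set (?f v) F + \<bar>b\<bar> * L2_set (?f w) F"
    by (simp add: L2_set_right_distrib)
  also have "\<dots> \<le> \<bar>a\<bar> * Hnorm n v + \<bar>b\<bar> * Hnorm n w"
    using L2_set_le_Hnorm[OF v n F] L2_set_le_Hnorm[OF w n F] by (intro add_mono mult_left_mono) auto
  finally show "L2_set (?f (lincomb a v b w)) F \<le> \<bar>a\<bar> * Hnorm n v + \<bar>b\<bar> * Hnorm n w" .
qed

lemma norm_coeff_le_Hnorm: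
  assumes v: "v \<in> Asp" and n: "n > 0"
  shows "norm (v k) \<le> Hnorm n v"
proof (cases "k = 0")
  case True
  then show ?thesis using v unfolding Asp_iff mean_free_div_free_def Hnorm_eq_l2 by simp
next
  case False
  have "1 \<le> freq_norm k powr n" using freq_norm_ge_1[OF False] n by (simp add: ge_one_powr_ge_zero)
  then have "1 * norm (v k) \<le> freq_norm k powr n * norm (v k)" by (intro mult_right_mono) auto
  also have "\<dots> = L2_set (\<lambda>k. freq_norm k powr n * norm (v k)) {k}" by simp
  also have "\<dots> \<le> Hnorm n v" by (rule L2_set_le_Hnorm[OF v n]) simp
  finally show ?thesis by simp
qed

lemma exp_decay_Hnorm:
  assumes s: "\<sigma> > 0" and n: "n > 0"
  shows "\<exists>C\<ge>0. \<forall>K v. v \<in> Asp \<longrightarrow> exp_decay K \<sigma> v \<longrightarrow> Hnorm n v \<le> C * K"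
proof -
  obtain C where C: "C \<ge> 0" "\<And>K v k. exp_decay K \<sigma> v \<Longrightarrow> freq_norm k powr n * norm (v k) \<le> C * K * exp (- (\<sigma> / 2) * freq_l1 k)"
    using exp_decay_weighted[OF s n] by metis
  define S where "S = sqrt (\<Sum>\<^sub>\<infinity>k::freq. exp (- \<sigma> * freq_l1 k))"
  have S0: "S \<ge> 0" unfolding S_def by (simp add: infsum_nonneg)
  have "Hnorm n v \<le> C * S * K" if v: "v \<in> Asp" "exp_decay K \<sigma> v" for v K
  proof (rule Hnorm_le_finite[OF v(1) n])
    fix F :: "freq set" assume F: "finite F"
    have K0: "K \<ge> 0" by (rule exp_decay_nonneg[OF v(2)])
    have "L2_set (\<lambda>k. freq_norm k powr n * norm (v k)) F \<le> L2_set (\<lambda>k. C * K * exp (- (\<sigma> / 2) * freq_l1 k)) F"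
      by (rule L2_set_mono) (use C(2)[OF v(2)] in auto)
    also have "\<dots> = C * K * L2_set (\<lambda>k. exp (- (\<sigma> / 2) * freq_l1 k)) F"
      using C(1) K0 by (intro L2_set_right_distrib[symmetric]) auto
    also have "L2_set (\<lambda>k. exp (- (\<sigma> / 2) * freq_l1 k)) F = sqrt (\<Sum>k\<in>F. exp (- \<sigma> * freq_l1 k))"
      unfolding L2_set_def by (simp add: exp_double[symmetric])
    also have "C * K * \<dots> \<le> C * K * S"
      unfolding S_def using C(1) K0
      by (intro mult_left_mono real_sqrt_le_mono finite_sum_le_infsum[OF summable_on_exp_freq[OF s] F]) auto
    finally show "L2_set (\<lambda>k. freq_norm k powr n * norm (v k)) F \<le> C * S * K" by (simp add: mult_ac)
  qed
  then show ?thesis using C(1) S0 by (intro exI[of _ "C * S"]) auto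
qed

subsection \<open>The convergence radius\<close>

lemma H_conv_radius_nonneg: "0 \<le> H_conv_radius n a"
  unfolding H_conv_radius_def by (rule Liminf_bounded) (simp add: inv_root_def)

lemma H_conv_radius_ge:
  assumes s: "s > 0" and b: "\<And>j. Hnorm n (a j) \<le> K * (1 / s) ^ j"
  shows "ereal s \<le> H_conv_radius n a"
  unfolding H_conv_radius_def le_Liminf_iff
proof (intro allI impI)
  fix y assume y: "y < ereal s"
  have nn: "0 \<le> Hnorm n (a j)" for j by (simp add: Hnorm_eq_l2)
  have K: "K \<ge> 0" using order_trans[OF nn b[of 0]] by simp
  \<comment> \<open>The constant disappears in the j-th root; \<open>K + 1\<close> is positive even
    when \<open>K\<close> is 0.\<close>
  have "((\<lambda>j. (K + 1) powr (- 1 / real j) * s) \<longlongrightarrow> (K + 1) powr 0 * s) sequentially"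
    using K by (intro tendsto_intros tendsto_divide_0[OF tendsto_const filterlim_at_top_imp_at_infinity[OF filterlim_real_sequentially]]) auto
  then have "((\<lambda>j. (K + 1) powr (- 1 / real j) * s) \<longlongrightarrow> s) sequentially" using K by simp
  then have "((\<lambda>j. ereal ((K + 1) powr (- 1 / real j) * s)) \<longlongrightarrow> ereal s) sequentially" by simp
  then have "eventually (\<lambda>j. y < ereal ((K + 1) powr (- 1 / real j) * s)) sequentially"
    by (rule order_tendstoD) (rule y)
  with eventually_gt_at_top[of 0] show "eventually (\<lambda>j. y < inv_root (real j) (Hnorm n (a j))) sequentially"
  proof eventually_elim
    case (elim j)
    show ?case
    proof (cases "Hnorm n (a j) = 0")
      case True
      then show ?thesis using y by (auto simp: inv_root_def)
    next
      case False
      then have h: "Hnorm n (a j) > 0" using nn[of j] by simp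
      have "Hnorm n (a j) \<le> (K + 1) * (1 / s) ^ j"
        using order_trans[OF b[of j] mult_right_mono[of K "K + 1" "(1 / s) ^ j"]] s by simp
      then have "((K + 1) * (1 / s) ^ j) powr (- 1 / real j) \<le> Hnorm n (a j) powr (- 1 / real j)"
        using h elim by (intro powr_mono2') auto
      also have "((K + 1) * (1 / s) ^ j) powr (- 1 / real j) = (K + 1) powr (- 1 / real j) * s"
      proof -
        have "((1 / s) ^ j) powr (- 1 / real j) = s"
        proof -
          have "(1 / s) ^ j = s powr (- real j)" using s by (simp add: powr_minus powr_realpow power_one_over inverse_eq_divide)
          then show ?thesis using s elim by (simp add: powr_powr)
        qed
        then show ?thesis using K s by (simp add: powr_mult)
      qed
      finally have "ereal ((K + 1) powr (- 1 / real j) * s) \<le> inv_root (real j) (Hnorm n (a j))"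
        using False by (simp add: inv_root_def)
      then show ?thesis using elim(2) by (rule less_le_trans[rotated])
    qed
  qed
qed

lemma H_conv_radius_bound:
  assumes t: "ereal \<bar>t\<bar> < H_conv_radius n a"
  shows "\<exists>R K. \<bar>t\<bar> < R \<and> (\<forall>j. Hnorm n (a j) \<le> K * (1 / R) ^ j)"
proof -
  obtain R where R: "ereal \<bar>t\<bar> < ereal R" "ereal R < H_conv_radius n a" using ereal_dense2[OF t] by blast
  have R0: "R > 0" using R(1) by simp
  have nn: "0 \<le> Hnorm n (a j)" for j by (simp add: Hnorm_eq_l2)
  \<comment> \<open>At j = 0 the exponent -1/j is 0 by convention, and \<open>inv_root\<close> says
    nothing about the size of a nonzero norm; hence j > 0.\<close>
  have "eventually (\<lambda>j. ereal R < inv_root (real j) (Hnorm n (a j)) \<and> j > 0) sequentially"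
    using less_LiminfD[OF R(2)[unfolded H_conv_radius_def]] eventually_gt_at_top[of 0] by eventually_elim auto
  then obtain J where J: "\<And>j. j \<ge> J \<Longrightarrow> ereal R < inv_root (real j) (Hnorm n (a j)) \<and> j > 0"
    by (auto simp: eventually_sequentially)
  have big: "Hnorm n (a j) \<le> (1 / R) ^ j" if "j \<ge> J" for j
  proof (cases "Hnorm n (a j) = 0")
    case False
    then have h: "Hnorm n (a j) > 0" using nn[of j] by simp
    have j: "R < Hnorm n (a j) powr (- 1 / real j)" "j > 0" using J[OF that] False by (auto simp: inv_root_def)
    have "(Hnorm n (a j) powr (- 1 / real j)) powr (- real j) \<le> R powr (- real j)"
      using j R0 by (intro powr_mono2') auto
    moreover have "(Hnorm n (a j) powr (- 1 / real j)) powr (- real j) = Hnorm n (a j)"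
      using h j by (simp add: powr_powr)
    moreover have "R powr (- real j) = (1 / R) ^ j"
      using R0 by (simp add: powr_minus powr_realpow power_one_over inverse_eq_divide)
    ultimately show ?thesis by (simp only:)
  qed (use R0 in simp)
  define K where "K = 1 + (\<Sum>j<J. Hnorm n (a j) * R ^ j)"
  have "Hnorm n (a j) \<le> K * (1 / R) ^ j" for j
  proof (cases "j < J")
    case True
    have "Hnorm n (a j) * R ^ j \<le> (\<Sum>j<J. Hnorm n (a j) * R ^ j)"
      by (rule member_le_sum) (use True R0 nn in auto)
    then have "Hnorm n (a j) * R ^ j \<le> K" by (simp add: K_def)
    then show ?thesis using R0 by (simp add: power_one_over field_simps)
  next
    case False
    then have "Hnorm n (a j) \<le> 1 * (1 / R) ^ j" using big by simp
    also have "\<dots> \<le> K * (1 / R) ^ j"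
      unfolding K_def using R0 nn by (intro mult_right_mono) (auto intro!: sum_nonneg)
    finally show ?thesis .
  qed
  then show ?thesis using R(1) by auto
qed

text \<open>Convergence in \<open>Asp\<close> at one time \<open>s\<close> bounds all terms in one
  step of the inductive limit, and by \<open>exp_decay_Hnorm\<close> such a bound is a bound in H^n
  with the same time radius. If the radii were in the wrong order, \<open>s\<close> could be chosen
  between them.\<close>

lemma A_conv_radius_le_H_conv_radius:
  assumes a: "\<And>j. a j \<in> Asp" and n: "n > 0"
  shows "A_conv_radius a \<le> H_conv_radius n a"
  unfolding A_conv_radius_def
proof (rule Sup_least)
  fix x assume "x \<in> {ereal r |r. r \<ge> 0 \<and> (\<forall>t. \<bar>t\<bar> < r \<longrightarrow> (\<exists>s. limitin A_topology (power_partial_sum a t) s sequentially))}"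
  then obtain r where r: "x = ereal r" "r \<ge> 0"
    "\<And>t. \<bar>t\<bar> < r \<Longrightarrow> \<exists>s. limitin A_topology (power_partial_sum a t) s sequentially" by blast
  show "x \<le> H_conv_radius n a"
  proof (rule ccontr)
    assume "\<not> x \<le> H_conv_radius n a"
    then obtain s where s: "H_conv_radius n a < ereal s" "s < r" using ereal_dense2 r(1) by (metis less_ereal.simps(1) not_le)
    have s0: "s > 0" using le_less_trans[OF H_conv_radius_nonneg s(1)] by simp
    obtain l where "limitin A_topology (power_partial_sum a s) l sequentially" using r(3)[of s] s s0 by auto
    then obtain K \<sigma> where K: "\<sigma> > 0" "\<And>j. exp_decay (K * (1 / s) ^ j) \<sigma> (a j)"
      using A_convergent_terms_decay[of a s l] a s0 by auto
    obtain C where C: "\<And>K v. v \<in> Asp \<Longrightarrow> exp_decay K \<sigma> v \<Longrightarrow> Hnorm n v \<le> C * K"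
      using exp_decay_Hnorm[OF K(1) n] by blast
    have "ereal s \<le> H_conv_radius n a"
    proof (rule H_conv_radius_ge[OF s0])
      show "Hnorm n (a j) \<le> C * K * (1 / s) ^ j" for j using C[OF a K(2), of j] by simp
    qed
    then show False using s(1) by simp
  qed
qed

lemma Hnorm_partial_sum_tail:
  assumes a: "\<And>j. a j \<in> Asp" and n: "n > 0" and b: "\<And>j. Hnorm n (a j) \<le> K * (1 / R) ^ j" and t: "\<bar>t\<bar> < R"
  shows "Hnorm n (\<lambda>k. power_partial_sum a t (N + m) k - power_partial_sum a t N k)
    \<le> (\<Sum>j = N..<N + m. K * (\<bar>t\<bar> / R) ^ j)"
proof (induction m)
  case 0
  then show ?case by (simp add: Hnorm_def)
next
  case (Suc m)
  let ?d = "\<lambda>m k. power_partial_sum a t (N + m) k - power_partial_sum a t N k"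
  have ps: "power_partial_sum a s M \<in> Asp" for s M by (rule power_partial_sum_Asp[OF a])
  have d: "?d m \<in> Asp" for m
    using Asp_lincomb[OF ps ps, of 1 t "N + m" "- 1" t N]
    by (simp add: lincomb_def)
  have dS: "?d (Suc m) = lincomb 1 (?d m) (t ^ (N + m)) (a (N + m))"
    by (rule ext) (simp add: lincomb_def power_partial_sum_def)
  have "Hnorm n (?d (Suc m)) \<le> \<bar>1\<bar> * Hnorm n (?d m) + \<bar>t ^ (N + m)\<bar> * Hnorm n (a (N + m))"
    by (subst dS) (rule Hnorm_lincomb_le[OF d a n])
  also have "\<dots> \<le> (\<Sum>j = N..<N + m. K * (\<bar>t\<bar> / R) ^ j) + \<bar>t\<bar> ^ (N + m) * (K * (1 / R) ^ (N + m))"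
    using Suc b[of "N + m"] by (intro add_mono) (auto simp: power_abs intro!: mult_left_mono)
  also have "\<bar>t\<bar> ^ (N + m) * (K * (1 / R) ^ (N + m)) = K * (\<bar>t\<bar> / R) ^ (N + m)"
    by (simp add: power_divide)
  finally show ?case by simp
qed

text \<open>The sum is known only coefficient by coefficient. On finitely many frequencies the
  geometric bound for differences of partial sums passes to the limit, and
  \<open>Hnorm_le_finite\<close> removes the finiteness.\<close>

lemma Hnorm_series_tail:
  assumes a: "\<And>j. a j \<in> Asp" and n: "n > 0" and b: "\<And>j. Hnorm n (a j) \<le> K * (1 / R) ^ j" and t: "\<bar>t\<bar> < R"
    and v: "v \<in> Asp" and s: "\<And>k. (\<lambda>j. t ^ j *\<^sub>R a j k) sums v k"
  shows "Hnorm n (\<lambda>k. v k - power_partial_sum a t N k) \<le> K * (\<bar>t\<bar> / R) ^ N / (1 - \<bar>t\<bar> / R)"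
proof -
  let ?y = "\<bar>t\<bar> / R"
  have y: "0 \<le> ?y" "?y < 1" using t by auto
  have nn: "0 \<le> Hnorm n w" for w by (simp add: Hnorm_eq_l2)
  have K: "K \<ge> 0" using order_trans[OF nn b[of 0]] by simp
  let ?d = "\<lambda>m k. power_partial_sum a t (N + m) k - power_partial_sum a t N k"
  have ps: "power_partial_sum a s M \<in> Asp" for s M by (rule power_partial_sum_Asp[OF a])
  have d: "?d m \<in> Asp" for m
    using Asp_lincomb[OF ps ps, of 1 t "N + m" "- 1" t N]
    by (simp add: lincomb_def)
  have "Hnorm n (?d m) \<le> K * ?y ^ N / (1 - ?y)" for m
  proof -
    have "(\<Sum>j = N..<N + m. K * ?y ^ j) = K * ?y ^ N * (\<Sum>j<m. ?y ^ j)"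
      using sum.shift_bounds_nat_ivl[of "\<lambda>j. K * ?y ^ j" 0 N m]
      by (simp add: add.commute power_add sum_distrib_left lessThan_atLeast0 mult_ac)
    also have "\<dots> \<le> K * ?y ^ N * (1 / (1 - ?y))"
    proof (rule mult_left_mono)
      have "(\<Sum>j<m. ?y ^ j) \<le> (\<Sum>j. ?y ^ j)"
        by (rule sum_le_suminf) (use y in \<open>auto intro!: summable_geometric zero_le_power\<close>)
      then show "(\<Sum>j<m. ?y ^ j) \<le> 1 / (1 - ?y)" using y by (simp add: suminf_geometric)
    qed (use K y in auto)
    finally have "(\<Sum>j = N..<N + m. K * ?y ^ j) \<le> K * ?y ^ N / (1 - ?y)" by simp
    then show ?thesis using Hnorm_partial_sum_tail[OF a n b t, of N m] by linarith
  qed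
  then have L: "L2_set (\<lambda>k. freq_norm k powr n * norm (?d m k)) F \<le> K * ?y ^ N / (1 - ?y)" if "finite F" for F m
    using L2_set_le_Hnorm[OF d n that] order_trans by blast
  have "lincomb 1 v (- 1) (power_partial_sum a t N) \<in> Asp"
    by (rule Asp_lincomb[OF v power_partial_sum_Asp[OF a]])
  then have vA: "(\<lambda>k. v k - power_partial_sum a t N k) \<in> Asp" by (simp add: lincomb_def)
  show ?thesis
  proof (rule Hnorm_le_finite[OF vA n])
    fix F :: "freq set" assume F: "finite F"
    have lim: "(\<lambda>m. ?d m k) \<longlonglongrightarrow> v k - power_partial_sum a t N k" for k
    proof (intro tendsto_diff tendsto_const)
      have "(\<lambda>m. power_partial_sum a t m k) \<longlonglongrightarrow> v k" using s[of k] by (simp add: sums_def power_partial_sum_def)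
      then show "(\<lambda>m. power_partial_sum a t (N + m) k) \<longlonglongrightarrow> v k"
        using LIMSEQ_ignore_initial_segment[of _ _ N] by (simp add: add.commute)
    qed
    have "(\<lambda>m. L2_set (\<lambda>k. freq_norm k powr n * norm (?d m k)) F)
        \<longlonglongrightarrow> L2_set (\<lambda>k. freq_norm k powr n * norm (v k - power_partial_sum a t N k)) F"
      unfolding L2_set_def by (intro tendsto_intros lim)
    then show "L2_set (\<lambda>k. freq_norm k powr n * norm (v k - power_partial_sum a t N k)) F \<le> K * ?y ^ N / (1 - ?y)"
      by (rule LIMSEQ_le_const2) (use L[OF F] in blast)
  qed
qed

section \<open>The power series of the solution\<close>

text \<open>Restricting a field to one frequency makes the identity theorem applicable to a series that is not yet known to have analytic values.\<close>

definition single_mode :: "freq \<Rightarrow> vfield \<Rightarrow> vfield" where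
  "single_mode k v = (\<lambda>l. if l = k then v k else 0)"

lemma locally_analytic_single_mode:
  assumes "locally_analytic u t"
  shows "locally_analytic (\<lambda>t. single_mode k (u t)) t"
proof -
  obtain r \<sigma> K c where E: "expansion_at r \<sigma> K c u t" using assms by (auto simp: locally_analytic_def)
  have K: "K \<ge> 0" by (rule expansion_K[OF E])
  have "expansion_at r \<sigma> K (\<lambda>i. single_mode k (c i)) (\<lambda>t. single_mode k (u t)) t"
    using E K by (auto simp: expansion_at_def exp_decay_def single_mode_def)
  then show ?thesis by (auto simp: locally_analytic_def)
qed

lemma solution_eq_power_series:
  assumes sol: "analytic_solution_on (time_dom Tm Tp) u" and T: "0 < Tm" "0 < Tp"
    and E: "expansion_at r \<sigma> L a u 0" and a: "\<And>j. a j \<in> Asp" and n: "n > 0"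
    and b: "\<And>j. Hnorm n (a j) \<le> K * (1 / R) ^ j" and t: "\<bar>t\<bar> < R" "t \<in> time_dom Tm Tp"
  shows "(\<lambda>j. t ^ j *\<^sub>R a j k) sums u t k"
proof -
  have R: "R > 0" using t by simp
  have nn: "0 \<le> Hnorm n w" for w by (simp add: Hnorm_eq_l2)
  have K: "K \<ge> 0" using order_trans[OF nn b[of 0]] by simp
  have ab: "norm (a j k) \<le> K * (1 / R) ^ j" for j
    using norm_coeff_le_Hnorm[OF a n] b order_trans by blast
  define v :: "real \<Rightarrow> vfield" where "v = (\<lambda>t k. \<Sum>j. t ^ j *\<^sub>R a j k)"
  have vs: "(\<lambda>j. s ^ j *\<^sub>R a j k) sums v s k" if s: "\<bar>s\<bar> < R" for s
  proof -
    have "summable (\<lambda>j. norm (s ^ j *\<^sub>R a j k))"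
    proof (rule geometric_summable_norm[where M = K and y = "\<bar>s\<bar> / R"])
      fix j
      have "norm (s ^ j *\<^sub>R a j k) \<le> \<bar>s\<bar> ^ j * (K * (1 / R) ^ j)"
        unfolding norm_scaleR power_abs by (intro mult_left_mono ab) auto
      then show "norm (s ^ j *\<^sub>R a j k) \<le> K * (\<bar>s\<bar> / R) ^ j"
        by (simp add: power_divide mult.commute)
    qed (use s R in auto)
    then show ?thesis unfolding v_def by (rule summable_sums[OF summable_norm_cancel])
  qed
  define w where "w = (\<lambda>t. single_mode k (v t))"
  \<comment> \<open>The H^n bounds on the \<open>a j\<close> give no exponential decay in the
    frequency. With a single nonzero mode, the rate 1 is obtained by putting
    \<open>exp (freq_l1 k)\<close> into the constant.\<close>
  have Ew: "expansion_at R 1 (K * exp (freq_l1 k)) (\<lambda>j. single_mode k (a j)) w 0"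
    unfolding expansion_at_def
  proof (intro conjI allI impI R)
    fix j
    have "norm (a j k) \<le> K * exp (freq_l1 k) * (1 / R) ^ j * exp (- 1 * freq_l1 k)"
      using ab[of j] by (simp add: mult.assoc mult.left_commute[of "exp (freq_l1 k)"] exp_add[symmetric])
    then show "exp_decay (K * exp (freq_l1 k) * (1 / R) ^ j) 1 (single_mode k (a j))"
      using K R by (simp add: exp_decay_def single_mode_def)
  next
    fix s :: real and l assume "\<bar>s - 0\<bar> < R"
    then show "(\<lambda>i. (s - 0) ^ i *\<^sub>R single_mode k (a i) l) sums w s l"
      using vs by (simp add: w_def single_mode_def)
  qed simp
  let ?I = "time_dom Tm Tp \<inter> ball 0 R"
  have "single_mode k (u t) k = w t k"
  proof (rule locally_analytic_identity[of ?I "\<lambda>t. single_mode k (u t)" w 0 "min r R"])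
    show "open ?I" by (intro open_Int open_time_dom open_ball)
    show "connected ?I"
      unfolding is_interval_connected_1[symmetric]
      by (intro is_interval_Int) (simp_all add: is_interval_connected_1 connected_time_dom)
    show "locally_analytic (\<lambda>t. single_mode k (u t)) s" if "s \<in> ?I" for s
      using that sol by (intro locally_analytic_single_mode) (auto simp: analytic_solution_on_def)
    show "locally_analytic w s" if "s \<in> ?I" for s
      using that by (intro expansion_recentre[OF Ew]) (auto simp: dist_real_def)
    show "0 \<in> ?I" using T R by (simp add: time_dom_def zero_ereal_def[symmetric] ereal_uminus_less_reorder)
    show "min r R > 0" using E R by (simp add: expansion_at_def)
    show "t \<in> ?I" using t by (simp add: dist_real_def)
    fix s assume s: "\<bar>s - 0\<bar> < min r R"
    have "(\<lambda>j. s ^ j *\<^sub>R a j k) sums u s k" using E s by (auto simp: expansion_at_def)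
    moreover have "(\<lambda>j. s ^ j *\<^sub>R a j k) sums v s k" using vs s by simp
    ultimately show "single_mode k (u s) k = w s k" by (simp add: single_mode_def w_def sums_unique2)
  qed
  then show ?thesis using vs[OF t(1)] by (simp add: single_mode_def w_def)
qed

lemma time_dom_0: "0 < Tm \<Longrightarrow> 0 < Tp \<Longrightarrow> 0 \<in> time_dom Tm Tp"
  by (simp add: time_dom_def zero_ereal_def[symmetric] ereal_uminus_less_reorder)

lemma maximal_A_solution_power_series:
  assumes n: "n > 5 / 2" and max: "maximal_A_solution u\<^sub>0 Tm Tp u"
    and E: "expansion_at r \<sigma> L a u 0" and a: "\<And>j. a j \<in> Asp"
  shows "H_conv_radius n a \<le> min Tm Tp"
proof -
  have n0: "n > 0" using n by simp
  have A: "A_solution u\<^sub>0 Tm Tp u" using max by (simp add: maximal_A_solution_def)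
  have T: "0 < Tm" "0 < Tp" and u0: "u 0 = u\<^sub>0" using A by (auto simp: A_solution_def)
  have sol: "analytic_solution_on (time_dom Tm Tp) u" by (rule A_solution_imp_analytic_solution[OF A])
  have maxD: "Tm' = Tm \<and> Tp' = Tp" if "analytic_solution_on (time_dom Tm' Tp') u'" "Tm \<le> Tm'" "Tp \<le> Tp'"
    "\<And>t. t \<in> time_dom Tm Tp \<Longrightarrow> u' t = u t" for Tm' Tp' u'
  proof -
    have "A_solution (u' 0) Tm' Tp' u'"
      by (rule analytic_solution_imp_A_solution[OF that(1)]) (use T that(2,3) less_le_trans in blast)+
    moreover have "u' 0 = u\<^sub>0" using that(4)[OF time_dom_0[OF T]] u0 by simp
    ultimately show ?thesis using max that(2-4) unfolding maximal_A_solution_def by blast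
  qed
  \<comment> \<open>Since \<open>T'\<close> lies strictly below the H^n radius, the terms are still
    bounded with some radius \<open>R\<close> above \<open>T'\<close>, and the geometric majorant
    stays bounded for all |t| < \<open>T'\<close>. Nothing is assumed here about the relation of
    \<open>T'\<close> to the domain of \<open>u\<close>.\<close>
  have bound: "\<exists>M. \<forall>t\<in>time_dom Tm Tp. \<bar>t\<bar> < T' \<longrightarrow> Hnorm n (u t) \<le> M" if T': "ereal T' < H_conv_radius n a" "T' > 0" for T'
  proof -
    obtain R K where R: "\<bar>T'\<bar> < R" "\<And>j. Hnorm n (a j) \<le> K * (1 / R) ^ j"
      using H_conv_radius_bound[of T' n a] T' by auto
    have nn: "0 \<le> Hnorm n w" for w by (simp add: Hnorm_eq_l2)
    have K: "K \<ge> 0" using order_trans[OF nn R(2)[of 0]] by simp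
    have "Hnorm n (u t) \<le> K / (1 - T' / R)" if t: "t \<in> time_dom Tm Tp" "\<bar>t\<bar> < T'" for t
    proof -
      have tR: "\<bar>t\<bar> < R" using t R T' by simp
      have ut: "u t \<in> Asp" using sol t by (simp add: analytic_solution_on_def)
      have "Hnorm n (u t) \<le> K / (1 - \<bar>t\<bar> / R)"
        using Hnorm_series_tail[OF a n0 R(2) tR ut solution_eq_power_series[OF sol T E a n0 R(2) tR t(1)], of 0]
        by (simp add: power_partial_sum_def)
      also have "\<dots> \<le> K / (1 - T' / R)"
      proof -
        have "\<bar>t\<bar> / R \<le> T' / R" "T' / R < 1" using t R T' by (auto intro!: divide_right_mono)
        then show ?thesis using K by (intro divide_left_mono mult_pos_pos) auto
      qed
      finally show ?thesis .
    qed
    then show ?thesis by blast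
  qed
  have "H_conv_radius n a \<le> Tp"
  proof (rule ccontr)
    assume neg: "\<not> H_conv_radius n a \<le> Tp"
    then obtain T' where T': "Tp = ereal T'" using T(2) by (cases Tp) auto
    then have T'0: "T' > 0" and lt: "ereal T' < H_conv_radius n a" using T neg by auto
    obtain M where M: "\<forall>t\<in>time_dom Tm Tp. \<bar>t\<bar> < T' \<longrightarrow> Hnorm n (u t) \<le> M" using bound[OF lt T'0] by blast
    have "Hnorm n (u t) \<le> M" if "0 \<le> t" "t < T'" for t
    proof -
      have "t \<in> time_dom Tm Tp"
        using connected_time_dom time_dom_0[OF T] that T(1) unfolding time_dom_def T'
        by (auto intro: less_le_trans[of _ 0] simp: ereal_uminus_less_reorder)
      then show ?thesis using M that by simp
    qed
    then obtain T'' u' where "T' < T''" "analytic_solution_on (time_dom Tm (ereal T'')) u'" "\<forall>t\<in>time_dom Tm (ereal T'). u' t = u t"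
      using analytic_solution_continuation[OF sol[unfolded T'] T(1) T'0 n] by blast
    then show False using maxD[of Tm "ereal T''" u'] T' by simp
  qed
  moreover have "H_conv_radius n a \<le> Tm"
  proof (rule ccontr)
    assume neg: "\<not> H_conv_radius n a \<le> Tm"
    then obtain T' where T': "Tm = ereal T'" using T(1) by (cases Tm) auto
    then have T'0: "T' > 0" and lt: "ereal T' < H_conv_radius n a" using T neg by auto
    obtain M where M: "\<forall>t\<in>time_dom Tm Tp. \<bar>t\<bar> < T' \<longrightarrow> Hnorm n (u t) \<le> M" using bound[OF lt T'0] by blast
    let ?w = "time_reversal u"
    have solw: "analytic_solution_on (time_dom Tp (ereal T')) ?w"
      using analytic_solution_time_reversal[OF sol] by (simp add: uminus_time_dom T')
    have "Hnorm n (?w t) \<le> M" if "0 \<le> t" "t < T'" for t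
    proof -
      have "- t \<in> time_dom Tm Tp"
        using that T(2) unfolding time_dom_def T'
        by (auto intro: le_less_trans[of _ 0])
      then have "Hnorm n (u (- t)) \<le> M" using M that by simp
      then show ?thesis by (simp add: Hnorm_def time_reversal_def)
    qed
    then obtain T'' u' where u': "T' < T''" "analytic_solution_on (time_dom Tp (ereal T'')) u'" "\<forall>t\<in>time_dom Tp (ereal T'). u' t = ?w t"
      using analytic_solution_continuation[OF solw T(2) T'0 n] by blast
    have "analytic_solution_on (time_dom (ereal T'') Tp) (time_reversal u')"
      using analytic_solution_time_reversal[OF u'(2)] by (simp add: uminus_time_dom)
    moreover have "time_reversal u' t = u t" if "t \<in> time_dom Tm Tp" for t
    proof -
      have "- t \<in> time_dom Tp (ereal T')" using that uminus_time_dom[of Tm Tp] T' by auto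
      then have "u' (- t) = ?w (- t)" using u'(3) by blast
      then show ?thesis by (simp add: time_reversal_def)
    qed
    ultimately show False using maxD[of "ereal T''" Tp "time_reversal u'"] u'(1) T' by simp
  qed
  ultimately show ?thesis by simp
qed

theorem mainTheorem2:
  fixes n :: real and u\<^sub>0 :: vfield and u :: "real \<Rightarrow> vfield"
    and Tm Tp :: ereal and a :: "nat \<Rightarrow> vfield"
  assumes n: "n > 5 / 2"
    and u0: "u\<^sub>0 \<in> Asp"
    and sol: "maximal_A_solution u\<^sub>0 Tm Tp u"
    and a_0: "a 0 = u\<^sub>0"
    and a_rec: "\<And>j. j \<ge> 1 \<Longrightarrow>
      a j = (\<lambda>k. (1 / real j) *\<^sub>R (\<Sum>l = 0..j - 1. euler_P (a l) (a (j - l - 1)) k))"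
  shows "A_conv_radius a \<le> H_conv_radius n a
    \<and> H_conv_radius n a \<le> min Tm Tp
    \<and> (\<forall>t. ereal \<bar>t\<bar> < H_conv_radius n a \<longrightarrow> H_tendsto n (power_partial_sum a t) (u t))"
proof -
  have n0: "n > 0" using n by simp
  have A: "A_solution u\<^sub>0 Tm Tp u" using sol by (simp add: maximal_A_solution_def)
  have T: "0 < Tm" "0 < Tp" and u_0: "u 0 = u\<^sub>0" using A by (auto simp: A_solution_def)
  have an: "analytic_solution_on (time_dom Tm Tp) u" by (rule A_solution_imp_analytic_solution[OF A])
  have rec: "euler_recursion a"
    unfolding euler_recursion_def
  proof
    fix j
    show "a (Suc j) = (\<lambda>k. (1 / real (Suc j)) *\<^sub>R (\<Sum>l\<le>j. euler_P (a l) (a (j - l)) k))"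
      using a_rec[of "Suc j"] by (simp add: atMost_atLeast0)
  qed
  have a: "a j \<in> Asp" for j by (rule euler_recursion_Asp[OF rec]) (simp add: a_0 u0)
  obtain r \<sigma> L c where c: "expansion_at r \<sigma> L c u 0" "euler_recursion c"
    using analytic_solution_recursion[OF an open_time_dom time_dom_0[OF T]] by metis
  \<comment> \<open>The link between the given series and the solution: the Taylor coefficients of
    \<open>u\<close> at time 0 satisfy the same recursion with the same initial value.\<close>
  have "c = a"
    by (rule euler_recursion_unique[OF c(2) rec]) (use expansion_at_centre[OF c(1)] a_0 u_0 in simp)
  then have E: "expansion_at r \<sigma> L a u 0" using c(1) by simp
  have H: "H_conv_radius n a \<le> min Tm Tp" by (rule maximal_A_solution_power_series[OF n sol E a])
  have "H_tendsto n (power_partial_sum a t) (u t)" if t: "ereal \<bar>t\<bar> < H_conv_radius n a" for t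
  proof -
    have "ereal \<bar>t\<bar> < Tm" "ereal \<bar>t\<bar> < Tp" using less_le_trans[OF t H] by auto
    moreover have "ereal t \<le> ereal \<bar>t\<bar>" "- ereal t \<le> ereal \<bar>t\<bar>" by auto
    ultimately have "ereal t < Tp" "- ereal t < Tm" using le_less_trans by blast+
    moreover from this(2) have "- Tm < ereal t" by (subst ereal_uminus_less_reorder)
    ultimately have tI: "t \<in> time_dom Tm Tp" by (simp add: time_dom_def)
    have ut: "u t \<in> Asp" using an tI by (simp add: analytic_solution_on_def)
    obtain R K where R: "\<bar>t\<bar> < R" "\<And>j. Hnorm n (a j) \<le> K * (1 / R) ^ j"
      using H_conv_radius_bound[OF t] by auto
    have nn: "0 \<le> Hnorm n w" for w by (simp add: Hnorm_eq_l2)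
    have tail: "Hnorm n (lincomb 1 (power_partial_sum a t N) (- 1) (u t)) \<le> K * (\<bar>t\<bar> / R) ^ N / (1 - \<bar>t\<bar> / R)" for N
    proof -
      have "Hnorm n (lincomb 1 (power_partial_sum a t N) (- 1) (u t)) = Hnorm n (\<lambda>k. u t k - power_partial_sum a t N k)"
        by (simp add: Hnorm_def lincomb_def norm_minus_commute)
      then show ?thesis
        using Hnorm_series_tail[OF a n0 R(2,1) ut solution_eq_power_series[OF an T E a n0 R(2,1) tI], of N] by simp
    qed
    have "(\<lambda>N. (\<bar>t\<bar> / R) ^ N) \<longlonglongrightarrow> 0" using R(1) by (intro LIMSEQ_power_zero) auto
    then have "(\<lambda>N. K * (\<bar>t\<bar> / R) ^ N / (1 - \<bar>t\<bar> / R)) \<longlonglongrightarrow> K * 0 / (1 - \<bar>t\<bar> / R)"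
      by (intro tendsto_divide tendsto_mult tendsto_const) (use R(1) in auto)
    then have "(\<lambda>N. K * (\<bar>t\<bar> / R) ^ N / (1 - \<bar>t\<bar> / R)) \<longlonglongrightarrow> 0" by simp
    then have "(\<lambda>N. Hnorm n (lincomb 1 (power_partial_sum a t N) (- 1) (u t))) \<longlonglongrightarrow> 0"
      by (rule tendsto_sandwich[OF _ _ tendsto_const, rotated 2]) (use nn tail in auto)
    moreover have "power_partial_sum a t N \<in> Hsp n" for N
      by (rule Asp_Hsp[OF power_partial_sum_Asp[OF a] n0])
    ultimately show ?thesis unfolding H_tendsto_def using Asp_Hsp[OF ut n0] by blast
  qed
  moreover have "A_conv_radius a \<le> H_conv_radius n a"
    by (rule A_conv_radius_le_H_conv_radius[OF a n0])
  ultimately show ?thesis using H by blast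
qed

end
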